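(* Let $\gamma\in(0,1]$ and let $\{\breve x^k\},\{\widetilde x^k\},\{\bar x^k\},\{\lambda^k\}$ be generated, for $k\ge0$, by Algorithm 3 (given in the context). Define $$\bar\lambda^k:=\lambda^k-\gamma(1-\tau^k)\beta^k(A\breve x^{k-1}-b),\qquad \widetilde\lambda^k:=\bar\lambda^k-\tau^k\beta^k\Big(A_1\widetilde x_1^k+\sum_{j=2}^mA_j\bar x_j^k-b\Big),$$ $\widetilde u^k=(\widetilde x_1^k,\dots,\widetilde x_m^k,\widetilde\lambda^k)$, $v^k=(A_2\bar x_2^k,\dots,A_m\bar x_m^k,\bar\lambda^k)$, $\widetilde v^k=(A_2\widetilde x_2^k,\dots,A_m\widetilde x_m^k,\widetilde\lambda^k)$, and let $Q^k,M^k$ be the matrices defined in the context. The following hold. (i) Suppose $\beta^k=\beta/\tau^k$ for some $\beta>0$ and $1/\tau^{k-1}=(1-\tau^k)/\tau^k$ for $k\ge0$, $\tau^{-1}\in(0,1)$. Then for all $k\ge0$, with $c^k=(1-\gamma)(1-\tau^k)\beta^k$, $$\frac{1}{\tau^k}[f(x)-f(\breve x^k)]-\frac{1}{\tau^{k-1}}[f(x)-f(\breve x^{k-1})]+(u-\widetilde u^k)^TF(\widetilde u^k)+c^k(A(x-\widetilde x^k))^T(A\breve x^{k-1}-b)\ge (v-\widetilde v^k)^TQ^k(v^k-\widetilde v^k)\quad\forall u,$$ and $v^{k+1}=v^k-M^k(v^k-\widetilde v^k)$. Moreover there are matrices $H^k$ with $Q^k=H^kM^k$ such that, with $G^k:=(Q^k)^T+Q^k-(M^k)^TH^kM^k$,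 $H_0^k=\frac1\gamma\begin{pmatrix}\beta JJ^T&0\\0&\frac1\beta I_l\end{pmatrix}$ and some $\varTheta^k\ge0$ satisfying $\varTheta^{k+1}-\varTheta^k\ge(1-\gamma)\tau^k\beta^k\|A\widetilde x^k-b\|^2$, $$\|v^{k+1}-v'\|^2_{H^k}-\|v^k-v'\|^2_{H^k}+\|v^k-\widetilde v^k\|^2_{G^k}\ge\|v^{k+1}-v'\|^2_{H_0^{k+1}}-\|v^k-v'\|^2_{H_0^k}+\varTheta^{k+1}-\varTheta^k$$ for all $v'=(A_2x_2',\dots,A_mx_m',\lambda)$ with $x'\in\Omega$, $\lambda\in\mathbb{R}^l$. (ii) Suppose $f_m$ is $L$-gradient Lipschitz continuous, $\beta^k\equiv\beta>0$, $(1-\gamma)\beta\le1$, $\tau^k>0$, $1/(\tau^{k-1})^2=(1-\tau^k)/(\tau^k)^2$ for $k\ge0$, $\tau^{-1}\in(0,1)$, and $$\frac1{\beta(\tau^k)^2}+\frac{\sigma''}{\tau^k}\ge\frac1{\beta(\tau^{k+1})^2}+\frac{\sigma''(1-\gamma)}{\tau^{k+1}},\qquad \sigma''=\sigma'-\frac{\sigma'^2}{\sigma'+1},\quad\sigma'=\frac{\sigma_{\min}(A_mA_m^T)}{L}.$$ Then for all $k\ge0$, with $c^k=(1-\gamma)(1-\tau^k)\beta^k/\tau^k$, $\sigma=1/L$, $R=I_{n_m}$, $z=\nabla f_m(x_m)$, $z^k=\nabla f_m(\breve x_m^k)$, $$\frac{1}{(\tau^k)^2}[f(x)-f(\breve x^k)]-\frac{1}{(\tau^{k-1})^2}[f(x)-f(\breve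 x^{k-1})]+\frac1{\tau^k}(u-\widetilde u^k)^TF(\widetilde u^k)+c^k(A(x-\widetilde x^k))^T(A\breve x^{k-1}-b)$$ $$\ge\frac1{\tau^k}\Big[(v-\widetilde v^k)^TQ^k(v^k-\widetilde v^k)+\frac\sigma2\|z^k-z\|_R^2\Big]\quad\forall u,$$ and $v^{k+1}=v^k-M^k(v^k-\widetilde v^k)$. Moreover there are matrices $H^k$ with $Q^k=H^kM^k$ such that, with $G^k:=(Q^k)^T+Q^k-(M^k)^TH^kM^k$, $$H_0^k=\frac1\gamma\begin{pmatrix}\beta JJ^T&0\\0&\frac1{\beta(\tau^k)^2}I_l+\frac{\sigma''(1-\gamma)}{\tau^k}I_l\end{pmatrix}$$ and some $\varTheta^k\ge0$ satisfying $\varTheta^{k+1}-\varTheta^k\ge(1-\gamma)\beta^k\big(\|A\widetilde x^k-b\|^2-\frac{\tau^k}{(\tau^{k-1})^2}\|A\breve x^{k-1}-b\|^2\big)$, $$\frac1{\tau^k}\Big(\|v^{k+1}-v'\|^2_{H^k}+\sigma\|z^k-z'\|_R^2-\|v^k-v'\|^2_{H^k}+\|v^k-\widetilde v^k\|^2_{G^k}\Big)\ge\|v^{k+1}-v'\|^2_{H_0^{k+1}}-\|v^k-v'\|^2_{H_0^k}+\varTheta^{k+1}-\varTheta^k$$ in the special setting $z'=\nabla f_m(x_m^* )$ and $v'=v^*=(A_2x_2^*,\dots,A_mx_m^*,\lambda^* )$, where $(x^*,\lambda^* )$ is a saddle point of the Lagrangian.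
   Context: Problem (P3): minimize $f(x)=\sum_{i=1}^mf_i(x_i)$ subject to $Ax:=\sum_{i=1}^mA_ix_i=b$, $m\ge2$, $f_i:\mathbb{R}^{n_i}\to\mathbb{R}$ closed proper convex, $A_i\in\mathbb{R}^{l\times n_i}$, $b\in\mathbb{R}^l$, $\Omega=\{x:Ax=b\}$. A saddle point $(x^*,\lambda^* )$ of $L(x,\lambda)=f(x)-\lambda^T(Ax-b)$ satisfies $L(x^*,\lambda)\le L(x^*,\lambda^* )\le L(x,\lambda^* )$ for all $x,\lambda$. $u=(x_1,\dots,x_m,\lambda)$, $v=(A_2x_2,\dots,A_mx_m,\lambda)$, $F(u)=(-A_1^T\lambda,\dots,-A_m^T\lambda,Ax-b)$. $\|w\|_D^2:=w^TDw$; $\sigma_{\min}$ denotes smallest eigenvalue. A function $g$ is $L$-gradient Lipschitz continuous ($L>0$) if it is differentiable and $g(y)\le g(x)+\langle\nabla g(x),y-x\rangle+\frac L2\|y-x\|^2$ for all $x,y$ (for convex $g$, equivalently $g(y)\ge g(x)+\langle\nabla g(x),y-x\rangle+\frac1{2L}\|\nabla g(x)-\nabla g(y)\|^2$). Let $\beta^k>0$ and $\varphi^k(x_1,\dots,x_m,\lambda):=-\lambda^T(\sum_iA_ix_i-b)+\frac{\beta^k}2\|\sum_iA_ix_i-b\|^2$. Matrices: $J\in\mathbb{R}^{(m-1)l\times(m-1)l}$ is the block lower triangular matrix whose $(i,j)$ block is $I_l$ for $i\ge j$ and $0$ for $i<j$; $\widetilde I=(I_l,\dots,I_l)\in\mathbb{R}^{l\times(m-1)l}$;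 $P^k=\begin{pmatrix}\sqrt{\tau^k\beta^k}J&0\\0&\frac1{\sqrt{\tau^k\beta^k}}I_l\end{pmatrix}$, $N^k=\gamma\begin{pmatrix}\sqrt{\tau^k\beta^k}I_{(m-1)l}&0\\-\sqrt{\tau^k\beta^k}\widetilde I&\frac1{\sqrt{\tau^k\beta^k}}I_l\end{pmatrix}$, $Q^k=\begin{pmatrix}\tau^k\beta^kJ&0\\-\widetilde I&\frac1{\tau^k\beta^k}I_l\end{pmatrix}$, $M^k=(P^k)^{-T}N^k$. Algorithm 3 (given $\breve x^{-1},\bar x^0,\lambda^0$; minimizers are assumed to exist): for $k\ge0$, - $\hat x^k=(1-\tau^k)\breve x^{k-1}+\tau^k\bar x^k$; - $\breve x_1^k\in\arg\min_{x_1}\{f_1(x_1)+x_1^T\nabla_{x_1}\varphi^k(\hat x_1^k,\dots,\hat x_m^k,\lambda^k)+\frac{\beta^k}2\|x_1-\hat x_1^k\|^2_{A_1^TA_1}\}$; - for $j=2,\dots,m$: $\breve x_j^k\in\arg\min_{x_j}\{f_j(x_j)+x_j^T\nabla_{x_j}\varphi^k(\breve x_1^k,\dots,\breve x_{j-1}^k,\hat x_j^k,\dots,\hat x_m^k,\lambda^k)+\frac{\beta^k}2\|x_j-\hat x_j^k\|^2_{A_j^TA_j}\}$; - $\widetilde x^k=\breve x^k/\tau^k-(1-\tau^k)\breve x^{k-1}/\tau^k$; - $\bar x^{k+1}$ satisfies $\bar x_1^{k+1}=\bar x_1^k$ and $(A_j\bar x_j^{k+1})_{j=2}^m=(A_j\bar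 x_j^k)_{j=2}^m-\gamma J^{-T}\big(A_j\bar x_j^k-A_j\widetilde x_j^k\big)_{j=2}^m$ (block column vectors in $\mathbb{R}^{(m-1)l}$); - $\lambda^{k+1}=\lambda^k-\gamma[(1-\tau^k)\beta^k(A\breve x^{k-1}-b)-(1-\tau^{k+1})\beta^{k+1}(A\breve x^k-b)]-\gamma\tau^k\beta^k(A\widetilde x^k-b)$. *)

theory Defs
  imports
    Complex_Main
    "Jordan_Normal_Form.Gauss_Jordan_Elimination"
    "Jordan_Normal_Form.Char_Poly"
begin

text \<open>
  Since the block dimensions n_1, ..., n_m may differ, all vectors and matrices are those of
  Jordan_Normal_Form, with explicit carriers. A block vector (x_1, ..., x_m) is a function on
  indices of which only the values at 1, ..., m matter. Iteration counters are integers, so that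
  the index -1 can be written literally; every statement is restricted to counters k \<ge> 0.
\<close>

type_synonym bvec = "nat \<Rightarrow> real vec"


section \<open>Real functions on n-dimensional space\<close>

definition vnorm :: "real vec \<Rightarrow> real" where
  "vnorm x = sqrt (x \<bullet> x)"

definition convex_fun :: "nat \<Rightarrow> (real vec \<Rightarrow> real) \<Rightarrow> bool" where
  "convex_fun n g \<longleftrightarrow> (\<forall>x\<in>carrier_vec n. \<forall>y\<in>carrier_vec n. \<forall>t. 0 \<le> t \<and> t \<le> 1 \<longrightarrow>
     g ((1 - t) \<cdot>\<^sub>v x + t \<cdot>\<^sub>v y) \<le> (1 - t) * g x + t * g y)"

text \<open>A function is closed if its epigraph is closed, here in the (equivalent) sequential sense.\<close>

definition closed_fun :: "nat \<Rightarrow> (real vec \<Rightarrow> real) \<Rightarrow> bool" where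
  "closed_fun n g \<longleftrightarrow> (\<forall>X T x t.
     (\<forall>i::nat. X i \<in> carrier_vec n \<and> g (X i) \<le> T i) \<and> x \<in> carrier_vec n \<and>
     (\<lambda>i. vnorm (X i - x)) \<longlonglongrightarrow> 0 \<and> T \<longlonglongrightarrow> t \<longrightarrow> g x \<le> t)"

text \<open>Properness (never minus infinity, somewhere finite) is automatic for real-valued functions.\<close>

definition closed_proper_convex :: "nat \<Rightarrow> (real vec \<Rightarrow> real) \<Rightarrow> bool" where
  "closed_proper_convex n g \<longleftrightarrow> closed_fun n g \<and> convex_fun n g"

text \<open>Frechet differentiability at x with gradient d.\<close>

definition has_gradient :: "nat \<Rightarrow> (real vec \<Rightarrow> real) \<Rightarrow> real vec \<Rightarrow> real vec \<Rightarrow> bool" where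
  "has_gradient n g x d \<longleftrightarrow> d \<in> carrier_vec n \<and>
     (\<forall>e>0. \<exists>r>0. \<forall>y\<in>carrier_vec n. vnorm (y - x) < r \<longrightarrow>
        \<bar>g y - g x - d \<bullet> (y - x)\<bar> \<le> e * vnorm (y - x))"

definition gradient :: "nat \<Rightarrow> (real vec \<Rightarrow> real) \<Rightarrow> real vec \<Rightarrow> real vec" where
  "gradient n g x = (THE d. has_gradient n g x d)"

definition gradient_lipschitz :: "nat \<Rightarrow> real \<Rightarrow> (real vec \<Rightarrow> real) \<Rightarrow> bool" where
  "gradient_lipschitz n L g \<longleftrightarrow> L > 0 \<and>
     (\<forall>x\<in>carrier_vec n. \<exists>d. has_gradient n g x d) \<and>
     (\<forall>x\<in>carrier_vec n. \<forall>y\<in>carrier_vec n.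
        g y \<le> g x + gradient n g x \<bullet> (y - x) + L / 2 * (vnorm (y - x))\<^sup>2)"


section \<open>The separable problem\<close>

definition bspace :: "nat \<Rightarrow> (nat \<Rightarrow> nat) \<Rightarrow> bvec set" where
  "bspace m n = {x. \<forall>i\<in>{1..m}. x i \<in> carrier_vec (n i)}"

definition Asum :: "nat set \<Rightarrow> nat \<Rightarrow> (nat \<Rightarrow> real mat) \<Rightarrow> bvec \<Rightarrow> real vec" where
  "Asum S l A x = vec l (\<lambda>r. \<Sum>i\<in>S. (A i *\<^sub>v x i) $ r)"

definition Amul :: "nat \<Rightarrow> nat \<Rightarrow> (nat \<Rightarrow> real mat) \<Rightarrow> bvec \<Rightarrow> real vec" where
  "Amul m l A x = Asum {1..m} l A x"

definition problem_P3 ::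
  "nat \<Rightarrow> nat \<Rightarrow> (nat \<Rightarrow> nat) \<Rightarrow> (nat \<Rightarrow> real mat) \<Rightarrow> real vec \<Rightarrow> (nat \<Rightarrow> real vec \<Rightarrow> real) \<Rightarrow> bool"
where
  "problem_P3 m l n A b f \<longleftrightarrow> 2 \<le> m \<and> 1 \<le> l \<and> b \<in> carrier_vec l \<and>
     (\<forall>i\<in>{1..m}. 1 \<le> n i \<and> A i \<in> carrier_mat l (n i) \<and> closed_proper_convex (n i) (f i))"

definition obj :: "nat \<Rightarrow> (nat \<Rightarrow> real vec \<Rightarrow> real) \<Rightarrow> bvec \<Rightarrow> real" where
  "obj m f x = (\<Sum>i=1..m. f i (x i))"

definition feasible ::
  "nat \<Rightarrow> nat \<Rightarrow> (nat \<Rightarrow> nat) \<Rightarrow> (nat \<Rightarrow> real mat) \<Rightarrow> real vec \<Rightarrow> bvec set" where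
  "feasible m l n A b = {x \<in> bspace m n. Amul m l A x = b}"

definition Lagrangian ::
  "nat \<Rightarrow> nat \<Rightarrow> (nat \<Rightarrow> real mat) \<Rightarrow> real vec \<Rightarrow> (nat \<Rightarrow> real vec \<Rightarrow> real) \<Rightarrow> bvec \<Rightarrow> real vec \<Rightarrow> real"
where
  "Lagrangian m l A b f x \<mu> = obj m f x - \<mu> \<bullet> (Amul m l A x - b)"

definition saddle_point ::
  "nat \<Rightarrow> nat \<Rightarrow> (nat \<Rightarrow> nat) \<Rightarrow> (nat \<Rightarrow> real mat) \<Rightarrow> real vec \<Rightarrow> (nat \<Rightarrow> real vec \<Rightarrow> real)
    \<Rightarrow> bvec \<Rightarrow> real vec \<Rightarrow> bool"
where
  "saddle_point m l n A b f xs \<mu>s \<longleftrightarrow> xs \<in> bspace m n \<and> \<mu>s \<in> carrier_vec l \<and>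
     (\<forall>x\<in>bspace m n. \<forall>\<mu>\<in>carrier_vec l.
        Lagrangian m l A b f xs \<mu> \<le> Lagrangian m l A b f xs \<mu>s \<and>
        Lagrangian m l A b f xs \<mu>s \<le> Lagrangian m l A b f x \<mu>s)"

text \<open>The vectors u = (x_1, ..., x_m, \<mu>) are kept as pairs, with the product inner product.\<close>

definition u_diff :: "bvec \<times> real vec \<Rightarrow> bvec \<times> real vec \<Rightarrow> bvec \<times> real vec" where
  "u_diff u w = (\<lambda>i. fst u i - fst w i, snd u - snd w)"

definition u_inner :: "nat \<Rightarrow> bvec \<times> real vec \<Rightarrow> bvec \<times> real vec \<Rightarrow> real" where
  "u_inner m u w = (\<Sum>i=1..m. fst u i \<bullet> fst w i) + snd u \<bullet> snd w"

definition F_op ::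
  "nat \<Rightarrow> nat \<Rightarrow> (nat \<Rightarrow> real mat) \<Rightarrow> real vec \<Rightarrow> bvec \<times> real vec \<Rightarrow> bvec \<times> real vec" where
  "F_op m l A b u = (\<lambda>i. - (transpose_mat (A i) *\<^sub>v snd u), Amul m l A (fst u) - b)"

text \<open>The block column (w_2, ..., w_m), stacked into one vector of length (m - 1) l.\<close>

definition tail_stack :: "nat \<Rightarrow> nat \<Rightarrow> bvec \<Rightarrow> real vec" where
  "tail_stack m l w = vec ((m - 1) * l) (\<lambda>r. w (r div l + 2) $ (r mod l))"

text \<open>v = (A_2 x_2, ..., A_m x_m, \<mu>), a vector of length m l.\<close>

definition v_stack :: "nat \<Rightarrow> nat \<Rightarrow> (nat \<Rightarrow> real mat) \<Rightarrow> bvec \<Rightarrow> real vec \<Rightarrow> real vec" where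
  "v_stack m l A x \<mu> = tail_stack m l (\<lambda>j. A j *\<^sub>v x j) @\<^sub>v \<mu>"


section \<open>Matrices\<close>

text \<open>The square of the D-weighted (semi)norm; D need not be symmetric or definite.\<close>

definition wnormsq :: "real mat \<Rightarrow> real vec \<Rightarrow> real" where
  "wnormsq D w = w \<bullet> (D *\<^sub>v w)"

definition sigma_min :: "real mat \<Rightarrow> real" where
  "sigma_min B = Min {e. eigenvalue B e}"

text \<open>Entry (r, c) lies in block (r div l, c div l), at position (r mod l, c mod l).\<close>

definition J_mat :: "nat \<Rightarrow> nat \<Rightarrow> real mat" where
  "J_mat m l = mat ((m - 1) * l) ((m - 1) * l)
     (\<lambda>(r, c). if c div l \<le> r div l \<and> r mod l = c mod l then 1 else 0)"

definition I_row :: "nat \<Rightarrow> nat \<Rightarrow> real mat" where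
  "I_row m l = mat l ((m - 1) * l) (\<lambda>(r, c). if r = c mod l then 1 else 0)"

definition inv_mat :: "real mat \<Rightarrow> real mat" where
  "inv_mat B = the (mat_inverse B)"

definition P_mat :: "nat \<Rightarrow> nat \<Rightarrow> real \<Rightarrow> real \<Rightarrow> real mat" where
  "P_mat m l t \<beta> = four_block_mat
     (sqrt (t * \<beta>) \<cdot>\<^sub>m J_mat m l)   (0\<^sub>m ((m - 1) * l) l)
     (0\<^sub>m l ((m - 1) * l))            ((1 / sqrt (t * \<beta>)) \<cdot>\<^sub>m 1\<^sub>m l)"

definition N_mat :: "nat \<Rightarrow> nat \<Rightarrow> real \<Rightarrow> real \<Rightarrow> real \<Rightarrow> real mat" where
  "N_mat m l \<gamma> t \<beta> = \<gamma> \<cdot>\<^sub>m four_block_mat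
     (sqrt (t * \<beta>) \<cdot>\<^sub>m 1\<^sub>m ((m - 1) * l))   (0\<^sub>m ((m - 1) * l) l)
     ((- sqrt (t * \<beta>)) \<cdot>\<^sub>m I_row m l)      ((1 / sqrt (t * \<beta>)) \<cdot>\<^sub>m 1\<^sub>m l)"

definition Q_mat :: "nat \<Rightarrow> nat \<Rightarrow> real \<Rightarrow> real \<Rightarrow> real mat" where
  "Q_mat m l t \<beta> = four_block_mat
     ((t * \<beta>) \<cdot>\<^sub>m J_mat m l)   (0\<^sub>m ((m - 1) * l) l)
     (- I_row m l)              ((1 / (t * \<beta>)) \<cdot>\<^sub>m 1\<^sub>m l)"

definition M_mat :: "nat \<Rightarrow> nat \<Rightarrow> real \<Rightarrow> real \<Rightarrow> real \<Rightarrow> real mat" where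
  "M_mat m l \<gamma> t \<beta> = transpose_mat (inv_mat (P_mat m l t \<beta>)) * N_mat m l \<gamma> t \<beta>"

definition G_mat :: "real mat \<Rightarrow> real mat \<Rightarrow> real mat \<Rightarrow> real mat" where
  "G_mat Q M H = transpose_mat Q + Q - transpose_mat M * H * M"

text \<open>(1/\<gamma>) diag(\<beta> J J^T, s I_l).\<close>

definition H0_mat :: "nat \<Rightarrow> nat \<Rightarrow> real \<Rightarrow> real \<Rightarrow> real \<Rightarrow> real mat" where
  "H0_mat m l \<gamma> \<beta> s = (1 / \<gamma>) \<cdot>\<^sub>m four_block_mat
     (\<beta> \<cdot>\<^sub>m (J_mat m l * transpose_mat (J_mat m l)))   (0\<^sub>m ((m - 1) * l) l)
     (0\<^sub>m l ((m - 1) * l))                              (s \<cdot>\<^sub>m 1\<^sub>m l)"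

text \<open>The constants \<sigma>' and \<sigma>'', for B = A_m.\<close>

definition sigma1 :: "real mat \<Rightarrow> real \<Rightarrow> real" where
  "sigma1 B L = sigma_min (B * transpose_mat B) / L"

definition sigma2 :: "real mat \<Rightarrow> real \<Rightarrow> real" where
  "sigma2 B L = sigma1 B L - (sigma1 B L)\<^sup>2 / (sigma1 B L + 1)"


section \<open>The algorithm\<close>

definition phi ::
  "nat \<Rightarrow> nat \<Rightarrow> (nat \<Rightarrow> real mat) \<Rightarrow> real vec \<Rightarrow> real \<Rightarrow> bvec \<Rightarrow> real vec \<Rightarrow> real" where
  "phi m l A b \<beta> x \<mu> = - (\<mu> \<bullet> (Amul m l A x - b)) + \<beta> / 2 * (vnorm (Amul m l A x - b))\<^sup>2"

definition grad_phi ::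
  "nat \<Rightarrow> nat \<Rightarrow> (nat \<Rightarrow> nat) \<Rightarrow> (nat \<Rightarrow> real mat) \<Rightarrow> real vec \<Rightarrow> real \<Rightarrow> nat \<Rightarrow> bvec \<Rightarrow> real vec \<Rightarrow> real vec"
where
  "grad_phi m l n A b \<beta> j x \<mu> = gradient (n j) (\<lambda>y. phi m l A b \<beta> (x(j := y)) \<mu>) (x j)"

text \<open>
  In the subproblem for block j the gradient is taken at the point whose blocks before j are
  already updated (breve) and whose remaining blocks are extrapolated (hat); for j = 1 this is
  the fully extrapolated point, so that j = 1 needs no separate clause. For j \<ge> 2 the next xbar_j
  is only constrained through A_j xbar_j, so xbar need not be determined by its predecessors.
\<close>

definition algorithm3 ::
  "nat \<Rightarrow> nat \<Rightarrow> (nat \<Rightarrow> nat) \<Rightarrow> (nat \<Rightarrow> real mat) \<Rightarrow> real vec \<Rightarrow> (nat \<Rightarrow> real vec \<Rightarrow> real)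
    \<Rightarrow> real \<Rightarrow> (int \<Rightarrow> real) \<Rightarrow> (int \<Rightarrow> real)
    \<Rightarrow> (int \<Rightarrow> bvec) \<Rightarrow> (int \<Rightarrow> bvec) \<Rightarrow> (int \<Rightarrow> bvec) \<Rightarrow> (int \<Rightarrow> bvec) \<Rightarrow> (int \<Rightarrow> real vec) \<Rightarrow> bool"
where
  "algorithm3 m l n A b f \<gamma> \<tau> \<beta> xhat xbreve xtilde xbar lam \<longleftrightarrow>
     xbreve (-1) \<in> bspace m n \<and> xbar 0 \<in> bspace m n \<and> lam 0 \<in> carrier_vec l \<and>
     (\<forall>k\<ge>0. \<beta> k > 0) \<and>
     (\<forall>k\<ge>0.
        (\<forall>i\<in>{1..m}. xhat k i = (1 - \<tau> k) \<cdot>\<^sub>v xbreve (k - 1) i + \<tau> k \<cdot>\<^sub>v xbar k i) \<and>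
        (\<forall>j\<in>{1..m}.
           is_arg_min
             (\<lambda>y. f j y
                + y \<bullet> grad_phi m l n A b (\<beta> k) j
                        (\<lambda>i. if i < j then xbreve k i else xhat k i) (lam k)
                + \<beta> k / 2 * wnormsq (transpose_mat (A j) * A j) (y - xhat k j))
             (\<lambda>y. y \<in> carrier_vec (n j))
             (xbreve k j)) \<and>
        (\<forall>i\<in>{1..m}. xtilde k i =
           (1 / \<tau> k) \<cdot>\<^sub>v xbreve k i - ((1 - \<tau> k) / \<tau> k) \<cdot>\<^sub>v xbreve (k - 1) i) \<and>
        xbar (k + 1) \<in> bspace m n \<and>
        xbar (k + 1) 1 = xbar k 1 \<and>
        tail_stack m l (\<lambda>j. A j *\<^sub>v xbar (k + 1) j) =
          tail_stack m l (\<lambda>j. A j *\<^sub>v xbar k j)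
          - \<gamma> \<cdot>\<^sub>v (transpose_mat (inv_mat (J_mat m l))
                 *\<^sub>v tail_stack m l (\<lambda>j. A j *\<^sub>v xbar k j - A j *\<^sub>v xtilde k j)) \<and>
        lam (k + 1) =
          lam k
          - \<gamma> \<cdot>\<^sub>v (((1 - \<tau> k) * \<beta> k) \<cdot>\<^sub>v (Amul m l A (xbreve (k - 1)) - b)
                 - ((1 - \<tau> (k + 1)) * \<beta> (k + 1)) \<cdot>\<^sub>v (Amul m l A (xbreve k) - b))
          - (\<gamma> * \<tau> k * \<beta> k) \<cdot>\<^sub>v (Amul m l A (xtilde k) - b))"

end

theory Submission
  imports Defs
begin

text \<open>
  The blockwise optimality conditions of the subproblems show that \<open>A\<^sub>j\<^sup>T (lamtilde - c r + \<tau> \<beta> S\<^sub>j)\<close> is a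
  subgradient of \<open>f\<^sub>j\<close> at the new iterate, where \<open>r\<close> is the previous residual and \<open>S\<^sub>j\<close> sums the gaps
  \<open>A\<^sub>i (xbar\<^sub>i - xtilde\<^sub>i)\<close> over \<open>2 \<le> i \<le> j\<close>. Testing it with weights \<open>\<tau>\<close> and \<open>1 - \<tau>\<close> against \<open>x\<close> and the
  previous iterate and summing over the blocks gives the prediction inequalities; in part (ii) the
  last block contributes the additional cocoercivity term.

  The matrix \<open>H = \<gamma>\<^sup>-\<^sup>1 diag(\<tau> \<beta> J J\<^sup>T, (\<tau> \<beta>)\<^sup>-\<^sup>1 I)\<close> satisfies \<open>Q = H M\<close>, and \<open>G\<close> dominates \<open>(1 - \<gamma>) \<tau> \<beta>\<close>
  times the squared residual of \<open>xtilde\<close>. In part (i) \<open>H\<close> equals \<open>H\<^sub>0\<close>, so \<open>\<Theta>\<close> is the sum of these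
  residuals.

  In part (ii) the delicate point is the nonnegativity of \<open>\<Theta>\<close>, since the prescribed lower bounds for
  its increments can be negative. The growth condition on \<open>\<tau>\<close> forces \<open>1/\<beta> + \<sigma>'' (1 - \<gamma>) < \<sigma>''\<close>,
  hence \<open>A\<^sub>m A\<^sub>m\<^sup>T\<close> is positive definite and the optimal multiplier is unique. The increments of \<open>\<Theta>\<close> are
  chosen to be the exact gaps of the contraction inequality. They are bounded below by a multiple of
  \<open>- |lambar - \<mu>|\<^sup>2 / \<tau>\<close>, which is summable: the prediction inequality at the saddle point, combined with
  the lower bound for the increments, telescopes into a Lyapunov function whose decrease eventually
  dominates this quantity.
\<close>

section \<open>Vectors and quadratic forms\<close>

text \<open>In part (ii) a single \<open>\<Theta>\<close> has to serve every saddle point, since it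
  is chosen before them. The gap depends on a saddle point only through its multiplier, so
  uniqueness of the multiplier removes this dependence. With exact gaps as increments the
  contraction inequality becomes an equality, and the sum of the series of multiplier errors is a
  large enough initial value of \<open>\<Theta>\<close>. The recursion for \<open>\<tau>\<close>
  reads \<open>1/\<tau>(k+1)^2 = 1/\<tau>(k)^2 + 1/\<tau>(k+1)\<close>, so the growth condition
  collapses to \<open>rho/\<tau>(k+1) \<le> s2/\<tau>(k)\<close> with
  \<open>rho = 1/\<beta> + s2 (1 - \<gamma>)\<close>. As \<open>1/\<tau>\<close> increases strictly,
  \<open>rho < s2\<close>; as it is unbounded with increments at most 1, the coefficient
  \<open>(s2/\<tau>(k) - rho/\<tau>(k+1))/\<gamma>\<close> of the Lyapunov decrease is eventually
  comparable to \<open>1/\<tau>(k+1)\<close>. The prediction inequality contains a product of the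
  residual of \<open>xtilde\<close> and the previous residual, of unknown sign. Together with the
  prescribed lower bound for the increments of \<open>\<Theta>\<close> it telescopes into squared
  residuals divided by \<open>\<tau>^2\<close>, which become part of the Lyapunov function.\<close>

lemma dot_sum: "x \<in> carrier_vec n \<Longrightarrow> y \<in> carrier_vec n \<Longrightarrow> x \<bullet> y = (\<Sum>i<n. x $ i * y $ i)"
  by (simp add: scalar_prod_def lessThan_atLeast0)

lemma dot_add_left: "dim_vec x = dim_vec z \<Longrightarrow> dim_vec y = dim_vec z \<Longrightarrow> (x + y) \<bullet> z = x \<bullet> z + y \<bullet> (z::real vec)"
  by (simp add: scalar_prod_def sum.distrib algebra_simps)

lemma dot_minus_left: "dim_vec x = dim_vec z \<Longrightarrow> dim_vec y = dim_vec z \<Longrightarrow> (x - y) \<bullet> z = x \<bullet> z - y \<bullet> (z::real vec)"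
  by (simp add: scalar_prod_def sum_subtractf algebra_simps)

lemma dot_smult_left: "dim_vec x = dim_vec z \<Longrightarrow> (c \<cdot>\<^sub>v x) \<bullet> z = c * (x \<bullet> (z::real vec))"
  by (simp add: scalar_prod_def sum_distrib_left algebra_simps)

lemma dot_uminus_left: "dim_vec x = dim_vec z \<Longrightarrow> (- x) \<bullet> z = - (x \<bullet> (z::real vec))"
  by (simp add: scalar_prod_def sum_negf)

lemma dot_add_right: "dim_vec x = dim_vec z \<Longrightarrow> dim_vec y = dim_vec z \<Longrightarrow> z \<bullet> (x + y) = z \<bullet> x + z \<bullet> (y::real vec)"
  by (simp add: scalar_prod_def sum.distrib algebra_simps)

lemma dot_minus_right: "dim_vec x = dim_vec z \<Longrightarrow> dim_vec y = dim_vec z \<Longrightarrow> z \<bullet> (x - y) = z \<bullet> x - z \<bullet> (y::real vec)"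
  by (simp add: scalar_prod_def sum_subtractf algebra_simps)

lemma dot_smult_right: "dim_vec x = dim_vec z \<Longrightarrow> z \<bullet> (c \<cdot>\<^sub>v x) = c * (z \<bullet> (x::real vec))"
  by (simp add: scalar_prod_def sum_distrib_left algebra_simps)

lemma dot_uminus_right: "dim_vec x = dim_vec z \<Longrightarrow> z \<bullet> (- x) = - (z \<bullet> (x::real vec))"
  by (simp add: scalar_prod_def sum_negf)

lemmas dot_linear = dot_add_left dot_minus_left dot_smult_left dot_uminus_left
  dot_add_right dot_minus_right dot_smult_right dot_uminus_right

lemma dot_commute: "dim_vec x = dim_vec y \<Longrightarrow> x \<bullet> y = y \<bullet> (x::real vec)"
  by (simp add: scalar_prod_def mult.commute)

lemma dot_self_nonneg: "0 \<le> x \<bullet> (x::real vec)"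
  by (simp add: scalar_prod_def sum_nonneg)

lemma dot_self_eq_0: "x \<bullet> x = 0 \<longleftrightarrow> x = 0\<^sub>v (dim_vec (x::real vec))"
proof
  assume "x \<bullet> x = 0"
  then show "x = 0\<^sub>v (dim_vec x)" by (intro eq_vecI) (auto simp: scalar_prod_def sum_nonneg_eq_0_iff)
next
  assume "x = 0\<^sub>v (dim_vec x)"
  then show "x \<bullet> x = 0" by (metis scalar_prod_left_zero zero_carrier_vec)
qed

lemma vnorm_sq: "(vnorm x)\<^sup>2 = x \<bullet> x"
  by (simp add: vnorm_def dot_self_nonneg)

lemma vnorm_nonneg: "0 \<le> vnorm x"
  by (simp add: vnorm_def dot_self_nonneg)

lemma vnorm_smult: "vnorm (c \<cdot>\<^sub>v x) = \<bar>c\<bar> * vnorm x"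
  by (simp add: vnorm_def dot_linear real_sqrt_mult flip: mult.assoc power2_eq_square)

lemma discriminant_le:
  fixes a b c :: real
  assumes nn: "\<And>t. 0 \<le> a + 2 * t * b + t\<^sup>2 * c" and c: "0 \<le> c"
  shows "b\<^sup>2 \<le> a * c"
proof (cases "c = 0")
  case True
  have "b = 0"
  proof (rule ccontr)
    assume "b \<noteq> 0"
    \<comment> \<open>At this \<open>t\<close> the form, linear because \<open>c = 0\<close>, takes
      the value -1.\<close>
    then show False using nn[of "- (a + 1) / (2 * b)"] nn[of 0] True by (simp add: field_simps)
  qed
  then show ?thesis using True by simp
next
  case False
  then have "0 \<le> a - b\<^sup>2 / c"
    using nn[of "- b / c"] by (simp add: power2_eq_square field_simps)
  then show ?thesis using False c by (simp add: field_simps)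
qed

lemma Cauchy_Schwarz_dot:
  assumes "dim_vec x = dim_vec y"
  shows "(x \<bullet> y)\<^sup>2 \<le> (x \<bullet> x) * (y \<bullet> (y::real vec))"
proof (rule discriminant_le)
  fix t :: real
  have "x \<bullet> x + 2 * t * (x \<bullet> y) + t\<^sup>2 * (y \<bullet> y) = (x + t \<cdot>\<^sub>v y) \<bullet> (x + t \<cdot>\<^sub>v y)"
    using assms dot_commute[OF assms] by (simp add: dot_linear power2_eq_square algebra_simps)
  then show "0 \<le> x \<bullet> x + 2 * t * (x \<bullet> y) + t\<^sup>2 * (y \<bullet> y)"
    by (simp add: dot_self_nonneg)
qed (rule dot_self_nonneg)

lemma mult_mat_vec_bounded:
  fixes B :: "real mat"
  obtains K where "K \<ge> 0" "\<And>y. y \<in> carrier_vec (dim_col B) \<Longrightarrow> (B *\<^sub>v y) \<bullet> (B *\<^sub>v y) \<le> K * (y \<bullet> y)"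
proof
  \<comment> \<open>The squared Frobenius norm: Cauchy-Schwarz is applied to each row.\<close>
  let ?K = "\<Sum>i<dim_row B. row B i \<bullet> row B i"
  show "?K \<ge> 0" by (simp add: sum_nonneg dot_self_nonneg)
  fix y :: "real vec" assume y: "y \<in> carrier_vec (dim_col B)"
  have "(B *\<^sub>v y) \<bullet> (B *\<^sub>v y) = (\<Sum>i<dim_row B. (row B i \<bullet> y)\<^sup>2)"
    by (subst dot_sum[of _ "dim_row B"]) (auto simp: power2_eq_square intro: carrier_vecI)
  also have "\<dots> \<le> (\<Sum>i<dim_row B. (row B i \<bullet> row B i) * (y \<bullet> y))"
    using y by (intro sum_mono Cauchy_Schwarz_dot) auto
  finally show "(B *\<^sub>v y) \<bullet> (B *\<^sub>v y) \<le> ?K * (y \<bullet> y)" by (simp add: sum_distrib_right)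
qed

lemma dot_mult_mat_vec:
  "B \<in> carrier_mat l n \<Longrightarrow> y \<in> carrier_vec n \<Longrightarrow> w \<in> carrier_vec l \<Longrightarrow>
    (transpose_mat B *\<^sub>v w) \<bullet> y = w \<bullet> (B *\<^sub>v (y :: real vec))"
  by (metis transpose_vec_mult_scalar)

lemma mult_mat_vec_linear:
  fixes B :: "real mat"
  assumes "B \<in> carrier_mat l n"
  shows "x \<in> carrier_vec n \<Longrightarrow> y \<in> carrier_vec n \<Longrightarrow> B *\<^sub>v (x + y) = B *\<^sub>v x + B *\<^sub>v y"
    and "x \<in> carrier_vec n \<Longrightarrow> y \<in> carrier_vec n \<Longrightarrow> B *\<^sub>v (x - y) = B *\<^sub>v x - B *\<^sub>v y"
    and "x \<in> carrier_vec n \<Longrightarrow> B *\<^sub>v (c \<cdot>\<^sub>v x) = c \<cdot>\<^sub>v (B *\<^sub>v x)"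
  using assms by (simp_all add: mult_add_distrib_mat_vec mult_minus_distrib_mat_vec mult_mat_vec)

text \<open>The discriminant argument tolerates degenerate forms. This matters below, where the form
  of \<open>S - \<rho> I\<close> has infimum 0 on the unit sphere.\<close>

lemma psd_Cauchy_Schwarz:
  fixes S :: "real mat"
  assumes S: "S \<in> carrier_mat l l" and sym: "transpose_mat S = S"
    and psd: "\<And>y. y \<in> carrier_vec l \<Longrightarrow> 0 \<le> y \<bullet> (S *\<^sub>v y)"
    and x: "x \<in> carrier_vec l" and y: "y \<in> carrier_vec l"
  shows "(x \<bullet> (S *\<^sub>v y))\<^sup>2 \<le> (x \<bullet> (S *\<^sub>v x)) * (y \<bullet> (S *\<^sub>v y))"
proof (rule discriminant_le)
  fix t :: real
  have c: "y \<bullet> (S *\<^sub>v x) = x \<bullet> (S *\<^sub>v y)"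
    using dot_mult_mat_vec[OF S x y] S x y by (metis sym dot_commute mult_mat_vec_carrier carrier_vecD)
  have "x \<bullet> (S *\<^sub>v x) + 2 * t * (x \<bullet> (S *\<^sub>v y)) + t\<^sup>2 * (y \<bullet> (S *\<^sub>v y))
      = (x + t \<cdot>\<^sub>v y) \<bullet> (S *\<^sub>v (x + t \<cdot>\<^sub>v y))"
    using S x y c by (simp add: mult_mat_vec_linear[OF S] dot_linear power2_eq_square algebra_simps)
  then show "0 \<le> x \<bullet> (S *\<^sub>v x) + 2 * t * (x \<bullet> (S *\<^sub>v y)) + t\<^sup>2 * (y \<bullet> (S *\<^sub>v y))"
    using psd[of "x + t \<cdot>\<^sub>v y"] x y by simp
qed (rule psd[OF y])

section \<open>The smallest eigenvalue of a Gram matrix\<close>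

lemma eigenvalue_gram_nonneg:
  fixes B :: "real mat"
  assumes B: "B \<in> carrier_mat l n" and e: "eigenvalue (B * transpose_mat B) e"
  shows "0 \<le> e"
proof -
  from e obtain x where x: "x \<in> carrier_vec l" "x \<noteq> 0\<^sub>v l" and ev: "(B * transpose_mat B) *\<^sub>v x = e \<cdot>\<^sub>v x"
    using B by (auto simp: eigenvalue_def eigenvector_def)
  have "e * (x \<bullet> x) = x \<bullet> (e \<cdot>\<^sub>v x)" by (simp add: dot_linear)
  also have "e \<cdot>\<^sub>v x = B *\<^sub>v (transpose_mat B *\<^sub>v x)"
    using B x by (simp add: ev[symmetric] assoc_mult_mat_vec[of _ l n _ l])
  also have "x \<bullet> (B *\<^sub>v (transpose_mat B *\<^sub>v x)) = (transpose_mat B *\<^sub>v x) \<bullet> (transpose_mat B *\<^sub>v x)"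
    using B x by (intro dot_mult_mat_vec[symmetric]) auto
  finally have "0 \<le> e * (x \<bullet> x)" using dot_self_nonneg by metis
  moreover have "0 < x \<bullet> x" using x dot_self_eq_0[of x] dot_self_nonneg[of x] by auto
  ultimately show ?thesis by (simp add: zero_le_mult_iff)
qed

text \<open>The infimum \<open>\<rho>\<close> of the Rayleigh quotient is an eigenvalue even without an appeal to
  compactness: if \<open>S - \<rho> I\<close> were invertible, the Cauchy-Schwarz inequality for this
  semidefinite form would bound the form below by a positive multiple of the squared norm.\<close>

lemma Rayleigh_infimum_eigenvalue:
  fixes S :: "real mat"
  assumes S: "S \<in> carrier_mat l l" and l: "0 < l" and sym: "transpose_mat S = S"
    and psd: "\<And>y. y \<in> carrier_vec l \<Longrightarrow> 0 \<le> y \<bullet> (S *\<^sub>v y)"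
  obtains \<rho> where "eigenvalue S \<rho>" "\<And>y. y \<in> carrier_vec l \<Longrightarrow> \<rho> * (y \<bullet> y) \<le> y \<bullet> (S *\<^sub>v y)"
proof -
  define R where "R = {y \<bullet> (S *\<^sub>v y) | y. y \<in> carrier_vec l \<and> y \<bullet> y = 1}"
  define \<rho> where "\<rho> = Inf R"
  have "unit_vec l 0 \<bullet> (S *\<^sub>v unit_vec l 0) \<in> R" using l by (auto simp: R_def)
  then have ne: "R \<noteq> {}" by auto
  have bdd: "bdd_below R" using psd by (intro bdd_belowI[of _ 0]) (auto simp: R_def)
  have scale: "(1 / sqrt (y \<bullet> y)) \<cdot>\<^sub>v y \<in> carrier_vec l"
    "((1 / sqrt (y \<bullet> y)) \<cdot>\<^sub>v y) \<bullet> ((1 / sqrt (y \<bullet> y)) \<cdot>\<^sub>v y) = 1"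
    "((1 / sqrt (y \<bullet> y)) \<cdot>\<^sub>v y) \<bullet> (S *\<^sub>v ((1 / sqrt (y \<bullet> y)) \<cdot>\<^sub>v y)) = (y \<bullet> (S *\<^sub>v y)) / (y \<bullet> y)"
    if "y \<in> carrier_vec l" "y \<bullet> y \<noteq> 0" for y
    using that dot_self_nonneg[of y] S
    by (auto simp: dot_linear mult_mat_vec[OF S] field_simps)
  have low: "\<rho> * (y \<bullet> y) \<le> y \<bullet> (S *\<^sub>v y)" if y: "y \<in> carrier_vec l" for y
  proof (cases "y \<bullet> y = 0")
    case True
    then show ?thesis using psd[OF y] by simp
  next
    case False
    have "\<rho> \<le> (y \<bullet> (S *\<^sub>v y)) / (y \<bullet> y)"
      unfolding \<rho>_def
    proof (rule cInf_lower[OF _ bdd])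
      show "(y \<bullet> (S *\<^sub>v y)) / (y \<bullet> y) \<in> R"
        unfolding R_def
        by (intro CollectI exI[of _ "(1 / sqrt (y \<bullet> y)) \<cdot>\<^sub>v y"] conjI
            scale(1,2)[OF y False] scale(3)[OF y False, symmetric])
    qed
    then show ?thesis using False dot_self_nonneg[of y] by (simp add: field_simps)
  qed
  define T where "T = char_matrix S \<rho>"
  have T: "T \<in> carrier_mat l l" using S by (simp add: T_def)
  have Tv: "T *\<^sub>v y = S *\<^sub>v y - \<rho> \<cdot>\<^sub>v y" if "y \<in> carrier_vec l" for y
    using S that by (auto simp: T_def char_matrix_def add_mult_distrib_mat_vec[of _ l l])
  have Tpsd: "0 \<le> y \<bullet> (T *\<^sub>v y)" if "y \<in> carrier_vec l" for y
    using low[OF that] that S by (simp add: Tv dot_linear)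
  have Tsym: "transpose_mat T = T"
    using S sym by (auto simp: T_def char_matrix_def transpose_add[of _ l l])
  have "det T = 0"
  proof (rule ccontr)
    assume "det T \<noteq> 0"
    then obtain C where C: "C \<in> carrier_mat l l" "C * T = 1\<^sub>m l"
      using det_non_zero_imp_unit[OF T, of "()"] by (auto simp: Units_def ring_mat_def)
    obtain K where K: "K \<ge> 0" "\<And>y. y \<in> carrier_vec l \<Longrightarrow> (C *\<^sub>v y) \<bullet> (C *\<^sub>v y) \<le> K * (y \<bullet> y)"
      using mult_mat_vec_bounded[of C] C by auto
    obtain K' where K': "K' \<ge> 0" "\<And>y. y \<in> carrier_vec l \<Longrightarrow> (T *\<^sub>v y) \<bullet> (T *\<^sub>v y) \<le> K' * (y \<bullet> y)"
      using mult_mat_vec_bounded[of T] T by auto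
    \<comment> \<open>With \<open>x = T y\<close>, Cauchy-Schwarz for the form of \<open>T\<close>
      bounds \<open>|x|^4\<close> by the product of the form at \<open>x\<close> and at
      \<open>y\<close>. The form at \<open>x\<close> is at most \<open>(K' + 1) |x|^2\<close>, so
      one factor \<open>|x|^2\<close> cancels; then \<open>y = C x\<close> returns to
      \<open>y\<close>.\<close>
    have bound: "y \<bullet> y \<le> K * (K' + 1) * (y \<bullet> (T *\<^sub>v y))" if y: "y \<in> carrier_vec l" for y
    proof -
      define x where "x = T *\<^sub>v y"
      have x: "x \<in> carrier_vec l" using T y by (simp add: x_def)
      have "(x \<bullet> (T *\<^sub>v x))\<^sup>2 \<le> (x \<bullet> x) * ((T *\<^sub>v x) \<bullet> (T *\<^sub>v x))"
        using T x by (intro Cauchy_Schwarz_dot) auto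
      also have "\<dots> \<le> (x \<bullet> x) * (K' * (x \<bullet> x))"
        by (intro mult_left_mono K' x dot_self_nonneg)
      also have "\<dots> \<le> ((K' + 1) * (x \<bullet> x))\<^sup>2"
      proof -
        \<comment> \<open>\<open>K' + 1\<close> stands in for the square root of \<open>K'\<close>,
          so that both sides are squares.\<close>
        have "K' \<le> (K' + 1)\<^sup>2" using K' by (simp add: power2_eq_square algebra_simps)
        then show ?thesis
          using mult_right_mono[of K' "(K' + 1)\<^sup>2" "(x \<bullet> x)\<^sup>2"]
          by (simp add: power_mult_distrib power2_eq_square mult_ac)
      qed
      finally have 1: "x \<bullet> (T *\<^sub>v x) \<le> (K' + 1) * (x \<bullet> x)"
        using K' dot_self_nonneg[of x] by (auto intro: power2_le_imp_le)
      have "(x \<bullet> x) * (x \<bullet> x) \<le> (x \<bullet> (T *\<^sub>v x)) * (y \<bullet> (T *\<^sub>v y))"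
        using psd_Cauchy_Schwarz[OF T Tsym Tpsd x y] by (simp add: x_def power2_eq_square)
      also have "\<dots> \<le> ((K' + 1) * (x \<bullet> x)) * (y \<bullet> (T *\<^sub>v y))"
        by (intro mult_right_mono 1 Tpsd y)
      finally have "x \<bullet> x \<le> (K' + 1) * (y \<bullet> (T *\<^sub>v y))"
        using dot_self_nonneg[of x] Tpsd[OF y] K'
        by (cases "x \<bullet> x = 0") (auto simp: mult_ac)
      moreover have "y = C *\<^sub>v x"
        using C T y by (simp add: x_def flip: assoc_mult_mat_vec[of _ l l _ l])
      ultimately show ?thesis
        using K(2)[OF x] K(1) mult_left_mono[of "x \<bullet> x" "(K' + 1) * (y \<bullet> (T *\<^sub>v y))" K] by (simp add: mult_ac)
    qed
    define c where "c = K * (K' + 1) + 1"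
    have c: "c > 0" using K K' by (simp add: c_def add_nonneg_pos)
    \<comment> \<open>The form of \<open>T = S - \<rho> I\<close> is at least \<open>1 / c\<close>
      on unit vectors, which would lift the infimum above itself.\<close>
    have "\<rho> + 1 / c \<le> Inf R"
    proof (rule cInf_greatest[OF ne])
      fix r assume "r \<in> R"
      then obtain y where y: "y \<in> carrier_vec l" "y \<bullet> y = 1" and r: "r = y \<bullet> (S *\<^sub>v y)"
        by (auto simp: R_def)
      have "1 \<le> c * (y \<bullet> (T *\<^sub>v y))"
        using bound[OF y(1)] Tpsd[OF y(1)] y(2) unfolding c_def by (simp add: algebra_simps)
      also have "y \<bullet> (T *\<^sub>v y) = r - \<rho>" using y S by (simp add: Tv dot_linear r)
      finally show "\<rho> + 1 / c \<le> r" using c by (simp add: field_simps)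
    qed
    then show False using c by (simp add: \<rho>_def)
  qed
  then have "eigenvalue S \<rho>" using eigenvalue_det[OF S] by (simp add: T_def)
  then show thesis using low that by blast
qed

text \<open>\<open>sigma_min\<close> is a \<open>Min\<close>, which has its usual properties only on
  finite nonempty sets.\<close>

lemma finite_eigenvalues:
  assumes "(S :: real mat) \<in> carrier_mat l l"
  shows "finite {e. eigenvalue S e}"
proof -
  have "char_poly S \<noteq> 0" using degree_monic_char_poly[OF assms] by auto
  then show ?thesis using eigenvalue_root_char_poly[OF assms] poly_roots_finite by auto
qed

text \<open>Nonnegativity holds because the minimum is attained by an eigenvalue. The lower bound
  needs no diagonalization: the Rayleigh infimum \<open>\<rho>\<close> is an eigenvalue, hence at
  least \<open>sigma_min\<close>.\<close>

lemma
  fixes B :: "real mat"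
  assumes B: "B \<in> carrier_mat l n" and l: "0 < l"
  shows sigma_min_gram_nonneg: "0 \<le> sigma_min (B * transpose_mat B)"
    and sigma_min_gram_le: "y \<in> carrier_vec l \<Longrightarrow>
      sigma_min (B * transpose_mat B) * (y \<bullet> y) \<le> (transpose_mat B *\<^sub>v y) \<bullet> (transpose_mat B *\<^sub>v y)"
proof -
  let ?S = "B * transpose_mat B"
  have S: "?S \<in> carrier_mat l l" using B by simp
  have q: "y \<bullet> (?S *\<^sub>v y) = (transpose_mat B *\<^sub>v y) \<bullet> (transpose_mat B *\<^sub>v y)" if "y \<in> carrier_vec l" for y
    using B that by (subst dot_mult_mat_vec[OF B]) (auto simp: assoc_mult_mat_vec[of _ l n _ l])
  have "transpose_mat ?S = ?S" using B by (simp add: transpose_mult[of _ l n _ l])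
  moreover have "0 \<le> y \<bullet> (?S *\<^sub>v y)" if "y \<in> carrier_vec l" for y
    by (simp add: q that dot_self_nonneg)
  ultimately obtain \<rho> where \<rho>: "eigenvalue ?S \<rho>"
    and low: "\<And>y. y \<in> carrier_vec l \<Longrightarrow> \<rho> * (y \<bullet> y) \<le> y \<bullet> (?S *\<^sub>v y)"
    using Rayleigh_infimum_eigenvalue[OF S l] by blast
  have fin: "finite {e. eigenvalue ?S e}" by (rule finite_eigenvalues[OF S])
  have "sigma_min ?S \<in> {e. eigenvalue ?S e}"
    unfolding sigma_min_def using \<rho> by (intro Min_in[OF fin]) auto
  then show "0 \<le> sigma_min ?S" using eigenvalue_gram_nonneg[OF B] by simp
  have "sigma_min ?S \<le> \<rho>" unfolding sigma_min_def using \<rho> by (intro Min_le[OF fin]) simp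
  then show "sigma_min ?S * (y \<bullet> y) \<le> (transpose_mat B *\<^sub>v y) \<bullet> (transpose_mat B *\<^sub>v y)"
    if "y \<in> carrier_vec l"
    using low[OF that] q[OF that] mult_right_mono[OF _ dot_self_nonneg[of y], of "sigma_min ?S" \<rho>] by simp
qed

section \<open>Gradients of convex functions\<close>

text \<open>A one-sided first-order estimate already identifies the gradient: along
  \<open>h = s - d\<close> it forces growth that the expansion with \<open>d\<close> does not allow.
  This covers uniqueness of gradients and the comparison of gradients with subgradients at
  once.\<close>

lemma has_gradient_eqI:
  assumes d: "has_gradient n g x d" and x: "x \<in> carrier_vec n" and s: "s \<in> carrier_vec n"
    and minor: "\<And>e. e > 0 \<Longrightarrow> \<exists>r>0. \<forall>y\<in>carrier_vec n. vnorm (y - x) < r \<longrightarrow>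
      g y - g x - s \<bullet> (y - x) \<ge> - e * vnorm (y - x)"
  shows "d = s"
proof (rule ccontr)
  assume ne: "d \<noteq> s"
  have dc: "d \<in> carrier_vec n" using d by (simp add: has_gradient_def)
  define h where "h = s - d"
  have h: "h \<in> carrier_vec n" using s dc by (simp add: h_def)
  have "h \<noteq> 0\<^sub>v n"
  proof
    assume "h = 0\<^sub>v n"
    have "s $ i = d $ i" if "i < n" for i
    proof -
      have "(s - d) $ i = 0" using \<open>h = 0\<^sub>v n\<close> that by (simp add: h_def)
      then show ?thesis using that s dc by simp
    qed
    then show False using ne s dc by (metis eq_vecI carrier_vecD)
  qed
  then have "h \<bullet> h \<noteq> 0" using dot_self_eq_0[of h] h by simp
  then have N: "vnorm h > 0" using dot_self_nonneg[of h] by (simp add: vnorm_def)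
  \<comment> \<open>Two errors of size \<open>e\<close> occur, and \<open>2 / 3 < 1\<close> gives
    the contradiction.\<close>
  define e where "e = vnorm h / 3"
  have e: "e > 0" using N by (simp add: e_def)
  obtain r1 where r1: "r1 > 0" "\<And>y. y \<in> carrier_vec n \<Longrightarrow> vnorm (y - x) < r1 \<Longrightarrow>
      \<bar>g y - g x - d \<bullet> (y - x)\<bar> \<le> e * vnorm (y - x)"
    using d e unfolding has_gradient_def by blast
  obtain r2 where r2: "r2 > 0" "\<And>y. y \<in> carrier_vec n \<Longrightarrow> vnorm (y - x) < r2 \<Longrightarrow>
      g y - g x - s \<bullet> (y - x) \<ge> - e * vnorm (y - x)"
    using minor[OF e] by blast
  define t where "t = min r1 r2 / (2 * vnorm h)"
  have t: "t > 0" using r1 r2 N by (simp add: t_def)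
  define y where "y = x + t \<cdot>\<^sub>v h"
  have y: "y \<in> carrier_vec n" "y - x = t \<cdot>\<^sub>v h" using x h by (auto simp: y_def)
  have nrm: "vnorm (y - x) = t * vnorm h" using t by (simp add: y vnorm_smult)
  have "t * vnorm h = min r1 r2 / 2" using N by (simp add: t_def)
  then have "vnorm (y - x) < r1" "vnorm (y - x) < r2" using r1(1) r2(1) nrm by auto
  then have "s \<bullet> (y - x) - d \<bullet> (y - x) \<le> 2 * (e * (t * vnorm h))"
    using r1(2)[OF y(1)] r2(2)[OF y(1)] nrm by fastforce
  moreover have "s \<bullet> (y - x) - d \<bullet> (y - x) = t * (vnorm h)\<^sup>2"
    using s dc h by (simp add: y vnorm_sq) (simp add: h_def dot_linear algebra_simps)
  ultimately have "t * (vnorm h)\<^sup>2 \<le> t * (2 / 3 * (vnorm h)\<^sup>2)"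
    by (simp add: e_def power2_eq_square mult_ac)
  then have "(vnorm h)\<^sup>2 \<le> 2 / 3 * (vnorm h)\<^sup>2" using t by (simp only: mult_le_cancel_left_pos)
  moreover have "(vnorm h)\<^sup>2 > 0" using N by simp
  ultimately show False by linarith
qed

lemma gradient_eqI:
  assumes d: "has_gradient n g x d" and x: "x \<in> carrier_vec n"
  shows "gradient n g x = d"
proof -
  have "d' = d" if d': "has_gradient n g x d'" for d'
  proof (rule has_gradient_eqI[OF d' x])
    show "d \<in> carrier_vec n" using d by (simp add: has_gradient_def)
    fix e :: real assume "e > 0"
    then obtain r where "r > 0" "\<forall>y\<in>carrier_vec n. vnorm (y - x) < r \<longrightarrow>
        \<bar>g y - g x - d \<bullet> (y - x)\<bar> \<le> e * vnorm (y - x)"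
      using d unfolding has_gradient_def by blast
    then show "\<exists>r>0. \<forall>y\<in>carrier_vec n. vnorm (y - x) < r \<longrightarrow>
        g y - g x - d \<bullet> (y - x) \<ge> - e * vnorm (y - x)"
      by (intro exI[of _ r]) (auto simp: abs_le_iff)
  qed
  then show ?thesis using d unfolding gradient_def by blast
qed

lemma subgradient_eq_gradient:
  assumes d: "has_gradient n g x d" and x: "x \<in> carrier_vec n" and s: "s \<in> carrier_vec n"
    and sub: "\<And>y. y \<in> carrier_vec n \<Longrightarrow> g y \<ge> g x + s \<bullet> (y - x)"
  shows "gradient n g x = s"
proof -
  have "d = s"
  proof (rule has_gradient_eqI[OF d x s])
    fix e :: real assume "e > 0"
    have "g y - g x - s \<bullet> (y - x) \<ge> - e * vnorm (y - x)" if "y \<in> carrier_vec n" for y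
    proof -
      have "e * vnorm (y - x) \<ge> 0" using \<open>e > 0\<close> by (simp add: vnorm_nonneg)
      then show ?thesis using sub[OF that] by simp
    qed
    then show "\<exists>r>0. \<forall>y\<in>carrier_vec n. vnorm (y - x) < r \<longrightarrow>
        g y - g x - s \<bullet> (y - x) \<ge> - e * vnorm (y - x)"
      by (intro exI[of _ 1]) auto
  qed
  then show ?thesis using gradient_eqI[OF d x] by simp
qed

lemma has_gradient_quadraticI:
  assumes "d \<in> carrier_vec n"
    and bnd: "\<And>y. y \<in> carrier_vec n \<Longrightarrow> \<bar>g y - g x - d \<bullet> (y - x)\<bar> \<le> K * (vnorm (y - x))\<^sup>2"
  shows "has_gradient n g x d"
  unfolding has_gradient_def
proof (intro conjI allI impI)
  fix e :: real assume e: "e > 0"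
  define r where "r = e / (\<bar>K\<bar> + 1)"
  have "\<bar>g y - g x - d \<bullet> (y - x)\<bar> \<le> e * vnorm (y - x)"
    if y: "y \<in> carrier_vec n" and r: "vnorm (y - x) < r" for y
  proof -
    have "K * vnorm (y - x) \<le> (\<bar>K\<bar> + 1) * vnorm (y - x)"
      by (intro mult_right_mono vnorm_nonneg) auto
    also have "\<dots> \<le> (\<bar>K\<bar> + 1) * r" using r by (intro mult_left_mono) auto
    also have "\<dots> = e" by (simp add: r_def)
    finally have "K * vnorm (y - x) * vnorm (y - x) \<le> e * vnorm (y - x)"
      by (intro mult_right_mono vnorm_nonneg)
    then show ?thesis using bnd[OF y] by (simp add: power2_eq_square)
  qed
  then show "\<exists>r>0. \<forall>y\<in>carrier_vec n. vnorm (y - x) < r \<longrightarrow>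
      \<bar>g y - g x - d \<bullet> (y - x)\<bar> \<le> e * vnorm (y - x)"
    using e by (intro exI[of _ r]) (auto simp: r_def)
qed fact

lemma convex_fun_segment:
  assumes "convex_fun n g" "x \<in> carrier_vec n" "y \<in> carrier_vec n" "0 \<le> t" "t \<le> 1"
  shows "g (x + t \<cdot>\<^sub>v (y - x)) \<le> (1 - t) * g x + t * g y"
proof -
  have "x + t \<cdot>\<^sub>v (y - x) = (1 - t) \<cdot>\<^sub>v x + t \<cdot>\<^sub>v y"
    using assms by (intro eq_vecI) (auto simp: algebra_simps)
  then show ?thesis using assms by (simp add: convex_fun_def)
qed

text \<open>An algebraic substitute for the limit \<open>t \<longlonglongrightarrow> 0\<close>; it
  turns comparisons along a segment into first-order conditions.\<close>

lemma le_0_of_small_multiples: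
  fixes a c :: real
  assumes "\<And>t. 0 < t \<Longrightarrow> t \<le> 1 \<Longrightarrow> a \<le> t * c"
  shows "a \<le> 0"
proof (rule ccontr)
  assume "\<not> a \<le> 0"
  then have a: "a > 0" by simp
  define t where "t = min 1 (a / (2 * (\<bar>c\<bar> + 1)))"
  have t: "t > 0" "t \<le> 1" using a by (auto simp: t_def)
  have "a \<le> t * c" by (rule assms[OF t])
  also have "\<dots> \<le> t * (\<bar>c\<bar> + 1)" using t by (intro mult_left_mono) auto
  also have "\<dots> \<le> a / (2 * (\<bar>c\<bar> + 1)) * (\<bar>c\<bar> + 1)" by (intro mult_right_mono) (auto simp: t_def)
  also have "\<dots> = a / 2" by (simp add: field_simps)
  finally show False using a by simp
qed

lemma convex_gradient_le:
  assumes cvx: "convex_fun n g" and d: "has_gradient n g x d"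
    and x: "x \<in> carrier_vec n" and y: "y \<in> carrier_vec n"
  shows "g x + d \<bullet> (y - x) \<le> g y"
proof -
  have dc: "d \<in> carrier_vec n" using d by (simp add: has_gradient_def)
  have "g x + d \<bullet> (y - x) - g y \<le> e * vnorm (y - x)" if e: "0 < e" for e
  proof -
    obtain r where r: "r > 0" "\<And>y. y \<in> carrier_vec n \<Longrightarrow> vnorm (y - x) < r \<Longrightarrow>
        \<bar>g y - g x - d \<bullet> (y - x)\<bar> \<le> e * vnorm (y - x)"
      using d e unfolding has_gradient_def by blast
    define t where "t = min 1 (r / (2 * (vnorm (y - x) + 1)))"
    have t: "t > 0" "t \<le> 1" using r(1) vnorm_nonneg[of "y - x"] by (auto simp: t_def intro!: divide_pos_pos)
    define z where "z = x + t \<cdot>\<^sub>v (y - x)"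
    have z: "z \<in> carrier_vec n" "z - x = t \<cdot>\<^sub>v (y - x)" using x y by (auto simp: z_def)
    have nz: "vnorm (z - x) = t * vnorm (y - x)" using t by (simp add: z vnorm_smult)
    also have "\<dots> \<le> r / (2 * (vnorm (y - x) + 1)) * (vnorm (y - x) + 1)"
      using vnorm_nonneg[of "y - x"] r t by (intro mult_mono) (auto simp: t_def)
    also have "\<dots> = r / 2" using vnorm_nonneg[of "y - x"] by (simp add: field_simps)
    finally have "vnorm (z - x) < r" using r(1) by simp
    then have "\<bar>g z - g x - d \<bullet> (z - x)\<bar> \<le> e * (t * vnorm (y - x))"
      using r(2)[OF z(1)] nz by metis
    then have "g x + t * (d \<bullet> (y - x)) - t * (e * vnorm (y - x)) \<le> g z"
      using dc x y by (simp add: z dot_linear abs_le_iff mult_ac)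
    also have "g z \<le> (1 - t) * g x + t * g y"
      unfolding z_def using convex_fun_segment[OF cvx x y] t by simp
    finally have "t * (g x + d \<bullet> (y - x) - g y) \<le> t * (e * vnorm (y - x))"
      by (simp add: algebra_simps)
    then show ?thesis using t(1) by (simp only: mult_le_cancel_left_pos)
  qed
  \<comment> \<open>The tolerance \<open>e\<close> itself plays the role of the small factor
    \<open>t\<close>.\<close>
  then show ?thesis using le_0_of_small_multiples[of "g x + d \<bullet> (y - x) - g y" "vnorm (y - x)"] by auto
qed

lemma gradient_lipschitz_has_gradient:
  assumes "gradient_lipschitz n L g" "x \<in> carrier_vec n"
  shows "has_gradient n g x (gradient n g x)"
  using assms gradient_eqI unfolding gradient_lipschitz_def by metis

lemma gradient_lipschitz_cocoercive:
  assumes cvx: "convex_fun n g" and lip: "gradient_lipschitz n L g"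
    and x: "x \<in> carrier_vec n" and y: "y \<in> carrier_vec n"
  defines "h \<equiv> gradient n g y - gradient n g x"
  shows "g x + gradient n g x \<bullet> (y - x) + 1 / (2 * L) * (h \<bullet> h) \<le> g y"
proof -
  have L: "L > 0" using lip by (simp add: gradient_lipschitz_def)
  have grad: "has_gradient n g z (gradient n g z)" if "z \<in> carrier_vec n" for z
    by (rule gradient_lipschitz_has_gradient[OF lip that])
  have gc: "gradient n g z \<in> carrier_vec n" if "z \<in> carrier_vec n" for z
    using grad[OF that] by (simp add: has_gradient_def)
  have h: "h \<in> carrier_vec n" unfolding h_def using gc[OF x] gc[OF y] by simp
  \<comment> \<open>\<open>h\<close> is the gradient at \<open>y\<close> of \<open>g\<close> tilted
    by its linear part at \<open>x\<close>, and \<open>z\<close> is the gradient step of length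
    \<open>1 / L\<close> for the tilted function. The quadratic upper model at \<open>y\<close> and
    the convex lower bound at \<open>x\<close> are compared at \<open>z\<close>.\<close>
  define z where "z = y - (1 / L) \<cdot>\<^sub>v h"
  have z: "z \<in> carrier_vec n" using y h by (simp add: z_def)
  have zy: "z - y = (- 1 / L) \<cdot>\<^sub>v h" using y h by (intro eq_vecI) (auto simp: z_def)
  have "g z \<le> g y + gradient n g y \<bullet> (z - y) + L / 2 * (vnorm (z - y))\<^sup>2"
    using lip y z by (simp add: gradient_lipschitz_def)
  also have "(vnorm (z - y))\<^sup>2 = (h \<bullet> h) / L\<^sup>2"
    unfolding vnorm_sq zy by (simp add: dot_linear power2_eq_square)
  finally have "g z \<le> g y - 1 / L * (gradient n g y \<bullet> h) + 1 / (2 * L) * (h \<bullet> h)"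
    using L h gc[OF y] by (simp add: zy dot_linear power2_eq_square field_simps)
  moreover have "g x + gradient n g x \<bullet> (z - x) \<le> g z"
    by (rule convex_gradient_le[OF cvx grad[OF x] x z])
  moreover have "gradient n g x \<bullet> (z - x) = gradient n g x \<bullet> (y - x) - 1 / L * (gradient n g x \<bullet> h)"
    using h x y gc[OF x] by (simp add: z_def dot_linear)
  moreover have "gradient n g y \<bullet> h - gradient n g x \<bullet> h = h \<bullet> h"
    using h gc[OF x] gc[OF y] by (simp add: h_def dot_linear)
  then have "1 / L * (gradient n g y \<bullet> h) - 1 / L * (gradient n g x \<bullet> h) = 2 * (1 / (2 * L) * (h \<bullet> h))"
    using L by (simp add: field_simps)
  ultimately show ?thesis by linarith
qed

section \<open>Optimality conditions of the proximal subproblems\<close>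

lemma wnormsq_gram:
  assumes "B \<in> carrier_mat l n" "w \<in> carrier_vec n"
  shows "wnormsq (transpose_mat B * B) w = (B *\<^sub>v w) \<bullet> (B *\<^sub>v w)"
  using assms dot_mult_mat_vec[of B l n w "B *\<^sub>v w"] dot_commute[of w "transpose_mat B *\<^sub>v (B *\<^sub>v w)"]
  by (simp add: wnormsq_def assoc_mult_mat_vec[of _ n l _ n])

text \<open>The minimizer is compared with points \<open>x + t (y - x)\<close>. Convexity handles
  \<open>f\<close> without differentiability, and the part of the quadratic term of order
  \<open>t^2\<close> vanishes after division by \<open>t\<close>.\<close>

lemma proximal_argmin_le:
  assumes cvx: "convex_fun n f" and B: "B \<in> carrier_mat l n" and g: "g \<in> carrier_vec n"
    and xh: "xh \<in> carrier_vec n" and y: "y \<in> carrier_vec n"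
    and am: "is_arg_min (\<lambda>y. f y + y \<bullet> g + \<beta> / 2 * wnormsq (transpose_mat B * B) (y - xh))
      (\<lambda>y. y \<in> carrier_vec n) x"
  shows "f x \<le> f y + g \<bullet> (y - x) + \<beta> * ((B *\<^sub>v (x - xh)) \<bullet> (B *\<^sub>v (y - x)))"
proof -
  have x: "x \<in> carrier_vec n" using am by (simp add: is_arg_min_def)
  define p q where "p = B *\<^sub>v (x - xh)" and "q = B *\<^sub>v (y - x)"
  have pq: "p \<in> carrier_vec l" "q \<in> carrier_vec l" using B x xh y by (auto simp: p_def q_def)
  have "f x - (f y + g \<bullet> (y - x) + \<beta> * (p \<bullet> q)) \<le> t * (\<beta> / 2 * (q \<bullet> q))" if t: "0 < t" "t \<le> 1" for t
  proof -
    define z where "z = x + t \<cdot>\<^sub>v (y - x)"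
    have z: "z \<in> carrier_vec n" using x y by (simp add: z_def)
    have "B *\<^sub>v (z - xh) = p + t \<cdot>\<^sub>v q"
    proof -
      have "z - xh = (x - xh) + t \<cdot>\<^sub>v (y - x)" using x y xh by (intro eq_vecI) (auto simp: z_def)
      then show ?thesis using x y xh by (simp add: mult_mat_vec_linear[OF B] p_def q_def)
    qed
    then have wz: "wnormsq (transpose_mat B * B) (z - xh) = p \<bullet> p + 2 * t * (p \<bullet> q) + t * t * (q \<bullet> q)"
      using z xh pq dot_commute[of p q] by (simp add: wnormsq_gram[OF B] dot_linear algebra_simps)
    have wx: "wnormsq (transpose_mat B * B) (x - xh) = p \<bullet> p"
      using x xh by (simp add: wnormsq_gram[OF B] p_def)
    have zg: "z \<bullet> g = x \<bullet> g + t * (g \<bullet> (y - x))"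
      using x y g dot_commute[of "y - x" g] by (simp add: z_def dot_linear)
    have "f x + x \<bullet> g + \<beta> / 2 * wnormsq (transpose_mat B * B) (x - xh)
        \<le> f z + z \<bullet> g + \<beta> / 2 * wnormsq (transpose_mat B * B) (z - xh)"
      using am z by (auto simp: is_arg_min_linorder)
    then have "f x \<le> f z + t * (g \<bullet> (y - x)) + \<beta> / 2 * (2 * t * (p \<bullet> q) + t * t * (q \<bullet> q))"
      by (simp add: wz wx zg algebra_simps)
    also have "f z \<le> (1 - t) * f x + t * f y"
      unfolding z_def using convex_fun_segment[OF cvx x y] t by simp
    finally have "t * (f x - (f y + g \<bullet> (y - x) + \<beta> * (p \<bullet> q))) \<le> t * (t * (\<beta> / 2 * (q \<bullet> q)))"
      by (simp add: algebra_simps)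
    then show ?thesis using t(1) by (simp only: mult_le_cancel_left_pos)
  qed
  then show ?thesis using le_0_of_small_multiples by (fastforce simp: p_def q_def)
qed

section \<open>Block matrices\<close>

text \<open>Translates sums over flat indices into sums over blocks and positions; every computation
  with stacked vectors goes through it.\<close>

lemma sum_div_mod:
  fixes g :: "nat \<Rightarrow> nat \<Rightarrow> real"
  assumes "0 < l"
  shows "(\<Sum>r<k * l. g (r div l) (r mod l)) = (\<Sum>j<k. \<Sum>i<l. g j i)"
proof -
  have "(\<Sum>r<k * l. g (r div l) (r mod l)) = (\<Sum>j<k. \<Sum>r = j * l..<j * l + l. g (r div l) (r mod l))"
    by (rule sum.nat_group[symmetric])
  also have "\<dots> = (\<Sum>j<k. \<Sum>i<l. g j i)"
  proof (rule sum.cong[OF refl])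
    fix j
    have "(\<Sum>r = j * l..<j * l + l. g (r div l) (r mod l)) = (\<Sum>i = 0..<l. g ((i + j * l) div l) ((i + j * l) mod l))"
      using sum.shift_bounds_nat_ivl[of "\<lambda>r. g (r div l) (r mod l)" 0 "j * l" l] by (simp add: add.commute)
    also have "\<dots> = (\<Sum>i<l. g j i)"
      using assms by (intro sum.cong) (auto simp: lessThan_atLeast0)
    finally show "(\<Sum>r = j * l..<j * l + l. g (r div l) (r mod l)) = (\<Sum>i<l. g j i)" .
  qed
  finally show ?thesis .
qed

lemma sum_from_2: "(\<Sum>j = 2..m. h j) = (\<Sum>j<m - 1. h (j + 2 :: nat) :: real)"
  by (rule sum.reindex_bij_witness[of _ "\<lambda>j. j + 2" "\<lambda>j. j - 2"]) (auto simp del: add_2_eq_Suc')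

text \<open>An opaque name for the dimension, so that carrier conditions match syntactically instead
  of being rewritten as arithmetic.\<close>

definition tail_dim :: "nat \<Rightarrow> nat \<Rightarrow> nat" where
  "tail_dim m l = (m - 1) * l"

lemma div_less_blocks:
  assumes "r < tail_dim m l"
  shows "r div l + 2 \<in> {2..m} \<and> r mod l < l"
proof -
  have r: "r < (m - 1) * l" using assms by (simp add: tail_dim_def)
  then have "0 < l" by (cases l) auto
  moreover have "r div l < m - 1" using r by (simp add: less_mult_imp_div_less)
  ultimately show ?thesis by auto
qed

lemma tail_stack_carrier [simp]: "tail_stack m l u \<in> carrier_vec (tail_dim m l)"
  and dim_tail_stack [simp]: "dim_vec (tail_stack m l u) = tail_dim m l"
  by (simp_all add: tail_stack_def tail_dim_def)

lemma index_tail_stack: "r < tail_dim m l \<Longrightarrow> tail_stack m l u $ r = u (r div l + 2) $ (r mod l)"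
  by (simp add: tail_stack_def tail_dim_def)

lemma tail_stack_minus:
  assumes "\<And>j. j \<in> {2..m} \<Longrightarrow> w j \<in> carrier_vec l"
  shows "tail_stack m l u - tail_stack m l w = tail_stack m l (\<lambda>j. u j - w j)"
proof (intro eq_vecI)
  fix r assume "r < dim_vec (tail_stack m l (\<lambda>j. u j - w j))"
  then have r: "r < tail_dim m l" by simp
  then show "(tail_stack m l u - tail_stack m l w) $ r = tail_stack m l (\<lambda>j. u j - w j) $ r"
    using div_less_blocks[OF r] assms[of "r div l + 2"] by (simp add: index_tail_stack)
qed simp

lemma tail_stack_dot:
  assumes l: "0 < l"
    and "\<And>j. j \<in> {2..m} \<Longrightarrow> u j \<in> carrier_vec l" "\<And>j. j \<in> {2..m} \<Longrightarrow> w j \<in> carrier_vec l"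
  shows "tail_stack m l u \<bullet> tail_stack m l w = (\<Sum>j = 2..m. u j \<bullet> w j)"
proof -
  have "tail_stack m l u \<bullet> tail_stack m l w
      = (\<Sum>r<tail_dim m l. u (r div l + 2) $ (r mod l) * w (r div l + 2) $ (r mod l))"
    by (subst dot_sum[of _ "tail_dim m l"]) (simp_all add: index_tail_stack)
  also have "\<dots> = (\<Sum>j<m - 1. \<Sum>i<l. u (j + 2) $ i * w (j + 2) $ i)"
    unfolding tail_dim_def by (rule sum_div_mod[OF l])
  also have "\<dots> = (\<Sum>j = 2..m. \<Sum>i<l. u j $ i * w j $ i)"
    by (rule sum_from_2[symmetric])
  also have "\<dots> = (\<Sum>j = 2..m. u j \<bullet> w j)"
    using assms by (intro sum.cong refl dot_sum[symmetric]) auto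
  finally show ?thesis .
qed

lemma J_mat_carrier [simp]: "J_mat m l \<in> carrier_mat (tail_dim m l) (tail_dim m l)"
  and J_mat_dim [simp]: "dim_row (J_mat m l) = tail_dim m l" "dim_col (J_mat m l) = tail_dim m l"
  by (simp_all add: J_mat_def tail_dim_def)

lemma I_row_carrier [simp]: "I_row m l \<in> carrier_mat l (tail_dim m l)"
  and I_row_dim [simp]: "dim_row (I_row m l) = l" "dim_col (I_row m l) = tail_dim m l"
  by (simp_all add: I_row_def tail_dim_def)

lemma J_mat_index: "r < tail_dim m l \<Longrightarrow> c < tail_dim m l \<Longrightarrow>
    J_mat m l $$ (r, c) = (if c div l \<le> r div l \<and> r mod l = c mod l then 1 else 0)"
  by (simp add: J_mat_def tail_dim_def)

lemma I_row_index: "r < l \<Longrightarrow> c < tail_dim m l \<Longrightarrow>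
    I_row m l $$ (r, c) = (if r = c mod l then 1 else 0)"
  by (simp add: I_row_def tail_dim_def)

text \<open>\<open>J\<close> is summation over blocks; the partial sums are those that the
  Gauss-Seidel sweep leaves in the block multipliers.\<close>

lemma J_mat_mult_tail_stack:
  assumes l: "0 < l"
  shows "J_mat m l *\<^sub>v tail_stack m l u = tail_stack m l (\<lambda>j. vec l (\<lambda>i. \<Sum>c = 2..j. u c $ i))"
proof (intro eq_vecI)
  fix r assume "r < dim_vec (tail_stack m l (\<lambda>j. vec l (\<lambda>i. \<Sum>c = 2..j. u c $ i)))"
  then have r: "r < tail_dim m l" by simp
  note b = div_less_blocks[OF r]
  have "(J_mat m l *\<^sub>v tail_stack m l u) $ r
      = (\<Sum>s<tail_dim m l. (if s div l \<le> r div l \<and> r mod l = s mod l then 1 else 0) * u (s div l + 2) $ (s mod l))"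
    using r by (simp add: dot_sum[of _ "tail_dim m l"] carrier_vecI)
      (simp add: J_mat_index index_tail_stack)
  also have "\<dots> = (\<Sum>j<m - 1. \<Sum>i<l. (if j \<le> r div l \<and> r mod l = i then 1 else 0) * u (j + 2) $ i)"
    unfolding tail_dim_def by (rule sum_div_mod[OF l])
  also have "\<dots> = (\<Sum>j<m - 1. if j \<le> r div l then u (j + 2) $ (r mod l) else 0)"
  proof (rule sum.cong[OF refl])
    fix j
    have "(\<Sum>i<l. (if j \<le> r div l \<and> r mod l = i then 1 else 0) * u (j + 2) $ i)
        = (\<Sum>i<l. if i = r mod l then (if j \<le> r div l then u (j + 2) $ i else 0) else 0)"
      by (intro sum.cong) auto
    then show "(\<Sum>i<l. (if j \<le> r div l \<and> r mod l = i then 1 else 0) * u (j + 2) $ i)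
        = (if j \<le> r div l then u (j + 2) $ (r mod l) else 0)"
      using l by simp
  qed
  \<comment> \<open>Block row \<open>r div l\<close> carries the number \<open>r div l + 2\<close>;
    the bound is left in this form so that \<open>sum_from_2\<close> applies.\<close>
  also have "\<dots> = (\<Sum>j<r div l + 2 - 1. u (j + 2) $ (r mod l))"
    using b by (intro sum.mono_neutral_cong_right) auto
  also have "\<dots> = (\<Sum>c = 2..r div l + 2. u c $ (r mod l))"
    by (rule sum_from_2[symmetric])
  finally show "(J_mat m l *\<^sub>v tail_stack m l u) $ r
      = tail_stack m l (\<lambda>j. vec l (\<lambda>i. \<Sum>c = 2..j. u c $ i)) $ r"
    using r b by (simp add: index_tail_stack)
qed simp

lemma I_row_mult_tail_stack:
  assumes l: "0 < l"
  shows "I_row m l *\<^sub>v tail_stack m l u = vec l (\<lambda>i. \<Sum>c = 2..m. u c $ i)"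
proof (intro eq_vecI)
  fix r assume "r < dim_vec (vec l (\<lambda>i. \<Sum>c = 2..m. u c $ i))"
  then have r: "r < l" by simp
  have "(I_row m l *\<^sub>v tail_stack m l u) $ r
      = (\<Sum>s<tail_dim m l. (if r = s mod l then 1 else 0) * u (s div l + 2) $ (s mod l))"
    using r by (simp add: dot_sum[of _ "tail_dim m l"] carrier_vecI)
      (simp add: I_row_index index_tail_stack)
  also have "\<dots> = (\<Sum>j<m - 1. \<Sum>i<l. (if r = i then 1 else 0) * u (j + 2) $ i)"
    unfolding tail_dim_def by (rule sum_div_mod[OF l])
  also have "\<dots> = (\<Sum>j<m - 1. u (j + 2) $ r)"
  proof (rule sum.cong[OF refl])
    fix j
    have "(\<Sum>i<l. (if r = i then 1 else 0) * u (j + 2) $ i) = (\<Sum>i<l. if i = r then u (j + 2) $ i else 0)"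
      by (intro sum.cong) auto
    then show "(\<Sum>i<l. (if r = i then 1 else 0) * u (j + 2) $ i) = u (j + 2) $ r" using r by simp
  qed
  finally show "(I_row m l *\<^sub>v tail_stack m l u) $ r = vec l (\<lambda>i. \<Sum>c = 2..m. u c $ i) $ r"
    using r by (simp add: sum_from_2)
qed simp

text \<open>Doubling the sum over \<open>c \<le> j\<close> gives the full double sum plus one
  additional copy of its diagonal.\<close>

lemma sum_partial_sums:
  fixes x :: "nat \<Rightarrow> real"
  shows "2 * (\<Sum>j = a..m. x j * (\<Sum>c = a..j. x c)) = (\<Sum>j = a..m. x j * x j) + (\<Sum>j = a..m. x j) * (\<Sum>j = a..m. x j)"
proof (induction m)
  case (Suc m)
  then show ?case by (cases "a \<le> Suc m") (simp_all add: algebra_simps)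
qed (cases "a = 0"; simp)

text \<open>This is the block identity \<open>J + J\<^sup>T = I + R\<^sup>T R\<close> for the row \<open>R = I_row m l\<close>.\<close>

lemma J_mat_quadratic_form:
  assumes l: "0 < l" and u: "\<And>j. j \<in> {2..m} \<Longrightarrow> u j \<in> carrier_vec l"
  defines "a \<equiv> tail_stack m l u"
  shows "2 * (a \<bullet> (J_mat m l *\<^sub>v a)) = a \<bullet> a + (I_row m l *\<^sub>v a) \<bullet> (I_row m l *\<^sub>v a)"
proof -
  have "2 * (a \<bullet> (J_mat m l *\<^sub>v a)) = 2 * (\<Sum>j = 2..m. \<Sum>i<l. u j $ i * (\<Sum>c = 2..j. u c $ i))"
    unfolding a_def J_mat_mult_tail_stack[OF l]
    by (subst tail_stack_dot[OF l u]) (auto intro!: sum.cong simp: dot_sum[of _ l] u)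
  also have "\<dots> = (\<Sum>i<l. 2 * (\<Sum>j = 2..m. u j $ i * (\<Sum>c = 2..j. u c $ i)))"
    by (subst sum.swap) (simp add: sum_distrib_left)
  also have "\<dots> = (\<Sum>i<l. (\<Sum>j = 2..m. u j $ i * u j $ i)) + (\<Sum>i<l. (\<Sum>j = 2..m. u j $ i) * (\<Sum>j = 2..m. u j $ i))"
    by (simp add: sum_partial_sums sum.distrib)
  also have "(\<Sum>i<l. (\<Sum>j = 2..m. u j $ i * u j $ i)) = a \<bullet> a"
    unfolding a_def by (subst tail_stack_dot[OF l u u], assumption+, subst sum.swap)
      (auto intro!: sum.cong simp: dot_sum[of _ l] u)
  also have "(\<Sum>i<l. (\<Sum>j = 2..m. u j $ i) * (\<Sum>j = 2..m. u j $ i)) = (I_row m l *\<^sub>v a) \<bullet> (I_row m l *\<^sub>v a)"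
    unfolding a_def I_row_mult_tail_stack[OF l] by (subst dot_sum[of _ l]) auto
  finally show ?thesis .
qed

text \<open>\<open>inv_mat\<close> extracts the result of a partial Gauss-Jordan inversion. It must
  first be known to succeed, which invertibility in the matrix ring provides; then uniqueness of
  inverses applies.\<close>

lemma inv_mat_eqI:
  assumes A: "A \<in> carrier_mat n n" and B: "B \<in> carrier_mat n n" and AB: "A * B = 1\<^sub>m n"
  shows "inv_mat A = B"
proof -
  have BA: "B * A = 1\<^sub>m n" by (rule mat_mult_left_right_inverse[OF A B AB])
  have "A \<in> Units (ring_mat TYPE(real) n ())"
    using A B AB BA by (auto simp: Units_def ring_mat_def)
  then obtain C where C: "mat_inverse A = Some C"
    using mat_inverse(1)[OF A, of "()"] by (cases "mat_inverse A") auto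
  then have C': "C * A = 1\<^sub>m n" "C \<in> carrier_mat n n" using mat_inverse(2)[OF A C] by auto
  have "C = C * (A * B)" using C' by (simp add: AB)
  also have "\<dots> = (C * A) * B" by (rule assoc_mult_mat[OF C'(2) A B, symmetric])
  also have "\<dots> = B" using C' B by simp
  finally show ?thesis by (simp add: inv_mat_def C)
qed

text \<open>\<open>J\<close> is lower triangular also entrywise, with unit diagonal, hence of
  determinant 1.\<close>

lemma
  assumes l: "0 < l"
  shows J_mat_inv_carrier: "inv_mat (J_mat m l) \<in> carrier_mat (tail_dim m l) (tail_dim m l)"
    and J_mat_mult_inv: "J_mat m l * inv_mat (J_mat m l) = 1\<^sub>m (tail_dim m l)"
    and J_mat_inv_mult: "inv_mat (J_mat m l) * J_mat m l = 1\<^sub>m (tail_dim m l)"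
proof -
  let ?J = "J_mat m l" and ?n = "tail_dim m l"
  have "det ?J = prod_list (diag_mat ?J)"
  proof (rule det_lower_triangular[of ?n])
    fix r c assume rc: "r < c" "c < ?n"
    \<comment> \<open>Above the diagonal a nonzero entry would lie in a diagonal block at equal
      positions, that is, on the diagonal itself.\<close>
    have "\<not> (c div l \<le> r div l \<and> r mod l = c mod l)"
    proof
      assume *: "c div l \<le> r div l \<and> r mod l = c mod l"
      moreover have "r div l \<le> c div l" using rc by (simp add: div_le_mono)
      ultimately have "r = c" by (metis div_mult_mod_eq le_antisym)
      then show False using rc by simp
    qed
    then show "?J $$ (r, c) = 0" using rc by (auto simp: J_mat_def tail_dim_def)
  qed simp
  moreover have "diag_mat ?J = replicate ?n 1"
    by (rule nth_equalityI) (simp_all add: diag_mat_def J_mat_def tail_dim_def)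
  ultimately have "det ?J \<noteq> 0" by simp
  then have "?J \<in> Units (ring_mat TYPE(real) ?n ())"
    by (rule det_non_zero_imp_unit[OF J_mat_carrier])
  then obtain C where C: "mat_inverse ?J = Some C"
    using mat_inverse(1)[OF J_mat_carrier, of m l "()"] by (cases "mat_inverse ?J") auto
  note C' = mat_inverse(2)[OF J_mat_carrier C]
  show "inv_mat ?J \<in> carrier_mat ?n ?n" "?J * inv_mat ?J = 1\<^sub>m ?n" "inv_mat ?J * ?J = 1\<^sub>m ?n"
    using C' by (auto simp: inv_mat_def C)
qed

section \<open>Block forms of Q, M, H and the quadratic form of G\<close>

lemma smult_mat_mult_vec:
  "v \<in> carrier_vec (dim_col B) \<Longrightarrow> (c \<cdot>\<^sub>m B) *\<^sub>v v = c \<cdot>\<^sub>v (B *\<^sub>v (v :: real vec))"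
  by (intro eq_vecI) (auto simp: scalar_prod_def sum_distrib_left mult_ac)

lemma smult_smult_mat: "a \<cdot>\<^sub>m (b \<cdot>\<^sub>m B) = (a * b) \<cdot>\<^sub>m (B :: real mat)"
  by (intro eq_matI) auto

lemma one_smult_mat: "1 \<cdot>\<^sub>m B = (B :: real mat)"
  by (intro eq_matI) auto

lemma smult_zero_mat: "c \<cdot>\<^sub>m 0\<^sub>m r s = (0\<^sub>m r s :: real mat)"
  by (intro eq_matI) auto

lemma smult_mat_mult_smult_mat:
  "B \<in> carrier_mat n1 n2 \<Longrightarrow> C \<in> carrier_mat n2 n3 \<Longrightarrow>
    (a \<cdot>\<^sub>m B) * (b \<cdot>\<^sub>m C) = (a * b) \<cdot>\<^sub>m (B * (C :: real mat))"
  by (simp add: mult_smult_distrib[of _ n1 n2 _ n3] mult_smult_assoc_mat[of _ n1 n2 _ n3] smult_smult_mat mult.commute)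

text \<open>A block diagonal left factor covers both products that occur, the transposed inverse of
  \<open>P\<close> times \<open>N\<close> and \<open>H\<close> times \<open>M\<close>.\<close>

lemma lower_block_mult:
  fixes A1 :: "real mat"
  assumes "A1 \<in> carrier_mat n n" "D1 \<in> carrier_mat l l" "A2 \<in> carrier_mat n n" "C2 \<in> carrier_mat l n" "D2 \<in> carrier_mat l l"
  shows "four_block_mat A1 (0\<^sub>m n l) (0\<^sub>m l n) D1 * four_block_mat A2 (0\<^sub>m n l) C2 D2 =
    four_block_mat (A1 * A2) (0\<^sub>m n l) (D1 * C2) (D1 * D2)"
proof -
  have "four_block_mat A1 (0\<^sub>m n l) (0\<^sub>m l n) D1 * four_block_mat A2 (0\<^sub>m n l) C2 D2 =
    four_block_mat (A1 * A2 + 0\<^sub>m n l * C2) (A1 * 0\<^sub>m n l + 0\<^sub>m n l * D2)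
      (0\<^sub>m l n * A2 + D1 * C2) (0\<^sub>m l n * 0\<^sub>m n l + D1 * D2)"
    using assms by (intro mult_four_block_mat[of _ n n _ l _ l]) auto
  also have "A1 * A2 + 0\<^sub>m n l * C2 = A1 * A2"
    using assms by simp
  also have "A1 * 0\<^sub>m n l + 0\<^sub>m n l * D2 = 0\<^sub>m n l"
    using assms by simp
  also have "0\<^sub>m l n * A2 + D1 * C2 = D1 * C2"
    using assms by simp
  also have "0\<^sub>m l n * 0\<^sub>m n l + D1 * D2 = D1 * D2"
    using assms by simp
  finally show ?thesis .
qed

lemma lower_block_mult_vec:
  fixes A1 :: "real mat"
  assumes "A1 \<in> carrier_mat n n" "C1 \<in> carrier_mat l n" "D1 \<in> carrier_mat l l" "a \<in> carrier_vec n" "e \<in> carrier_vec l"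
  shows "four_block_mat A1 (0\<^sub>m n l) C1 D1 *\<^sub>v (a @\<^sub>v e) = (A1 *\<^sub>v a) @\<^sub>v (C1 *\<^sub>v a + D1 *\<^sub>v e)"
proof -
  have "0\<^sub>m n l *\<^sub>v e = 0\<^sub>v n" using assms by (intro eq_vecI) auto
  then show ?thesis
    using assms by (subst four_block_mat_mult_vec[of _ n n _ l _ l]) auto
qed

lemma Q_mat_eq: "Q_mat m l t \<beta> = four_block_mat
    ((t * \<beta>) \<cdot>\<^sub>m J_mat m l) (0\<^sub>m (tail_dim m l) l) (- I_row m l) ((1 / (t * \<beta>)) \<cdot>\<^sub>m 1\<^sub>m l)"
  by (simp add: Q_mat_def tail_dim_def)

lemma H0_mat_eq: "H0_mat m l \<gamma> \<beta> s = four_block_mat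
    ((\<beta> / \<gamma>) \<cdot>\<^sub>m (J_mat m l * transpose_mat (J_mat m l))) (0\<^sub>m (tail_dim m l) l)
    (0\<^sub>m l (tail_dim m l)) ((s / \<gamma>) \<cdot>\<^sub>m 1\<^sub>m l)"
proof -
  let ?n = "tail_dim m l"
  have "H0_mat m l \<gamma> \<beta> s = (1 / \<gamma>) \<cdot>\<^sub>m four_block_mat
      (\<beta> \<cdot>\<^sub>m (J_mat m l * transpose_mat (J_mat m l))) (0\<^sub>m ?n l) (0\<^sub>m l ?n) (s \<cdot>\<^sub>m 1\<^sub>m l)"
    by (simp add: H0_mat_def tail_dim_def)
  also have "\<dots> = four_block_mat ((1 / \<gamma>) \<cdot>\<^sub>m (\<beta> \<cdot>\<^sub>m (J_mat m l * transpose_mat (J_mat m l))))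
      ((1 / \<gamma>) \<cdot>\<^sub>m 0\<^sub>m ?n l) ((1 / \<gamma>) \<cdot>\<^sub>m 0\<^sub>m l ?n) ((1 / \<gamma>) \<cdot>\<^sub>m (s \<cdot>\<^sub>m 1\<^sub>m l))"
    by (rule smult_four_block_mat[of _ ?n ?n _ l _ l]) auto
  finally show ?thesis by (simp add: smult_smult_mat smult_zero_mat)
qed

lemma Q_mat_carrier: "Q_mat m l t \<beta> \<in> carrier_mat (tail_dim m l + l) (tail_dim m l + l)"
  unfolding Q_mat_eq by (rule four_block_carrier_mat) auto

lemma H0_mat_carrier: "H0_mat m l \<gamma> \<beta> s \<in> carrier_mat (tail_dim m l + l) (tail_dim m l + l)"
  unfolding H0_mat_eq by (rule four_block_carrier_mat) auto

lemma J_mat_transpose_inv: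
  assumes l: "0 < l"
  shows "transpose_mat (J_mat m l) * transpose_mat (inv_mat (J_mat m l)) = 1\<^sub>m (tail_dim m l)"
proof -
  have "transpose_mat (J_mat m l) * transpose_mat (inv_mat (J_mat m l))
      = transpose_mat (inv_mat (J_mat m l) * J_mat m l)"
    by (rule transpose_mult[symmetric, OF J_mat_inv_carrier[OF l] J_mat_carrier])
  then show ?thesis by (simp add: J_mat_inv_mult[OF l])
qed

context
  fixes m l :: nat and t \<beta> \<gamma> :: real
  assumes l: "0 < l" and s: "0 < t * \<beta>"
begin

text \<open>The square roots cancel: with \<open>q = sqrt (t * \<beta>)\<close>, the transposed
  inverse of \<open>P\<close> is the block diagonal matrix of the transposed inverse of
  \<open>J\<close> over \<open>q\<close> and of \<open>q I\<close>, and this meets the factors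
  \<open>q\<close>, \<open>- q\<close>, \<open>1 / q\<close> of \<open>N\<close>.\<close>

lemma M_mat_eq: "M_mat m l \<gamma> t \<beta> = four_block_mat
    (\<gamma> \<cdot>\<^sub>m transpose_mat (inv_mat (J_mat m l))) (0\<^sub>m (tail_dim m l) l)
    ((- (\<gamma> * (t * \<beta>))) \<cdot>\<^sub>m I_row m l) (\<gamma> \<cdot>\<^sub>m 1\<^sub>m l)"
proof -
  define n K q where "n = tail_dim m l" and "K = inv_mat (J_mat m l)" and "q = sqrt (t * \<beta>)"
  have K: "K \<in> carrier_mat n n" and J: "J_mat m l \<in> carrier_mat n n" and R: "I_row m l \<in> carrier_mat l n"
    using J_mat_inv_carrier[OF l] by (auto simp: n_def K_def)
  have q: "q > 0" "q * q = t * \<beta>" using s by (auto simp: q_def)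
  have JK: "J_mat m l * K = 1\<^sub>m n" using J_mat_mult_inv[OF l] by (simp add: K_def n_def)
  have P: "P_mat m l t \<beta> = four_block_mat (q \<cdot>\<^sub>m J_mat m l) (0\<^sub>m n l) (0\<^sub>m l n) ((1 / q) \<cdot>\<^sub>m 1\<^sub>m l)"
    by (simp add: P_mat_def n_def tail_dim_def q_def)
  define P' where "P' = four_block_mat ((1 / q) \<cdot>\<^sub>m K) (0\<^sub>m n l) (0\<^sub>m l n) (q \<cdot>\<^sub>m 1\<^sub>m l)"
  have "P_mat m l t \<beta> * P' = four_block_mat ((q \<cdot>\<^sub>m J_mat m l) * ((1 / q) \<cdot>\<^sub>m K)) (0\<^sub>m n l)
      (((1 / q) \<cdot>\<^sub>m 1\<^sub>m l) * 0\<^sub>m l n) (((1 / q) \<cdot>\<^sub>m 1\<^sub>m l) * (q \<cdot>\<^sub>m 1\<^sub>m l))"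
    unfolding P P'_def using J K by (intro lower_block_mult) auto
  also have "\<dots> = four_block_mat (1\<^sub>m n) (0\<^sub>m n l) (0\<^sub>m l n) (1\<^sub>m l)"
    using q by (simp add: smult_mat_mult_smult_mat[OF J K] smult_mat_mult_smult_mat[of _ l l _ l] JK one_smult_mat
        right_mult_zero_mat[of _ l l])
  finally have PP': "P_mat m l t \<beta> * P' = 1\<^sub>m (n + l)" by (simp add: four_block_one_mat)
  have "P_mat m l t \<beta> \<in> carrier_mat (n + l) (n + l)"
    unfolding P by (rule four_block_carrier_mat) (use J in auto)
  moreover have "P' \<in> carrier_mat (n + l) (n + l)"
    unfolding P'_def by (rule four_block_carrier_mat) (use K in auto)
  ultimately have "inv_mat (P_mat m l t \<beta>) = P'" using PP' by (intro inv_mat_eqI)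
  moreover have "transpose_mat P' =
      four_block_mat (transpose_mat ((1 / q) \<cdot>\<^sub>m K)) (transpose_mat (0\<^sub>m l n)) (transpose_mat (0\<^sub>m n l)) (transpose_mat (q \<cdot>\<^sub>m 1\<^sub>m l))"
    unfolding P'_def using K by (intro transpose_four_block_mat[of _ n n _ l _ l]) auto
  moreover have "transpose_mat ((1 / q) \<cdot>\<^sub>m K) = (1 / q) \<cdot>\<^sub>m transpose_mat K"
    "transpose_mat (q \<cdot>\<^sub>m 1\<^sub>m l) = q \<cdot>\<^sub>m 1\<^sub>m l"
    by (intro eq_matI; auto)+
  ultimately have PT: "transpose_mat (inv_mat (P_mat m l t \<beta>))
      = four_block_mat ((1 / q) \<cdot>\<^sub>m transpose_mat K) (0\<^sub>m n l) (0\<^sub>m l n) (q \<cdot>\<^sub>m 1\<^sub>m l)"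
    by simp
  have "N_mat m l \<gamma> t \<beta> = \<gamma> \<cdot>\<^sub>m four_block_mat (q \<cdot>\<^sub>m 1\<^sub>m n) (0\<^sub>m n l) ((- q) \<cdot>\<^sub>m I_row m l) ((1 / q) \<cdot>\<^sub>m 1\<^sub>m l)"
    by (simp add: N_mat_def n_def tail_dim_def q_def)
  also have "\<dots> = four_block_mat (\<gamma> \<cdot>\<^sub>m (q \<cdot>\<^sub>m 1\<^sub>m n)) (\<gamma> \<cdot>\<^sub>m 0\<^sub>m n l) (\<gamma> \<cdot>\<^sub>m ((- q) \<cdot>\<^sub>m I_row m l)) (\<gamma> \<cdot>\<^sub>m ((1 / q) \<cdot>\<^sub>m 1\<^sub>m l))"
    using R by (intro smult_four_block_mat[of _ n n _ l _ l]) auto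
  finally have N: "N_mat m l \<gamma> t \<beta> = four_block_mat ((\<gamma> * q) \<cdot>\<^sub>m 1\<^sub>m n) (0\<^sub>m n l) ((\<gamma> * - q) \<cdot>\<^sub>m I_row m l) ((\<gamma> * (1 / q)) \<cdot>\<^sub>m 1\<^sub>m l)"
    by (simp add: smult_smult_mat smult_zero_mat)
  have "M_mat m l \<gamma> t \<beta> = four_block_mat (((1 / q) \<cdot>\<^sub>m transpose_mat K) * ((\<gamma> * q) \<cdot>\<^sub>m 1\<^sub>m n)) (0\<^sub>m n l)
      ((q \<cdot>\<^sub>m 1\<^sub>m l) * ((\<gamma> * - q) \<cdot>\<^sub>m I_row m l)) ((q \<cdot>\<^sub>m 1\<^sub>m l) * ((\<gamma> * (1 / q)) \<cdot>\<^sub>m 1\<^sub>m l))"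
    unfolding M_mat_def PT N using K R by (intro lower_block_mult) auto
  also have "((1 / q) \<cdot>\<^sub>m transpose_mat K) * ((\<gamma> * q) \<cdot>\<^sub>m 1\<^sub>m n) = \<gamma> \<cdot>\<^sub>m transpose_mat K"
    using K q by (subst smult_mat_mult_smult_mat[of _ n n _ n]) auto
  also have "(q \<cdot>\<^sub>m 1\<^sub>m l) * ((\<gamma> * - q) \<cdot>\<^sub>m I_row m l) = (- (\<gamma> * (t * \<beta>))) \<cdot>\<^sub>m I_row m l"
  proof -
    have "q * (\<gamma> * - q) = - (\<gamma> * (t * \<beta>))" using q(2) by (simp add: algebra_simps)
    then show ?thesis using R by (subst smult_mat_mult_smult_mat[of _ l l _ n]) auto
  qed
  also have "(q \<cdot>\<^sub>m 1\<^sub>m l) * ((\<gamma> * (1 / q)) \<cdot>\<^sub>m 1\<^sub>m l) = \<gamma> \<cdot>\<^sub>m (1\<^sub>m l :: real mat)"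
    using q by (subst smult_mat_mult_smult_mat[of _ l l _ l]) auto
  finally show ?thesis by (simp add: K_def n_def)
qed

lemma M_mat_carrier: "M_mat m l \<gamma> t \<beta> \<in> carrier_mat (tail_dim m l + l) (tail_dim m l + l)"
  unfolding M_mat_eq by (rule four_block_carrier_mat) (use J_mat_inv_carrier[OF l] in auto)

lemma M_mat_mult_append:
  assumes a: "a \<in> carrier_vec (tail_dim m l)" and e: "e \<in> carrier_vec l"
  shows "M_mat m l \<gamma> t \<beta> *\<^sub>v (a @\<^sub>v e) =
    (\<gamma> \<cdot>\<^sub>v (transpose_mat (inv_mat (J_mat m l)) *\<^sub>v a)) @\<^sub>v (\<gamma> \<cdot>\<^sub>v (e - (t * \<beta>) \<cdot>\<^sub>v (I_row m l *\<^sub>v a)))"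
proof -
  have K: "transpose_mat (inv_mat (J_mat m l)) \<in> carrier_mat (tail_dim m l) (tail_dim m l)"
    using J_mat_inv_carrier[OF l] by simp
  have "M_mat m l \<gamma> t \<beta> *\<^sub>v (a @\<^sub>v e) = ((\<gamma> \<cdot>\<^sub>m transpose_mat (inv_mat (J_mat m l))) *\<^sub>v a) @\<^sub>v
      (((- (\<gamma> * (t * \<beta>))) \<cdot>\<^sub>m I_row m l) *\<^sub>v a + (\<gamma> \<cdot>\<^sub>m 1\<^sub>m l) *\<^sub>v e)"
    unfolding M_mat_eq using K a e by (intro lower_block_mult_vec) auto
  also have "(\<gamma> \<cdot>\<^sub>m transpose_mat (inv_mat (J_mat m l))) *\<^sub>v a = \<gamma> \<cdot>\<^sub>v (transpose_mat (inv_mat (J_mat m l)) *\<^sub>v a)"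
    using K a by (intro smult_mat_mult_vec) auto
  also have "((- (\<gamma> * (t * \<beta>))) \<cdot>\<^sub>m I_row m l) *\<^sub>v a + (\<gamma> \<cdot>\<^sub>m 1\<^sub>m l) *\<^sub>v e = \<gamma> \<cdot>\<^sub>v (e - (t * \<beta>) \<cdot>\<^sub>v (I_row m l *\<^sub>v a))"
    using a e by (simp add: smult_mat_mult_vec) (intro eq_vecI, auto simp: algebra_simps)
  finally show ?thesis .
qed

text \<open>\<open>M\<close> contains the transposed inverse of \<open>J\<close>, so the factor
  \<open>J J^T\<close> in \<open>H\<close> returns \<open>J\<close>. The lower right coefficient
  \<open>1 / (t * \<beta>)\<close> is the one that produces the lower row of
  \<open>Q\<close>.\<close>

lemma H0_mat_mult_M_mat:
  assumes g: "\<gamma> \<noteq> 0"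
  shows "H0_mat m l \<gamma> (t * \<beta>) (1 / (t * \<beta>)) * M_mat m l \<gamma> t \<beta> = Q_mat m l t \<beta>"
proof -
  define n J K where "n = tail_dim m l" and "J = J_mat m l" and "K = transpose_mat (inv_mat J)"
  have K: "K \<in> carrier_mat n n" and J: "J \<in> carrier_mat n n" and R: "I_row m l \<in> carrier_mat l n"
    using J_mat_inv_carrier[OF l] by (auto simp: n_def K_def J_def)
  have "J * transpose_mat J * K = J * (transpose_mat J * K)"
    using J K by (intro assoc_mult_mat[of _ n n _ n _ n]) auto
  then have JK: "J * transpose_mat J * K = J"
    using J J_mat_transpose_inv[OF l] by (simp add: J_def K_def n_def)
  have "H0_mat m l \<gamma> (t * \<beta>) (1 / (t * \<beta>)) * M_mat m l \<gamma> t \<beta> = four_block_mat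
      (((t * \<beta> / \<gamma>) \<cdot>\<^sub>m (J * transpose_mat J)) * (\<gamma> \<cdot>\<^sub>m K)) (0\<^sub>m n l)
      (((1 / (t * \<beta>) / \<gamma>) \<cdot>\<^sub>m 1\<^sub>m l) * ((- (\<gamma> * (t * \<beta>))) \<cdot>\<^sub>m I_row m l))
      (((1 / (t * \<beta>) / \<gamma>) \<cdot>\<^sub>m 1\<^sub>m l) * (\<gamma> \<cdot>\<^sub>m 1\<^sub>m l))"
    unfolding M_mat_eq H0_mat_eq n_def[symmetric] J_def[symmetric] K_def[symmetric]
    using J K R by (intro lower_block_mult) (auto simp: K_def J_def)
  also have "((t * \<beta> / \<gamma>) \<cdot>\<^sub>m (J * transpose_mat J)) * (\<gamma> \<cdot>\<^sub>m K) = (t * \<beta>) \<cdot>\<^sub>m J"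
    using J K g by (subst smult_mat_mult_smult_mat[of _ n n _ n]) (auto simp: JK)
  also have "((1 / (t * \<beta>) / \<gamma>) \<cdot>\<^sub>m 1\<^sub>m l) * ((- (\<gamma> * (t * \<beta>))) \<cdot>\<^sub>m I_row m l) = - I_row m l"
    using R g s by (subst smult_mat_mult_smult_mat[of _ l l _ n]) (auto simp: zero_less_mult_iff intro!: eq_matI)
  also have "((1 / (t * \<beta>) / \<gamma>) \<cdot>\<^sub>m 1\<^sub>m l) * (\<gamma> \<cdot>\<^sub>m 1\<^sub>m l) = (1 / (t * \<beta>)) \<cdot>\<^sub>m (1\<^sub>m l :: real mat)"
    using g by (subst smult_mat_mult_smult_mat[of _ l l _ l]) auto
  finally show ?thesis by (simp add: Q_mat_eq n_def J_def)
qed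

end

lemma Q_mat_mult_append:
  assumes a: "a \<in> carrier_vec (tail_dim m l)" and e: "e \<in> carrier_vec l"
  shows "Q_mat m l t \<beta> *\<^sub>v (a @\<^sub>v e) =
    ((t * \<beta>) \<cdot>\<^sub>v (J_mat m l *\<^sub>v a)) @\<^sub>v ((1 / (t * \<beta>)) \<cdot>\<^sub>v e - I_row m l *\<^sub>v a)"
proof -
  have "Q_mat m l t \<beta> *\<^sub>v (a @\<^sub>v e) = (((t * \<beta>) \<cdot>\<^sub>m J_mat m l) *\<^sub>v a) @\<^sub>v
      ((- I_row m l) *\<^sub>v a + ((1 / (t * \<beta>)) \<cdot>\<^sub>m 1\<^sub>m l) *\<^sub>v e)"
    unfolding Q_mat_eq using a e by (intro lower_block_mult_vec) auto
  also have "((t * \<beta>) \<cdot>\<^sub>m J_mat m l) *\<^sub>v a = (t * \<beta>) \<cdot>\<^sub>v (J_mat m l *\<^sub>v a)"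
    using a by (simp add: smult_mat_mult_vec)
  also have "(- I_row m l) *\<^sub>v a + ((1 / (t * \<beta>)) \<cdot>\<^sub>m 1\<^sub>m l) *\<^sub>v e = (1 / (t * \<beta>)) \<cdot>\<^sub>v e - I_row m l *\<^sub>v a"
    using a e by (simp add: smult_mat_mult_vec) (intro eq_vecI, auto)
  finally show ?thesis .
qed

lemma H0_mat_bilinear:
  assumes a: "a \<in> carrier_vec (tail_dim m l)" "a' \<in> carrier_vec (tail_dim m l)"
    and e: "e \<in> carrier_vec l" "e' \<in> carrier_vec l"
  shows "(a @\<^sub>v e) \<bullet> (H0_mat m l \<gamma> \<beta> s *\<^sub>v (a' @\<^sub>v e')) =
    (\<beta> * ((transpose_mat (J_mat m l) *\<^sub>v a) \<bullet> (transpose_mat (J_mat m l) *\<^sub>v a')) + s * (e \<bullet> e')) / \<gamma>"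
proof -
  define n J where "n = tail_dim m l" and "J = J_mat m l"
  have J: "J \<in> carrier_mat n n" by (auto simp: n_def J_def)
  note a = a[folded n_def]
  have "H0_mat m l \<gamma> \<beta> s *\<^sub>v (a' @\<^sub>v e') = (((\<beta> / \<gamma>) \<cdot>\<^sub>m (J * transpose_mat J)) *\<^sub>v a') @\<^sub>v
      (0\<^sub>m l n *\<^sub>v a' + ((s / \<gamma>) \<cdot>\<^sub>m 1\<^sub>m l) *\<^sub>v e')"
    unfolding H0_mat_eq n_def[symmetric] J_def[symmetric] using a e J by (intro lower_block_mult_vec) auto
  also have "((\<beta> / \<gamma>) \<cdot>\<^sub>m (J * transpose_mat J)) *\<^sub>v a' = (\<beta> / \<gamma>) \<cdot>\<^sub>v (J *\<^sub>v (transpose_mat J *\<^sub>v a'))"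
    using a J by (simp add: smult_mat_mult_vec assoc_mult_mat_vec[of _ n n _ n])
  also have "0\<^sub>m l n *\<^sub>v a' + ((s / \<gamma>) \<cdot>\<^sub>m 1\<^sub>m l) *\<^sub>v e' = (s / \<gamma>) \<cdot>\<^sub>v e'"
    using a e by (simp add: smult_mat_mult_vec) (intro eq_vecI, auto)
  also have "(a @\<^sub>v e) \<bullet> (((\<beta> / \<gamma>) \<cdot>\<^sub>v (J *\<^sub>v (transpose_mat J *\<^sub>v a'))) @\<^sub>v ((s / \<gamma>) \<cdot>\<^sub>v e'))
      = \<beta> / \<gamma> * (a \<bullet> (J *\<^sub>v (transpose_mat J *\<^sub>v a'))) + s / \<gamma> * (e \<bullet> e')"
    using a e J by (subst scalar_prod_append[of _ n _ l]) (auto simp: dot_linear)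
  also have "a \<bullet> (J *\<^sub>v (transpose_mat J *\<^sub>v a')) = (transpose_mat J *\<^sub>v a) \<bullet> (transpose_mat J *\<^sub>v a')"
    using a J by (intro dot_mult_mat_vec[symmetric, of _ n n]) auto
  finally show ?thesis by (simp add: J_def add_divide_distrib)
qed

lemma wnormsq_H0_mat:
  assumes a: "a \<in> carrier_vec (tail_dim m l)" and e: "e \<in> carrier_vec l"
  shows "wnormsq (H0_mat m l \<gamma> \<beta> s) (a @\<^sub>v e) =
    (\<beta> * ((transpose_mat (J_mat m l) *\<^sub>v a) \<bullet> (transpose_mat (J_mat m l) *\<^sub>v a)) + s * (e \<bullet> e)) / \<gamma>"
  unfolding wnormsq_def by (rule H0_mat_bilinear[OF a a e e])

text \<open>Since \<open>Q = H M\<close>, the subtracted product acts on \<open>d\<close> as the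
  transpose of \<open>M\<close> applied to \<open>Q d\<close>; so only \<open>Q d\<close> and
  \<open>M d\<close> have to be computed.\<close>

lemma wnormsq_G_mat:
  assumes Q: "Q \<in> carrier_mat n n" and M: "M \<in> carrier_mat n n" and H: "H \<in> carrier_mat n n"
    and QHM: "Q = H * M" and d: "d \<in> carrier_vec n"
  shows "wnormsq (G_mat Q M H) d = 2 * (d \<bullet> (Q *\<^sub>v d)) - (M *\<^sub>v d) \<bullet> (Q *\<^sub>v d)"
proof -
  have 1: "transpose_mat M * H * M *\<^sub>v d = transpose_mat M *\<^sub>v (Q *\<^sub>v d)"
    using M H d unfolding QHM
    by (simp add: assoc_mult_mat_vec[of _ n n _ n] assoc_mult_mat[of _ n n _ n _ n])
  have 2: "d \<bullet> (transpose_mat B *\<^sub>v w) = (B *\<^sub>v d) \<bullet> w" if "B \<in> carrier_mat n n" "w \<in> carrier_vec n" for B w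
    using dot_mult_mat_vec[OF that(1) d that(2)] that d
    by (metis carrier_vecD dot_commute mult_mat_vec_carrier transpose_carrier_mat)
  have "G_mat Q M H *\<^sub>v d = transpose_mat Q *\<^sub>v d + Q *\<^sub>v d - transpose_mat M *\<^sub>v (Q *\<^sub>v d)"
    unfolding G_mat_def 1[symmetric] using Q M H d
    by (simp add: minus_mult_distrib_mat_vec[of _ n n] add_mult_distrib_mat_vec[of _ n n])
  then show ?thesis unfolding wnormsq_def using Q M d
    by (simp add: dot_linear 2 dot_commute[of "Q *\<^sub>v d" d])
qed

lemma wnormsq_diff_correction:
  assumes H: "H \<in> carrier_mat n n" and y: "y \<in> carrier_vec n" and D: "D \<in> carrier_vec n"
    and sym: "D \<bullet> (H *\<^sub>v y) = y \<bullet> (H *\<^sub>v D)"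
  shows "wnormsq H (y - D) = wnormsq H y - 2 * (y \<bullet> (H *\<^sub>v D)) + D \<bullet> (H *\<^sub>v D)"
  unfolding wnormsq_def using H y D sym by (simp add: mult_mat_vec_linear[OF H] dot_linear)

text \<open>With \<open>e = t \<beta> (w + p)\<close>, the part from \<open>Q\<close> and its
  transpose is \<open>t \<beta>\<close> times \<open>|a|^2 + |p|^2 + 2 |w|^2 + 2 p w\<close>, where
  \<open>|p|^2\<close> stems from \<open>J + J^T\<close>; it completes a square. The correction
  removes \<open>\<gamma> (|a|^2 + |w|^2)\<close>. Along the iteration \<open>w\<close> is the
  residual of \<open>xtilde\<close>.\<close>

lemma wnormsq_G_mat_block:
  assumes l: "0 < l" and s: "0 < t * \<beta>" and g: "\<gamma> \<noteq> 0"
    and u: "\<And>j. j \<in> {2..m} \<Longrightarrow> u j \<in> carrier_vec l" and e: "e \<in> carrier_vec l"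
  defines "a \<equiv> tail_stack m l u"
  defines "p \<equiv> I_row m l *\<^sub>v a" and "w \<equiv> (1 / (t * \<beta>)) \<cdot>\<^sub>v e - I_row m l *\<^sub>v a"
  shows "wnormsq (G_mat (Q_mat m l t \<beta>) (M_mat m l \<gamma> t \<beta>) (H0_mat m l \<gamma> (t * \<beta>) (1 / (t * \<beta>)))) (a @\<^sub>v e) =
    t * \<beta> * ((1 - \<gamma>) * (a \<bullet> a) + (1 - \<gamma>) * (w \<bullet> w) + (w + p) \<bullet> (w + p))"
proof -
  let ?n = "tail_dim m l" and ?J = "J_mat m l" and ?K = "transpose_mat (inv_mat (J_mat m l))"
  have K: "?K \<in> carrier_mat ?n ?n" using J_mat_inv_carrier[OF l] by simp
  have a: "a \<in> carrier_vec ?n" by (simp add: a_def)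
  have Ja: "?J *\<^sub>v a \<in> carrier_vec ?n" and Ka: "?K *\<^sub>v a \<in> carrier_vec ?n"
    by (rule mult_mat_vec_carrier[OF J_mat_carrier a], rule mult_mat_vec_carrier[OF K a])
  have p: "p \<in> carrier_vec l" and w: "w \<in> carrier_vec l" using a e by (auto simp: p_def w_def intro!: carrier_vecI)
  have "w + p = (1 / (t * \<beta>)) \<cdot>\<^sub>v e" using e by (intro eq_vecI) (simp_all add: w_def p_def)
  then have e_eq: "e = (t * \<beta>) \<cdot>\<^sub>v (w + p)"
    using s by (auto simp: smult_smult_assoc)
  have Qd: "Q_mat m l t \<beta> *\<^sub>v (a @\<^sub>v e) = ((t * \<beta>) \<cdot>\<^sub>v (?J *\<^sub>v a)) @\<^sub>v w"
    unfolding w_def by (rule Q_mat_mult_append[OF a e])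
  have "e - (t * \<beta>) \<cdot>\<^sub>v p = (t * \<beta>) \<cdot>\<^sub>v w"
    using p w by (intro eq_vecI) (auto simp: e_eq algebra_simps)
  then have Md: "M_mat m l \<gamma> t \<beta> *\<^sub>v (a @\<^sub>v e) = (\<gamma> \<cdot>\<^sub>v (?K *\<^sub>v a)) @\<^sub>v (\<gamma> \<cdot>\<^sub>v ((t * \<beta>) \<cdot>\<^sub>v w))"
    unfolding p_def by (simp add: M_mat_mult_append[OF l s a e])
  have "(?K *\<^sub>v a) \<bullet> (?J *\<^sub>v a) = a \<bullet> (inv_mat ?J *\<^sub>v (?J *\<^sub>v a))"
    using a K J_mat_inv_carrier[OF l] by (intro dot_mult_mat_vec[of _ ?n ?n] mult_mat_vec_carrier[OF J_mat_carrier]) auto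
  also have "inv_mat ?J *\<^sub>v (?J *\<^sub>v a) = a"
    using a J_mat_inv_carrier[OF l] J_mat_inv_mult[OF l]
    by (simp flip: assoc_mult_mat_vec[of _ ?n ?n _ ?n])
  finally have KJ: "(?K *\<^sub>v a) \<bullet> (?J *\<^sub>v a) = a \<bullet> a" .
  have J: "2 * (a \<bullet> (?J *\<^sub>v a)) = a \<bullet> a + p \<bullet> p"
    unfolding a_def p_def by (rule J_mat_quadratic_form[OF l u])
  have "wnormsq (G_mat (Q_mat m l t \<beta>) (M_mat m l \<gamma> t \<beta>) (H0_mat m l \<gamma> (t * \<beta>) (1 / (t * \<beta>)))) (a @\<^sub>v e) =
    2 * ((a @\<^sub>v e) \<bullet> (Q_mat m l t \<beta> *\<^sub>v (a @\<^sub>v e))) - (M_mat m l \<gamma> t \<beta> *\<^sub>v (a @\<^sub>v e)) \<bullet> (Q_mat m l t \<beta> *\<^sub>v (a @\<^sub>v e))"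
    using a e by (intro wnormsq_G_mat[of _ "?n + l"] Q_mat_carrier M_mat_carrier H0_mat_carrier l s
        H0_mat_mult_M_mat[OF l s g, symmetric]) simp
  also have "(a @\<^sub>v e) \<bullet> (Q_mat m l t \<beta> *\<^sub>v (a @\<^sub>v e)) = t * \<beta> * (a \<bullet> (?J *\<^sub>v a)) + e \<bullet> w"
    unfolding Qd using a e w Ja by (simp add: scalar_prod_append[of _ ?n _ l] dot_linear)
  also have "e \<bullet> w = t * \<beta> * (w \<bullet> w + p \<bullet> w)"
    using p w by (simp add: e_eq dot_linear)
  also have "(M_mat m l \<gamma> t \<beta> *\<^sub>v (a @\<^sub>v e)) \<bullet> (Q_mat m l t \<beta> *\<^sub>v (a @\<^sub>v e))
      = \<gamma> * (t * \<beta>) * (a \<bullet> a) + \<gamma> * (t * \<beta>) * (w \<bullet> w)"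
    unfolding Qd Md using a w KJ Ja Ka by (simp add: scalar_prod_append[of _ ?n _ l] dot_linear)
  also have "2 * (t * \<beta> * (a \<bullet> (?J *\<^sub>v a)) + t * \<beta> * (w \<bullet> w + p \<bullet> w))
      = t * \<beta> * (a \<bullet> a + p \<bullet> p) + 2 * (t * \<beta> * (w \<bullet> w + p \<bullet> w))"
    using J by (simp add: algebra_simps)
  finally show ?thesis using p w dot_commute[of p w] by (simp add: dot_linear algebra_simps)
qed

section \<open>The iteration\<close>

lemma Amul_carrier [simp]: "Amul m l A x \<in> carrier_vec l" "dim_vec (Amul m l A x) = l"
  by (simp_all add: Amul_def Asum_def)

lemma index_Amul: "i < l \<Longrightarrow> Amul m l A x $ i = (\<Sum>j = 1..m. (A j *\<^sub>v x j) $ i)"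
  by (simp add: Amul_def Asum_def)

lemma Amul_dot:
  assumes "\<And>j. j \<in> {1..m} \<Longrightarrow> A j \<in> carrier_mat l (n j)" "w \<in> carrier_vec l"
  shows "w \<bullet> Amul m l A x = (\<Sum>j = 1..m. w \<bullet> (A j *\<^sub>v x j))"
proof -
  have "w \<bullet> (A j *\<^sub>v x j) = (\<Sum>i<l. w $ i * (A j *\<^sub>v x j) $ i)" if "j \<in> {1..m}" for j
    using assms(1)[OF that] assms(2) by (intro dot_sum carrier_vecI) auto
  then show ?thesis
    using assms(2) by (simp add: dot_sum[of _ l] index_Amul sum_distrib_left sum.swap[of _ "{..<l}"])
qed

lemma Amul_fun_upd:
  assumes A: "A j \<in> carrier_mat l p" and x: "x j \<in> carrier_vec p" and y: "y \<in> carrier_vec p" and j: "j \<in> {1..m}"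
  shows "Amul m l A (x(j := y)) = Amul m l A x + A j *\<^sub>v (y - x j)"
proof (rule eq_vecI)
  fix i assume "i < dim_vec (Amul m l A x + A j *\<^sub>v (y - x j))"
  then have i: "i < l" using A by simp
  have "(\<Sum>c = 1..m. (A c *\<^sub>v (x(j := y)) c) $ i)
      = (A j *\<^sub>v y) $ i + (\<Sum>c \<in> {1..m} - {j}. (A c *\<^sub>v (x(j := y)) c) $ i)"
    using j by (subst sum.remove[of _ j]) auto
  also have "(\<Sum>c \<in> {1..m} - {j}. (A c *\<^sub>v (x(j := y)) c) $ i) = (\<Sum>c \<in> {1..m} - {j}. (A c *\<^sub>v x c) $ i)"
    by (intro sum.cong) auto
  also have "\<dots> = (\<Sum>c = 1..m. (A c *\<^sub>v x c) $ i) - (A j *\<^sub>v x j) $ i"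
    using j by (subst (2) sum.remove[of _ j]) auto
  finally show "Amul m l A (x(j := y)) $ i = (Amul m l A x + A j *\<^sub>v (y - x j)) $ i"
    using i A x y by (simp add: index_Amul mult_mat_vec_linear[OF A] del: index_mult_mat_vec)
qed (use A in simp)

text \<open>\<open>phi\<close> is quadratic in one block, so the remainder of the linear expansion
  is exactly \<open>\<beta> / 2\<close> times the squared norm of
  \<open>A j (y - x j)\<close>.\<close>

lemma grad_phi_eq:
  assumes A: "A j \<in> carrier_mat l (n j)" and x: "x j \<in> carrier_vec (n j)" and j: "j \<in> {1..m}"
    and b: "b \<in> carrier_vec l" and \<mu>: "\<mu> \<in> carrier_vec l"
  shows "grad_phi m l n A b \<beta> j x \<mu> = transpose_mat (A j) *\<^sub>v (\<beta> \<cdot>\<^sub>v (Amul m l A x - b) - \<mu>)"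
proof -
  define R u where "R = Amul m l A x - b" and "u = \<beta> \<cdot>\<^sub>v (Amul m l A x - b) - \<mu>"
  have R: "R \<in> carrier_vec l" and u: "u \<in> carrier_vec l" using b \<mu> by (auto simp: R_def u_def)
  have d: "transpose_mat (A j) *\<^sub>v u \<in> carrier_vec (n j)"
    using A u by (intro mult_mat_vec_carrier[of _ _ l]) auto
  obtain K where K: "K \<ge> 0" "\<And>y. y \<in> carrier_vec (n j) \<Longrightarrow> (A j *\<^sub>v y) \<bullet> (A j *\<^sub>v y) \<le> K * (y \<bullet> y)"
    using mult_mat_vec_bounded[of "A j"] A by auto
  have bound: "\<bar>phi m l A b \<beta> (x(j := y)) \<mu> - phi m l A b \<beta> (x(j := x j)) \<mu>
      - (transpose_mat (A j) *\<^sub>v u) \<bullet> (y - x j)\<bar> \<le> (\<bar>\<beta> / 2\<bar> * K) * (vnorm (y - x j))\<^sup>2"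
    if y: "y \<in> carrier_vec (n j)" for y
  proof -
    define h where "h = A j *\<^sub>v (y - x j)"
    have h: "h \<in> carrier_vec l" using A x y by (auto simp: h_def)
    have "Amul m l A (x(j := y)) - b = R + h"
      using A x y b h unfolding Amul_fun_upd[of A j l "n j" x y m, OF A x y j] h_def[symmetric] R_def by (intro eq_vecI) auto
    then have eq: "phi m l A b \<beta> (x(j := y)) \<mu> - phi m l A b \<beta> (x(j := x j)) \<mu> - (transpose_mat (A j) *\<^sub>v u) \<bullet> (y - x j)
        = \<beta> / 2 * (h \<bullet> h)"
      using R h \<mu> b u dot_commute[of R h] A x y
      by (simp add: phi_def vnorm_sq dot_mult_mat_vec[OF A _ u] flip: R_def h_def)
        (simp add: u_def dot_linear algebra_simps flip: R_def)
    have "\<bar>\<beta> / 2 * (h \<bullet> h)\<bar> \<le> (\<bar>\<beta> / 2\<bar> * K) * (vnorm (y - x j))\<^sup>2"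
      using K(2)[of "y - x j"] x y mult_left_mono[of "h \<bullet> h" "K * ((y - x j) \<bullet> (y - x j))" "\<bar>\<beta> / 2\<bar>"]
      by (simp add: abs_mult vnorm_sq dot_self_nonneg h_def mult_ac)
    then show ?thesis unfolding eq .
  qed
  then show ?thesis
    unfolding grad_phi_def u_def[symmetric] by (rule gradient_eqI[OF has_gradient_quadraticI[OF d] x])
qed

text \<open>The setting shared by both parts. Bounds on \<open>\<tau>\<close> are obtained
  differently in the two parts and are therefore premises of the individual lemmas.\<close>

locale algorithm3_run =
  fixes m l :: nat and n :: "nat \<Rightarrow> nat"
    and A :: "nat \<Rightarrow> real mat" and b :: "real vec" and f :: "nat \<Rightarrow> real vec \<Rightarrow> real"
    and \<gamma> :: real and \<tau> \<beta> :: "int \<Rightarrow> real"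
    and xhat xbreve xtilde xbar :: "int \<Rightarrow> nat \<Rightarrow> real vec"
    and lam lambar lamtilde :: "int \<Rightarrow> real vec"
  assumes prob: "problem_P3 m l n A b f"
    and \<gamma>: "0 < \<gamma>" "\<gamma> \<le> 1"
    and alg: "algorithm3 m l n A b f \<gamma> \<tau> \<beta> xhat xbreve xtilde xbar lam"
    and lambar: "\<forall>k\<ge>0. lambar k = lam k - (\<gamma> * (1 - \<tau> k) * \<beta> k) \<cdot>\<^sub>v (Amul m l A (xbreve (k - 1)) - b)"
    and lamtilde: "\<forall>k\<ge>0. lamtilde k = lambar k
           - (\<tau> k * \<beta> k) \<cdot>\<^sub>v (A 1 *\<^sub>v xtilde k 1 + Asum {2..m} l A (xbar k) - b)"
begin

lemma m2: "2 \<le> m" and l0: "0 < l" and b_carrier [simp]: "b \<in> carrier_vec l" "dim_vec b = l"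
  and A_carrier: "j \<in> {1..m} \<Longrightarrow> A j \<in> carrier_mat l (n j)"
  and f_convex: "j \<in> {1..m} \<Longrightarrow> convex_fun (n j) (f j)"
  using prob by (auto simp: problem_P3_def closed_proper_convex_def)

lemma beta_pos: "0 \<le> k \<Longrightarrow> 0 < \<beta> k"
  and xhat_eq: "0 \<le> k \<Longrightarrow> j \<in> {1..m} \<Longrightarrow> xhat k j = (1 - \<tau> k) \<cdot>\<^sub>v xbreve (k - 1) j + \<tau> k \<cdot>\<^sub>v xbar k j"
  and xtilde_eq: "0 \<le> k \<Longrightarrow> j \<in> {1..m} \<Longrightarrow>
    xtilde k j = (1 / \<tau> k) \<cdot>\<^sub>v xbreve k j - ((1 - \<tau> k) / \<tau> k) \<cdot>\<^sub>v xbreve (k - 1) j"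
  and xbreve_argmin: "0 \<le> k \<Longrightarrow> j \<in> {1..m} \<Longrightarrow> is_arg_min
     (\<lambda>y. f j y + y \<bullet> grad_phi m l n A b (\<beta> k) j (\<lambda>i. if i < j then xbreve k i else xhat k i) (lam k)
        + \<beta> k / 2 * wnormsq (transpose_mat (A j) * A j) (y - xhat k j))
     (\<lambda>y. y \<in> carrier_vec (n j)) (xbreve k j)"
  using alg unfolding algorithm3_def by blast+

lemma xbar_bspace: "xbar 0 \<in> bspace m n" "0 \<le> k \<Longrightarrow> xbar (k + 1) \<in> bspace m n"
  using alg unfolding algorithm3_def by blast+

lemma tail_stack_xbar: "0 \<le> k \<Longrightarrow> tail_stack m l (\<lambda>j. A j *\<^sub>v xbar (k + 1) j) =
    tail_stack m l (\<lambda>j. A j *\<^sub>v xbar k j)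
    - \<gamma> \<cdot>\<^sub>v (transpose_mat (inv_mat (J_mat m l))
      *\<^sub>v tail_stack m l (\<lambda>j. A j *\<^sub>v xbar k j - A j *\<^sub>v xtilde k j))"
  using alg unfolding algorithm3_def by blast

lemma lam_0: "lam 0 \<in> carrier_vec l"
  using alg unfolding algorithm3_def by blast

lemma lam_step: "0 \<le> k \<Longrightarrow> lam (k + 1) = lam k
    - \<gamma> \<cdot>\<^sub>v (((1 - \<tau> k) * \<beta> k) \<cdot>\<^sub>v (Amul m l A (xbreve (k - 1)) - b)
           - ((1 - \<tau> (k + 1)) * \<beta> (k + 1)) \<cdot>\<^sub>v (Amul m l A (xbreve k) - b))
    - (\<gamma> * \<tau> k * \<beta> k) \<cdot>\<^sub>v (Amul m l A (xtilde k) - b)"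
  using alg unfolding algorithm3_def by blast

lemma xbreve_carrier: "-1 \<le> k \<Longrightarrow> j \<in> {1..m} \<Longrightarrow> xbreve k j \<in> carrier_vec (n j)"
proof (cases "k = -1")
  case True
  assume "j \<in> {1..m}"
  then show ?thesis using alg True by (auto simp: algorithm3_def bspace_def)
next
  case False
  assume "-1 \<le> k" "j \<in> {1..m}"
  then show ?thesis using xbreve_argmin[of k j] False by (auto simp: is_arg_min_def)
qed

lemma xbreve_bspace: "-1 \<le> k \<Longrightarrow> xbreve k \<in> bspace m n"
  by (simp add: bspace_def xbreve_carrier)

lemma xbar_carrier:
  assumes "0 \<le> k" "j \<in> {1..m}"
  shows "xbar k j \<in> carrier_vec (n j)"
proof -
  have "xbar k \<in> bspace m n"
    using xbar_bspace(1) xbar_bspace(2)[of "k - 1"] assms(1) by (cases "k = 0") auto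
  then show ?thesis using assms by (simp add: bspace_def)
qed

lemma xhat_carrier: "0 \<le> k \<Longrightarrow> j \<in> {1..m} \<Longrightarrow> xhat k j \<in> carrier_vec (n j)"
  by (simp add: xhat_eq xbreve_carrier xbar_carrier)

lemma xtilde_carrier: "0 \<le> k \<Longrightarrow> j \<in> {1..m} \<Longrightarrow> xtilde k j \<in> carrier_vec (n j)"
  by (simp add: xtilde_eq xbreve_carrier)

lemma A_mult_carrier: "j \<in> {1..m} \<Longrightarrow> y \<in> carrier_vec (n j) \<Longrightarrow> A j *\<^sub>v y \<in> carrier_vec l"
  by (rule mult_mat_vec_carrier[OF A_carrier])

lemma A_dim_row [simp]: "j \<in> {1..m} \<Longrightarrow> dim_row (A j) = l"
  using A_carrier by auto

lemma lam_carrier: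
  assumes "0 \<le> k"
  shows "lam k \<in> carrier_vec l"
proof (cases "k = 0")
  case False
  then have "0 \<le> k - 1" using assms by simp
  from lam_step[OF this] have "dim_vec (lam (k - 1 + 1)) = l" by simp
  then show ?thesis by (intro carrier_vecI) simp
qed (simp add: lam_0)

lemma lambar_carrier: "0 \<le> k \<Longrightarrow> lambar k \<in> carrier_vec l"
  using lambar by (intro carrier_vecI) simp

lemma lamtilde_carrier: "0 \<le> k \<Longrightarrow> lamtilde k \<in> carrier_vec l"
  using lamtilde by (intro carrier_vecI) simp

section \<open>Block multipliers as subgradients\<close>

definition resid :: "int \<Rightarrow> real vec" where
  "resid k = Amul m l A (xbreve k) - b"

definition tresid :: "int \<Rightarrow> real vec" where
  "tresid k = Amul m l A (xtilde k) - b"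

text \<open>The subproblems see the multiplier \<open>lam k - (1 - \<tau> k) \<beta> k r\<close>
  with \<open>r = resid (k - 1)\<close>, whereas \<open>lambar k\<close> contains only the fraction
  \<open>\<gamma>\<close> of this shift; \<open>cf k\<close> is the remaining coefficient. It is the
  constant \<open>c^k\<close> of part (i), and \<open>\<tau> k\<close> times that of part
  (ii).\<close>

definition cf :: "int \<Rightarrow> real" where
  "cf k = (1 - \<gamma>) * (1 - \<tau> k) * \<beta> k"

definition gap :: "int \<Rightarrow> nat \<Rightarrow> real vec" where
  "gap k j = A j *\<^sub>v xbar k j - A j *\<^sub>v xtilde k j"

text \<open>Block \<open>j\<close> of \<open>J\<close> applied to the stacked gaps for
  \<open>j \<ge> 2\<close>. For \<open>j = 1\<close> the sum is empty, so block 1 receives no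
  correction.\<close>

definition partial_gap :: "int \<Rightarrow> nat \<Rightarrow> real vec" where
  "partial_gap k j = vec l (\<lambda>i. \<Sum>c = 2..j. gap k c $ i)"

text \<open>The block subgradients of the objective at \<open>xbreve k\<close> have the form \<open>A\<^sub>j\<^sup>T\<close> times this vector.\<close>

definition block_mult :: "int \<Rightarrow> nat \<Rightarrow> real vec" where
  "block_mult k j = lamtilde k - cf k \<cdot>\<^sub>v resid (k - 1) + (\<tau> k * \<beta> k) \<cdot>\<^sub>v partial_gap k j"

lemma resid_carrier [simp]: "resid k \<in> carrier_vec l" "dim_vec (resid k) = l"
  and tresid_carrier [simp]: "tresid k \<in> carrier_vec l" "dim_vec (tresid k) = l"
  and partial_gap_carrier [simp]: "partial_gap k j \<in> carrier_vec l" "dim_vec (partial_gap k j) = l"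
  and block_mult_carrier [simp]: "block_mult k j \<in> carrier_vec l" "dim_vec (block_mult k j) = l"
  by (simp_all add: resid_def tresid_def partial_gap_def block_mult_def carrier_vecI)

lemma gap_carrier: "0 \<le> k \<Longrightarrow> j \<in> {1..m} \<Longrightarrow> gap k j \<in> carrier_vec l"
  by (simp add: gap_def A_mult_carrier xbar_carrier xtilde_carrier)

lemma A_xtilde:
  assumes "0 \<le> k" "j \<in> {1..m}"
  shows "A j *\<^sub>v xtilde k j = (1 / \<tau> k) \<cdot>\<^sub>v (A j *\<^sub>v xbreve k j) - ((1 - \<tau> k) / \<tau> k) \<cdot>\<^sub>v (A j *\<^sub>v xbreve (k - 1) j)"
  using assms by (simp add: xtilde_eq mult_mat_vec_linear[OF A_carrier] xbreve_carrier)

lemma A_xhat: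
  assumes "0 \<le> k" "j \<in> {1..m}"
  shows "A j *\<^sub>v xhat k j = (1 - \<tau> k) \<cdot>\<^sub>v (A j *\<^sub>v xbreve (k - 1) j) + \<tau> k \<cdot>\<^sub>v (A j *\<^sub>v xbar k j)"
  using assms by (simp add: xhat_eq mult_mat_vec_linear[OF A_carrier] xbreve_carrier xbar_carrier)

text \<open>The sweep point has updated blocks before \<open>j\<close>, and the proximal term
  supplies the change of block \<open>j\<close>. In effect all blocks up to \<open>j\<close> are
  updated: each block contributes \<open>(1 - t) B'\<close> and \<open>t\<close> times
  \<open>T\<close> or \<open>X\<close>, according to its position.\<close>

lemma partial_update_sum:
  fixes B B' T X :: "nat \<Rightarrow> real"
  assumes B: "\<And>c. c \<in> {1..m} \<Longrightarrow> B c = (1 - t) * B' c + t * T c"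
    and j: "j \<in> {1..m}"
  shows "(\<Sum>c = 1..m. if c < j then B c else (1 - t) * B' c + t * X c) + B j - ((1 - t) * B' j + t * X j)
    = (1 - t) * (\<Sum>c = 1..m. B' c) + t * (T 1 + (\<Sum>c = 2..m. X c) - (\<Sum>c = 2..j. X c - T c))"
proof -
  have "(\<Sum>c = 1..m. if c < j then B c else (1 - t) * B' c + t * X c) + B j - ((1 - t) * B' j + t * X j)
      = (\<Sum>c = 1..m. (if c < j then B c else (1 - t) * B' c + t * X c)
          + (if c = j then B c - ((1 - t) * B' c + t * X c) else 0))"
    using j by (simp add: sum.distrib)
  also have "\<dots> = (\<Sum>c = 1..m. (1 - t) * B' c + t * (if c \<le> j then T c else X c))"
    by (intro sum.cong) (auto simp: B)
  also have "\<dots> = (1 - t) * (\<Sum>c = 1..m. B' c) + t * (\<Sum>c = 1..m. if c \<le> j then T c else X c)"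
    by (simp add: sum.distrib sum_distrib_left)
  also have "(\<Sum>c = 1..m. if c \<le> j then T c else X c) = T 1 + (\<Sum>c = 2..m. if c \<le> j then T c else X c)"
    using j m2 by (subst sum.atLeast_Suc_atMost) (auto simp: numeral_2_eq_2)
  also have "(\<Sum>c = 2..m. if c \<le> j then T c else X c)
      = (\<Sum>c = 2..m. X c) - (\<Sum>c = 2..m. if c \<le> j then X c - T c else 0)"
    by (subst sum_subtractf[symmetric]) (intro sum.cong, auto)
  also have "(\<Sum>c = 2..m. if c \<le> j then X c - T c else 0) = (\<Sum>c = 2..j. X c - T c)"
    using j by (intro sum.mono_neutral_cong_right) auto
  finally show ?thesis by (simp add: algebra_simps)
qed

text \<open>The proximal metric is the Hessian of the penalty in block \<open>j\<close>. Linearized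
  penalty plus proximal term therefore have the gradient of the full penalty with block
  \<open>j\<close> updated.\<close>

lemma block_multiplier:
  assumes k: "0 \<le> k" and t: "0 < \<tau> k" and j: "j \<in> {1..m}"
  shows "\<beta> k \<cdot>\<^sub>v (Amul m l A (\<lambda>i. if i < j then xbreve k i else xhat k i) - b) - lam k
    + \<beta> k \<cdot>\<^sub>v (A j *\<^sub>v xbreve k j - A j *\<^sub>v xhat k j) = - block_mult k j"
proof (rule eq_vecI)
  fix i assume "i < dim_vec (- block_mult k j)"
  then have i: "i < l" by simp
  define B B' T X where "B c = (A c *\<^sub>v xbreve k c) $ i" and "B' c = (A c *\<^sub>v xbreve (k - 1) c) $ i"
    and "T c = (A c *\<^sub>v xtilde k c) $ i" and "X c = (A c *\<^sub>v xbar k c) $ i" for c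
  have H: "(A c *\<^sub>v xhat k c) $ i = (1 - \<tau> k) * B' c + \<tau> k * X c" if "c \<in> {1..m}" for c
    using i that unfolding A_xhat[OF k that] B'_def X_def by (simp del: index_mult_mat_vec)
  have BT: "B c = (1 - \<tau> k) * B' c + \<tau> k * T c" if "c \<in> {1..m}" for c
  proof -
    have "T c = 1 / \<tau> k * B c - (1 - \<tau> k) / \<tau> k * B' c"
      using i that unfolding B_def B'_def T_def A_xtilde[OF k that] by (simp del: index_mult_mat_vec)
    then show ?thesis using t by (simp add: field_simps)
  qed
  have "Amul m l A (\<lambda>i. if i < j then xbreve k i else xhat k i) $ i
      = (\<Sum>c = 1..m. if c < j then B c else (1 - \<tau> k) * B' c + \<tau> k * X c)"
    unfolding index_Amul[OF i] by (intro sum.cong refl) (auto simp: B_def H simp del: index_mult_mat_vec)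
  moreover have "(A j *\<^sub>v xhat k j) $ i = (1 - \<tau> k) * B' j + \<tau> k * X j" by (rule H[OF j])
  moreover have "(A j *\<^sub>v xbreve k j) $ i = B j" by (simp add: B_def)
  moreover have mk: "block_mult k j $ i = lam k $ i - \<beta> k * ((1 - \<tau> k) * (\<Sum>c = 1..m. B' c)
      + \<tau> k * (T 1 + (\<Sum>c = 2..m. X c) - (\<Sum>c = 2..j. X c - T c)) - b $ i)"
  proof -
    have lt: "lamtilde k $ i = lam k $ i - \<gamma> * (1 - \<tau> k) * \<beta> k * ((\<Sum>c = 1..m. B' c) - b $ i)
        - \<tau> k * \<beta> k * (T 1 + (\<Sum>c = 2..m. X c) - b $ i)"
      using i m2 k lamtilde lambar unfolding T_def X_def B'_def
      by (simp add: index_Amul Asum_def del: index_mult_mat_vec)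
    have rs: "resid (k - 1) $ i = (\<Sum>c = 1..m. B' c) - b $ i"
      using i by (simp add: resid_def index_Amul B'_def del: index_mult_mat_vec)
    have "partial_gap k j $ i = (\<Sum>c = 2..j. gap k c $ i)" using i by (simp add: partial_gap_def)
    also have "\<dots> = (\<Sum>c = 2..j. X c - T c)"
      using i j by (intro sum.cong) (auto simp: gap_def X_def T_def simp del: index_mult_mat_vec)
    finally show ?thesis using i by (simp add: block_mult_def lt rs cf_def algebra_simps)
  qed
  ultimately have "(\<beta> k \<cdot>\<^sub>v (Amul m l A (\<lambda>i. if i < j then xbreve k i else xhat k i) - b) - lam k
      + \<beta> k \<cdot>\<^sub>v (A j *\<^sub>v xbreve k j - A j *\<^sub>v xhat k j)) $ i
      = \<beta> k * ((\<Sum>c = 1..m. if c < j then B c else (1 - \<tau> k) * B' c + \<tau> k * X c) + B j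
          - ((1 - \<tau> k) * B' j + \<tau> k * X j) - b $ i) - lam k $ i"
    using i j lam_carrier[OF k] by (simp add: right_diff_distrib distrib_left del: index_mult_mat_vec)
  also have "(\<Sum>c = 1..m. if c < j then B c else (1 - \<tau> k) * B' c + \<tau> k * X c) + B j - ((1 - \<tau> k) * B' j + \<tau> k * X j)
      = (1 - \<tau> k) * (\<Sum>c = 1..m. B' c) + \<tau> k * (T 1 + (\<Sum>c = 2..m. X c) - (\<Sum>c = 2..j. X c - T c))"
    by (rule partial_update_sum[OF BT j])
  finally show "(\<beta> k \<cdot>\<^sub>v (Amul m l A (\<lambda>i. if i < j then xbreve k i else xhat k i) - b) - lam k
    + \<beta> k \<cdot>\<^sub>v (A j *\<^sub>v xbreve k j - A j *\<^sub>v xhat k j)) $ i = (- block_mult k j) $ i"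
    using i mk by simp
qed (use j in simp)

lemma xbreve_subgradient:
  assumes k: "0 \<le> k" and t: "0 < \<tau> k" and j: "j \<in> {1..m}" and y: "y \<in> carrier_vec (n j)"
  shows "f j (xbreve k j) + block_mult k j \<bullet> (A j *\<^sub>v (y - xbreve k j)) \<le> f j y"
proof -
  define z where "z = (\<lambda>i. if i < j then xbreve k i else xhat k i)"
  define u where "u = \<beta> k \<cdot>\<^sub>v (Amul m l A z - b) - lam k"
  define h where "h = A j *\<^sub>v (y - xbreve k j)"
  note Aj = A_carrier[OF j] and xb = xbreve_carrier[of k j, OF _ j] and xh = xhat_carrier[OF k j]
  have xb: "xbreve k j \<in> carrier_vec (n j)" using k by (intro xb) simp
  have u: "u \<in> carrier_vec l" using lam_carrier[OF k] by (simp add: u_def)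
  have h: "h \<in> carrier_vec l" using Aj y xb by (simp add: h_def)
  have g: "grad_phi m l n A b (\<beta> k) j z (lam k) = transpose_mat (A j) *\<^sub>v u"
    unfolding u_def by (rule grad_phi_eq) (use xh j in \<open>auto simp: z_def lam_carrier[OF k] A_carrier\<close>)
  have d: "A j *\<^sub>v (xbreve k j - xhat k j) \<in> carrier_vec l" using Aj xb xh by simp
  have "f j (xbreve k j) \<le> f j y + (transpose_mat (A j) *\<^sub>v u) \<bullet> (y - xbreve k j)
      + \<beta> k * ((A j *\<^sub>v (xbreve k j - xhat k j)) \<bullet> h)"
    unfolding h_def using xbreve_argmin[OF k j] Aj u
    by (intro proximal_argmin_le[where n = "n j" and l = l, OF f_convex[OF j] Aj _ xh y]) (auto simp: g[unfolded z_def])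
  also have "(transpose_mat (A j) *\<^sub>v u) \<bullet> (y - xbreve k j) = u \<bullet> h"
    unfolding h_def using y xb u by (intro dot_mult_mat_vec[OF Aj]) auto
  also have "f j y + u \<bullet> h + \<beta> k * ((A j *\<^sub>v (xbreve k j - xhat k j)) \<bullet> h)
      = f j y + (u + \<beta> k \<cdot>\<^sub>v (A j *\<^sub>v (xbreve k j - xhat k j))) \<bullet> h"
    using u h d j by (simp add: dot_linear)
  also have "u + \<beta> k \<cdot>\<^sub>v (A j *\<^sub>v (xbreve k j - xhat k j)) = - block_mult k j"
    using block_multiplier[OF k t j] xb xh by (simp add: u_def z_def mult_mat_vec_linear[OF Aj])
  finally show ?thesis using h j by (simp add: dot_linear h_def)
qed

end

lemma append_vec_minus:
  "dim_vec a = dim_vec c \<Longrightarrow> dim_vec e = dim_vec d \<Longrightarrow> (a @\<^sub>v e) - (c @\<^sub>v d) = (a - c) @\<^sub>v (e - (d :: real vec))"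
  by (intro eq_vecI) (auto simp: append_vec_def Let_def)

lemma sum_split_first: "1 \<le> m \<Longrightarrow> (\<Sum>j = 1..m. g j) = g 1 + (\<Sum>j = 2..m. g (j :: nat) :: real)"
  by (subst sum.atLeast_Suc_atMost) (auto simp: numeral_2_eq_2)

section \<open>Prediction and correction in one iteration\<close>

context algorithm3_run
begin

text \<open>By definition of \<open>xtilde\<close>, \<open>\<tau> (y - xtilde)\<close> equals
  \<open>\<tau> (y - xbreve k) + (1 - \<tau>) (xbreve (k - 1) - xbreve k)\<close>; the subgradient
  inequality is used at \<open>y\<close> and at the previous iterate with these weights.
  \<open>D\<close> leaves room for a surplus at \<open>y\<close>.\<close>

lemma block_descent:
  assumes k: "0 \<le> k" and t: "0 < \<tau> k" "\<tau> k \<le> 1" and j: "j \<in> {1..m}" and y: "y \<in> carrier_vec (n j)"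
    and D: "f j (xbreve k j) + block_mult k j \<bullet> (A j *\<^sub>v (y - xbreve k j)) + D \<le> f j y"
  shows "\<tau> k * (block_mult k j \<bullet> (A j *\<^sub>v y - A j *\<^sub>v xtilde k j)) + \<tau> k * D
    \<le> \<tau> k * f j y - f j (xbreve k j) + (1 - \<tau> k) * f j (xbreve (k - 1) j)"
proof -
  define X P P' where "X = block_mult k j \<bullet> (A j *\<^sub>v y)" and "P = block_mult k j \<bullet> (A j *\<^sub>v xbreve k j)"
    and "P' = block_mult k j \<bullet> (A j *\<^sub>v xbreve (k - 1) j)"
  have c: "xbreve k j \<in> carrier_vec (n j)" "xbreve (k - 1) j \<in> carrier_vec (n j)"
    using k j by (simp_all add: xbreve_carrier)
  note lin = mult_mat_vec_linear[OF A_carrier[OF j]] dot_linear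
  have 1: "\<tau> k * (f j (xbreve k j) + (X - P) + D) \<le> \<tau> k * f j y"
    using D t c y j by (intro mult_left_mono) (auto simp: lin X_def P_def)
  have 2: "(1 - \<tau> k) * (f j (xbreve k j) + (P' - P)) \<le> (1 - \<tau> k) * f j (xbreve (k - 1) j)"
    using xbreve_subgradient[OF k t(1) j c(2)] t c y j
    by (intro mult_left_mono) (auto simp: lin P_def P'_def)
  have "\<tau> k * (block_mult k j \<bullet> (A j *\<^sub>v y - A j *\<^sub>v xtilde k j)) = \<tau> k * X - P + (1 - \<tau> k) * P'"
    unfolding A_xtilde[OF k j] using j t by (simp add: lin X_def P_def P'_def field_simps)
  then show ?thesis using 1 2 by (simp add: algebra_simps)
qed

lemma objective_descent:
  assumes k: "0 \<le> k" and t: "0 < \<tau> k" "\<tau> k \<le> 1" and x: "x \<in> bspace m n"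
    and D: "f m (xbreve k m) + block_mult k m \<bullet> (A m *\<^sub>v (x m - xbreve k m)) + D \<le> f m (x m)"
  shows "\<tau> k * (\<Sum>j = 1..m. block_mult k j \<bullet> (A j *\<^sub>v x j - A j *\<^sub>v xtilde k j)) + \<tau> k * D
    \<le> \<tau> k * obj m f x - obj m f (xbreve k) + (1 - \<tau> k) * obj m f (xbreve (k - 1))"
proof -
  have xj: "x j \<in> carrier_vec (n j)" if "j \<in> {1..m}" for j using x that by (simp add: bspace_def)
  \<comment> \<open>Only the last block carries a surplus \<open>D\<close>, as only
    \<open>f m\<close> is smooth in part (ii).\<close>
  have "(\<Sum>j = 1..m. \<tau> k * (block_mult k j \<bullet> (A j *\<^sub>v x j - A j *\<^sub>v xtilde k j)) + \<tau> k * (if j = m then D else 0))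
      \<le> (\<Sum>j = 1..m. \<tau> k * f j (x j) - f j (xbreve k j) + (1 - \<tau> k) * f j (xbreve (k - 1) j))"
  proof (rule sum_mono)
    fix j assume j: "j \<in> {1..m}"
    show "\<tau> k * (block_mult k j \<bullet> (A j *\<^sub>v x j - A j *\<^sub>v xtilde k j)) + \<tau> k * (if j = m then D else 0)
      \<le> \<tau> k * f j (x j) - f j (xbreve k j) + (1 - \<tau> k) * f j (xbreve (k - 1) j)"
      by (rule block_descent[OF k t j xj[OF j]])
        (use D xbreve_subgradient[OF k t(1) j xj[OF j]] in auto)
  qed
  moreover have "(\<Sum>j = 1..m. \<tau> k * (if j = m then D else 0)) = \<tau> k * D"
    using m2 by (simp add: if_distrib cong: if_cong)
  ultimately show ?thesis
    by (simp add: obj_def sum.distrib sum_subtractf sum_distrib_left)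
qed

definition vv :: "int \<Rightarrow> real vec" where
  "vv k = v_stack m l A (xbar k) (lambar k)"

definition vt :: "int \<Rightarrow> real vec" where
  "vt k = v_stack m l A (xtilde k) (lamtilde k)"

lemma v_stack_carrier: "\<mu> \<in> carrier_vec l \<Longrightarrow> v_stack m l A x \<mu> \<in> carrier_vec (tail_dim m l + l)"
  by (simp add: v_stack_def)

lemma v_stack_minus:
  assumes "\<And>j. j \<in> {2..m} \<Longrightarrow> y j \<in> carrier_vec (n j)" "\<mu> \<in> carrier_vec l" "\<nu> \<in> carrier_vec l"
  shows "v_stack m l A x \<mu> - v_stack m l A y \<nu> = tail_stack m l (\<lambda>j. A j *\<^sub>v x j - A j *\<^sub>v y j) @\<^sub>v (\<mu> - \<nu>)"
  using assms unfolding v_stack_def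
  by (subst tail_stack_minus[symmetric]) (auto intro!: append_vec_minus A_mult_carrier)

lemma vv_minus_vt:
  "0 \<le> k \<Longrightarrow> vv k - vt k = tail_stack m l (gap k) @\<^sub>v (lambar k - lamtilde k)"
  unfolding vv_def vt_def
  by (subst v_stack_minus) (auto simp: xtilde_carrier lambar_carrier lamtilde_carrier gap_def[abs_def])

lemma I_row_mult_gap: "I_row m l *\<^sub>v tail_stack m l (gap k) = partial_gap k m"
  by (simp add: I_row_mult_tail_stack[OF l0] partial_gap_def)

lemma J_mat_mult_gap: "J_mat m l *\<^sub>v tail_stack m l (gap k) = tail_stack m l (partial_gap k)"
  by (simp add: J_mat_mult_tail_stack[OF l0] partial_gap_def[abs_def])

text \<open>The predictor \<open>lamtilde\<close> mixes \<open>xtilde\<close> in block 1 with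
  \<open>xbar\<close> elsewhere; passing to \<open>xtilde\<close> in all blocks costs the full sum
  of gaps.\<close>

lemma lambar_minus_lamtilde:
  assumes k: "0 \<le> k"
  shows "lambar k - lamtilde k = (\<tau> k * \<beta> k) \<cdot>\<^sub>v (tresid k + partial_gap k m)"
proof (rule eq_vecI)
  fix i assume "i < dim_vec ((\<tau> k * \<beta> k) \<cdot>\<^sub>v (tresid k + partial_gap k m))"
  then have i: "i < l" by simp
  define T X where "T c = (A c *\<^sub>v xtilde k c) $ i" and "X c = (A c *\<^sub>v xbar k c) $ i" for c
  have pg: "partial_gap k m $ i = (\<Sum>c = 2..m. X c - T c)"
    using i by (auto simp: partial_gap_def gap_def X_def T_def intro!: sum.cong simp del: index_mult_mat_vec)
  have tr: "tresid k $ i = T 1 + (\<Sum>c = 2..m. T c) - b $ i"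
    using i m2 sum_split_first[of m T] by (simp add: tresid_def index_Amul T_def del: index_mult_mat_vec)
  have lt: "lamtilde k $ i = lambar k $ i - \<tau> k * \<beta> k * (T 1 + (\<Sum>c = 2..m. X c) - b $ i)"
    using i k m2 lamtilde by (simp add: Asum_def T_def X_def del: index_mult_mat_vec)
  show "(lambar k - lamtilde k) $ i = ((\<tau> k * \<beta> k) \<cdot>\<^sub>v (tresid k + partial_gap k m)) $ i"
    using i lamtilde_carrier[OF k] by (simp add: pg tr lt sum_subtractf algebra_simps)
qed (use lamtilde_carrier[OF k] in simp)

text \<open>Identifies the vector \<open>w\<close> of the block formula for \<open>G\<close> as the
  residual of \<open>xtilde\<close>.\<close>

lemma tresid_eq:
  assumes k: "0 \<le> k" and t: "0 < \<tau> k"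
  shows "(1 / (\<tau> k * \<beta> k)) \<cdot>\<^sub>v (lambar k - lamtilde k) - I_row m l *\<^sub>v tail_stack m l (gap k) = tresid k"
  unfolding I_row_mult_gap lambar_minus_lamtilde[OF k] using t beta_pos[OF k]
  by (intro eq_vecI) auto

lemma Q_mult:
  assumes k: "0 \<le> k" and t: "0 < \<tau> k"
  shows "Q_mat m l (\<tau> k) (\<beta> k) *\<^sub>v (vv k - vt k) = ((\<tau> k * \<beta> k) \<cdot>\<^sub>v tail_stack m l (partial_gap k)) @\<^sub>v tresid k"
  unfolding vv_minus_vt[OF k]
  by (subst Q_mat_mult_append) (auto simp: J_mat_mult_gap tresid_eq[OF k t] lambar_carrier lamtilde_carrier k)

lemma M_mult:
  assumes k: "0 \<le> k" and t: "0 < \<tau> k"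
  shows "M_mat m l \<gamma> (\<tau> k) (\<beta> k) *\<^sub>v (vv k - vt k) =
    (\<gamma> \<cdot>\<^sub>v (transpose_mat (inv_mat (J_mat m l)) *\<^sub>v tail_stack m l (gap k))) @\<^sub>v ((\<gamma> * \<tau> k * \<beta> k) \<cdot>\<^sub>v tresid k)"
proof -
  have tb: "0 < \<tau> k * \<beta> k" using t beta_pos[OF k] by simp
  have "lambar k - lamtilde k - (\<tau> k * \<beta> k) \<cdot>\<^sub>v (I_row m l *\<^sub>v tail_stack m l (gap k)) = (\<tau> k * \<beta> k) \<cdot>\<^sub>v tresid k"
    unfolding lambar_minus_lamtilde[OF k] I_row_mult_gap by (intro eq_vecI) (auto simp: algebra_simps)
  then show ?thesis
    unfolding vv_minus_vt[OF k]
    by (subst M_mat_mult_append[OF l0 tb]) (auto simp: lambar_carrier lamtilde_carrier k smult_smult_assoc mult.assoc)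
qed

text \<open>The two residual terms in the update of \<open>lam\<close> are exactly the shifts
  between \<open>lam\<close> and \<open>lambar\<close> at \<open>k\<close> and \<open>k + 1\<close>.
  In terms of \<open>lambar\<close> a plain multiplier step remains.\<close>

lemma lambar_step:
  assumes k: "0 \<le> k"
  shows "lambar (k + 1) = lambar k - (\<gamma> * \<tau> k * \<beta> k) \<cdot>\<^sub>v tresid k"
proof (rule eq_vecI)
  have "0 \<le> k + 1" using k by simp
  note lb = lambar[rule_format, OF this] lambar[rule_format, OF k]
  show "lambar (k + 1) $ i = (lambar k - (\<gamma> * \<tau> k * \<beta> k) \<cdot>\<^sub>v tresid k) $ i"
    if "i < dim_vec (lambar k - (\<gamma> * \<tau> k * \<beta> k) \<cdot>\<^sub>v tresid k)" for i
    using that lam_carrier[OF k]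
    by (simp add: lb lam_step[OF k] tresid_def) (simp add: algebra_simps)
qed (use lambar_carrier[of "k + 1"] k in simp)

lemma vv_step:
  assumes k: "0 \<le> k" and t: "0 < \<tau> k"
  shows "vv (k + 1) = vv k - M_mat m l \<gamma> (\<tau> k) (\<beta> k) *\<^sub>v (vv k - vt k)"
proof -
  have K: "transpose_mat (inv_mat (J_mat m l)) \<in> carrier_mat (tail_dim m l) (tail_dim m l)"
    using J_mat_inv_carrier[OF l0] by simp
  show ?thesis
    unfolding M_mult[OF k t] unfolding vv_def v_stack_def
    using K lambar_carrier[OF k]
    by (subst append_vec_minus) (auto simp: tail_stack_xbar[OF k] lambar_step[OF k] gap_def[abs_def])
qed

lemma u_inner_F_op:
  assumes k: "0 \<le> k" and x: "x \<in> bspace m n" and \<mu>: "\<mu> \<in> carrier_vec l"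
  shows "u_inner m (u_diff (x, \<mu>) (xtilde k, lamtilde k)) (F_op m l A b (xtilde k, lamtilde k))
    = - (\<Sum>j = 1..m. lamtilde k \<bullet> (A j *\<^sub>v x j - A j *\<^sub>v xtilde k j)) + (\<mu> - lamtilde k) \<bullet> tresid k"
proof -
  define y where "y j = A j *\<^sub>v x j - A j *\<^sub>v xtilde k j" for j
  have xj: "x j \<in> carrier_vec (n j)" if "j \<in> {1..m}" for j using x that by (simp add: bspace_def)
  have yA: "A j *\<^sub>v (x j - xtilde k j) = y j" if "j \<in> {1..m}" for j
    using that by (simp add: y_def mult_mat_vec_linear[OF A_carrier] xj xtilde_carrier k)
  note lt = lamtilde_carrier[OF k]
  have "u_inner m (u_diff (x, \<mu>) (xtilde k, lamtilde k)) (F_op m l A b (xtilde k, lamtilde k))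
      = (\<Sum>j = 1..m. (x j - xtilde k j) \<bullet> (- (transpose_mat (A j) *\<^sub>v lamtilde k))) + (\<mu> - lamtilde k) \<bullet> tresid k"
    by (simp add: u_inner_def u_diff_def F_op_def tresid_def)
  also have "(\<Sum>j = 1..m. (x j - xtilde k j) \<bullet> (- (transpose_mat (A j) *\<^sub>v lamtilde k))) = - (\<Sum>j = 1..m. lamtilde k \<bullet> y j)"
    unfolding sum_negf[symmetric]
  proof (rule sum.cong[OF refl])
    fix j assume j: "j \<in> {1..m}"
    have Aj: "dim_col (A j) = n j" "dim_vec (xtilde k j) = n j" using A_carrier[OF j] xtilde_carrier[OF k j] by auto
    have xx: "x j - xtilde k j \<in> carrier_vec (n j)" using xj[OF j] xtilde_carrier[OF k j] by simp
    have "(transpose_mat (A j) *\<^sub>v lamtilde k) \<bullet> (x j - xtilde k j) = lamtilde k \<bullet> y j"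
      using dot_mult_mat_vec[OF A_carrier[OF j] xx lt] by (simp only: yA[OF j])
    then show "(x j - xtilde k j) \<bullet> (- (transpose_mat (A j) *\<^sub>v lamtilde k)) = - (lamtilde k \<bullet> y j)"
      using xx Aj dot_commute[of "x j - xtilde k j" "transpose_mat (A j) *\<^sub>v lamtilde k"]
      by (simp add: dot_uminus_right)
  qed
  finally show ?thesis by (simp add: y_def)
qed

text \<open>The three summands of \<open>block_mult\<close> give the primal part of
  \<open>F\<close>, the \<open>cf\<close> term and the \<open>J\<close> block of \<open>Q\<close>.
  The terms \<open>(\<mu> - lamtilde k) \<bullet> tresid k\<close> from \<open>F\<close> and
  \<open>Q\<close> cancel, so \<open>\<mu>\<close> is arbitrary.\<close>

lemma multiplier_identity:
  assumes k: "0 \<le> k" and t: "0 < \<tau> k" and x: "x \<in> bspace m n" and \<mu>: "\<mu> \<in> carrier_vec l"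
  shows "(\<Sum>j = 1..m. block_mult k j \<bullet> (A j *\<^sub>v x j - A j *\<^sub>v xtilde k j)) =
    - u_inner m (u_diff (x, \<mu>) (xtilde k, lamtilde k)) (F_op m l A b (xtilde k, lamtilde k))
    - cf k * (Amul m l A (\<lambda>i. x i - xtilde k i) \<bullet> resid (k - 1))
    + (v_stack m l A x \<mu> - vt k) \<bullet> (Q_mat m l (\<tau> k) (\<beta> k) *\<^sub>v (vv k - vt k))"
proof -
  define y where "y j = A j *\<^sub>v x j - A j *\<^sub>v xtilde k j" for j
  have xj: "x j \<in> carrier_vec (n j)" if "j \<in> {1..m}" for j using x that by (simp add: bspace_def)
  have y: "y j \<in> carrier_vec l" if "j \<in> {1..m}" for j
    using that by (simp add: y_def A_mult_carrier xj xtilde_carrier k)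
  have yA: "A j *\<^sub>v (x j - xtilde k j) = y j" if "j \<in> {1..m}" for j
    using that by (simp add: y_def mult_mat_vec_linear[OF A_carrier] xj xtilde_carrier k)
  note lt = lamtilde_carrier[OF k]
  note u = u_inner_F_op[OF k x \<mu>, folded y_def]
  have "Amul m l A (\<lambda>i. x i - xtilde k i) \<bullet> resid (k - 1) = resid (k - 1) \<bullet> Amul m l A (\<lambda>i. x i - xtilde k i)"
    by (rule dot_commute) simp
  also have "\<dots> = (\<Sum>j = 1..m. resid (k - 1) \<bullet> y j)"
    by (subst Amul_dot[OF A_carrier]) (auto simp: yA intro!: sum.cong)
  finally have r: "Amul m l A (\<lambda>i. x i - xtilde k i) \<bullet> resid (k - 1) = (\<Sum>j = 1..m. resid (k - 1) \<bullet> y j)" .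
  have "v_stack m l A x \<mu> - vt k = tail_stack m l y @\<^sub>v (\<mu> - lamtilde k)"
    unfolding vt_def y_def using \<mu> lt by (intro v_stack_minus) (auto simp: xtilde_carrier k)
  then have "(v_stack m l A x \<mu> - vt k) \<bullet> (Q_mat m l (\<tau> k) (\<beta> k) *\<^sub>v (vv k - vt k))
      = \<tau> k * \<beta> k * (tail_stack m l y \<bullet> tail_stack m l (partial_gap k)) + (\<mu> - lamtilde k) \<bullet> tresid k"
    unfolding Q_mult[OF k t] using \<mu> lt
    by (simp add: scalar_prod_append[of _ "tail_dim m l" _ l] dot_linear)
  also have "tail_stack m l y \<bullet> tail_stack m l (partial_gap k) = (\<Sum>j = 2..m. y j \<bullet> partial_gap k j)"
    by (rule tail_stack_dot[OF l0]) (use y in auto)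
  also have "\<dots> = (\<Sum>j = 1..m. partial_gap k j \<bullet> y j)"
  proof -
    \<comment> \<open>The stacked vectors begin at block 2; block 1 may be added because its partial
      gap is an empty sum.\<close>
    have "partial_gap k 1 \<bullet> y 1 = 0"
      using y[of 1] m2 by (subst dot_sum[of _ l]) (auto simp: partial_gap_def)
    then have "(\<Sum>j = 1..m. partial_gap k j \<bullet> y j) = (\<Sum>j = 2..m. partial_gap k j \<bullet> y j)"
      using m2 by (subst sum_split_first) auto
    also have "\<dots> = (\<Sum>j = 2..m. y j \<bullet> partial_gap k j)"
    proof (intro sum.cong refl dot_commute)
      fix j assume "j \<in> {2..m}"
      then show "dim_vec (partial_gap k j) = dim_vec (y j)" using y[of j] by simp
    qed
    finally show ?thesis by simp
  qed
  finally have q: "(v_stack m l A x \<mu> - vt k) \<bullet> (Q_mat m l (\<tau> k) (\<beta> k) *\<^sub>v (vv k - vt k))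
      = \<tau> k * \<beta> k * (\<Sum>j = 1..m. partial_gap k j \<bullet> y j) + (\<mu> - lamtilde k) \<bullet> tresid k" .
  have "(\<Sum>j = 1..m. block_mult k j \<bullet> y j)
      = (\<Sum>j = 1..m. lamtilde k \<bullet> y j - cf k * (resid (k - 1) \<bullet> y j) + \<tau> k * \<beta> k * (partial_gap k j \<bullet> y j))"
  proof (rule sum.cong[OF refl])
    fix j assume "j \<in> {1..m}"
    then show "block_mult k j \<bullet> y j = lamtilde k \<bullet> y j - cf k * (resid (k - 1) \<bullet> y j) + \<tau> k * \<beta> k * (partial_gap k j \<bullet> y j)"
      using y[of j] lt by (simp add: block_mult_def dot_linear)
  qed
  also have "\<dots> = (\<Sum>j = 1..m. lamtilde k \<bullet> y j) - cf k * (\<Sum>j = 1..m. resid (k - 1) \<bullet> y j)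
      + \<tau> k * \<beta> k * (\<Sum>j = 1..m. partial_gap k j \<bullet> y j)"
    by (simp add: sum.distrib sum_subtractf sum_distrib_left)
  finally show ?thesis unfolding u r q y_def[symmetric] by simp
qed

text \<open>Both prediction inequalities are this one, divided by \<open>\<tau> k\<close> and by \<open>(\<tau> k)\<^sup>2\<close>.\<close>

lemma prediction:
  assumes k: "0 \<le> k" and t: "0 < \<tau> k" "\<tau> k \<le> 1" and x: "x \<in> bspace m n" and \<mu>: "\<mu> \<in> carrier_vec l"
    and D: "f m (xbreve k m) + block_mult k m \<bullet> (A m *\<^sub>v (x m - xbreve k m)) + D \<le> f m (x m)"
  shows "\<tau> k * ((v_stack m l A x \<mu> - vt k) \<bullet> (Q_mat m l (\<tau> k) (\<beta> k) *\<^sub>v (vv k - vt k)) + D)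
    \<le> \<tau> k * (u_inner m (u_diff (x, \<mu>) (xtilde k, lamtilde k)) (F_op m l A b (xtilde k, lamtilde k))
        + cf k * (Amul m l A (\<lambda>i. x i - xtilde k i) \<bullet> resid (k - 1)))
      + (obj m f x - obj m f (xbreve k)) - (1 - \<tau> k) * (obj m f x - obj m f (xbreve (k - 1)))"
  using objective_descent[OF k t x D] unfolding multiplier_identity[OF k t(1) x \<mu>]
  by (simp add: algebra_simps)

lemma wnormsq_G_ge:
  assumes k: "0 \<le> k" and t: "0 < \<tau> k"
  defines "H \<equiv> H0_mat m l \<gamma> (\<tau> k * \<beta> k) (1 / (\<tau> k * \<beta> k))"
  shows "(1 - \<gamma>) * \<tau> k * \<beta> k * (tresid k \<bullet> tresid k) \<le>
    wnormsq (G_mat (Q_mat m l (\<tau> k) (\<beta> k)) (M_mat m l \<gamma> (\<tau> k) (\<beta> k)) H) (vv k - vt k)"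
proof -
  define a p where "a = tail_stack m l (gap k)" and "p = I_row m l *\<^sub>v a"
  have tb: "0 < \<tau> k * \<beta> k" using t beta_pos[OF k] by simp
  have "wnormsq (G_mat (Q_mat m l (\<tau> k) (\<beta> k)) (M_mat m l \<gamma> (\<tau> k) (\<beta> k)) H) (vv k - vt k)
    = \<tau> k * \<beta> k * ((1 - \<gamma>) * (a \<bullet> a) + (1 - \<gamma>) * (tresid k \<bullet> tresid k) + (tresid k + p) \<bullet> (tresid k + p))"
    unfolding vv_minus_vt[OF k] H_def p_def a_def
    by (subst wnormsq_G_mat_block[OF l0 tb])
      (use \<gamma> in \<open>auto simp: tresid_eq[OF k t] gap_carrier k lambar_carrier lamtilde_carrier\<close>)
  also have "\<dots> \<ge> \<tau> k * \<beta> k * ((1 - \<gamma>) * (tresid k \<bullet> tresid k))"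
    using \<gamma> tb dot_self_nonneg[of a] dot_self_nonneg[of "tresid k + p"] by (intro mult_left_mono) auto
  finally show ?thesis by (simp add: mult_ac)
qed

end

text \<open>The difference of the two sides is exactly \<open>t (1 - t) |x - y|^2\<close>.\<close>

lemma dot_convex_comb_le:
  assumes "dim_vec x = dim_vec y" "0 \<le> t" "t \<le> 1"
  shows "((1 - t) \<cdot>\<^sub>v x + t \<cdot>\<^sub>v y) \<bullet> ((1 - t) \<cdot>\<^sub>v x + t \<cdot>\<^sub>v y) \<le> (1 - t) * (x \<bullet> x) + t * (y \<bullet> (y :: real vec))"
proof -
  have "(1 - t) * (x \<bullet> x) + t * (y \<bullet> y) - ((1 - t) \<cdot>\<^sub>v x + t \<cdot>\<^sub>v y) \<bullet> ((1 - t) \<cdot>\<^sub>v x + t \<cdot>\<^sub>v y)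
      = t * (1 - t) * ((x - y) \<bullet> (x - y))"
    using assms(1) dot_commute[OF assms(1)] by (simp add: dot_linear algebra_simps)
  also have "\<dots> \<ge> 0" using assms by (simp add: dot_self_nonneg)
  finally show ?thesis by simp
qed

text \<open>Young's inequality with the optimal weight; it is the origin of the constant \<open>\<sigma>''\<close>.\<close>

lemma dot_diff_Young:
  assumes "dim_vec p = dim_vec q" "0 \<le> (s :: real)"
  shows "(s - s\<^sup>2 / (s + 1)) * (p \<bullet> p) - q \<bullet> q \<le> s * ((p - q) \<bullet> (p - q))"
proof -
  \<comment> \<open>As \<open>s - s^2 / (s + 1) = s / (s + 1)\<close>, multiplication by
    \<open>s + 1\<close> leaves a perfect square.\<close>
  have "(s + 1) * (s * ((p - q) \<bullet> (p - q)) - ((s - s\<^sup>2 / (s + 1)) * (p \<bullet> p) - q \<bullet> q))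
      = (s \<cdot>\<^sub>v p - (s + 1) \<cdot>\<^sub>v q) \<bullet> (s \<cdot>\<^sub>v p - (s + 1) \<cdot>\<^sub>v q)"
    using assms dot_commute[OF assms(1)]
    by (simp add: dot_linear power2_eq_square field_simps)
  then have "0 \<le> (s + 1) * (s * ((p - q) \<bullet> (p - q)) - ((s - s\<^sup>2 / (s + 1)) * (p \<bullet> p) - q \<bullet> q))"
    by (simp add: dot_self_nonneg)
  then show ?thesis using assms(2) by (simp add: zero_le_mult_iff)
qed

text \<open>With \<open>d = vv k - vt k\<close>, expand the \<open>H\<close> norm after the
  correction by \<open>M d\<close>. As \<open>H M = Q\<close>, the mixed term is \<open>Q d\<close>
  against \<open>vv k - y\<close>, and the definition of \<open>G\<close> accounts for the rest.
  This turns the right side of the prediction inequality into a difference of distances.\<close>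

lemma (in algorithm3_run) correction_identity:
  assumes k: "0 \<le> k" and t: "0 < \<tau> k" and x: "x \<in> bspace m n" and \<mu>: "\<mu> \<in> carrier_vec l"
  defines "y \<equiv> v_stack m l A x \<mu>" and "H \<equiv> H0_mat m l \<gamma> (\<tau> k * \<beta> k) (1 / (\<tau> k * \<beta> k))"
  shows "2 * ((y - vt k) \<bullet> (Q_mat m l (\<tau> k) (\<beta> k) *\<^sub>v (vv k - vt k))) =
    wnormsq H (vv (k + 1) - y) - wnormsq H (vv k - y)
    + wnormsq (G_mat (Q_mat m l (\<tau> k) (\<beta> k)) (M_mat m l \<gamma> (\<tau> k) (\<beta> k)) H) (vv k - vt k)"
proof -
  define N Q M d where "N = tail_dim m l + l" and "Q = Q_mat m l (\<tau> k) (\<beta> k)"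
    and "M = M_mat m l \<gamma> (\<tau> k) (\<beta> k)" and "d = vv k - vt k"
  have tb: "0 < \<tau> k * \<beta> k" using t beta_pos[OF k] by simp
  have c: "Q \<in> carrier_mat N N" "M \<in> carrier_mat N N" "H \<in> carrier_mat N N"
    using M_mat_carrier[OF l0 tb] by (auto simp: N_def Q_def M_def H_def Q_mat_carrier H0_mat_carrier)
  have QHM: "Q = H * M" using \<gamma> H0_mat_mult_M_mat[OF l0 tb, of \<gamma>] by (simp add: Q_def H_def M_def)
  have cv: "vv k \<in> carrier_vec N" "vt k \<in> carrier_vec N" "y \<in> carrier_vec N"
    using \<mu> by (auto simp: N_def vv_def vt_def y_def v_stack_carrier lambar_carrier lamtilde_carrier k)
  have d: "d \<in> carrier_vec N" using cv by (simp add: d_def)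
  have HMd: "H *\<^sub>v (M *\<^sub>v d) = Q *\<^sub>v d" unfolding QHM using c d by simp
  have sym: "(M *\<^sub>v d) \<bullet> (H *\<^sub>v (vv k - y)) = (vv k - y) \<bullet> (H *\<^sub>v (M *\<^sub>v d))"
  proof -
    have K: "transpose_mat (inv_mat (J_mat m l)) \<in> carrier_mat (tail_dim m l) (tail_dim m l)"
      using J_mat_inv_carrier[OF l0] by simp
    have e: "vv k - y = tail_stack m l (\<lambda>j. A j *\<^sub>v xbar k j - A j *\<^sub>v x j) @\<^sub>v (lambar k - \<mu>)"
      unfolding vv_def y_def using x \<mu> lambar_carrier[OF k] by (intro v_stack_minus) (auto simp: bspace_def)
    obtain a1 e1 where Md: "M *\<^sub>v d = a1 @\<^sub>v e1" "a1 \<in> carrier_vec (tail_dim m l)" "e1 \<in> carrier_vec l"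
      using M_mult[OF k t] mult_mat_vec_carrier[OF K tail_stack_carrier] unfolding M_def d_def by auto
    let ?a2 = "tail_stack m l (\<lambda>j. A j *\<^sub>v xbar k j - A j *\<^sub>v x j)" and ?e2 = "lambar k - \<mu>"
    have e2: "?e2 \<in> carrier_vec l" using \<mu> lambar_carrier[OF k] by simp
    have 1: "e1 \<bullet> ?e2 = ?e2 \<bullet> e1" using Md \<mu> by (intro dot_commute) auto
    have 2: "(transpose_mat (J_mat m l) *\<^sub>v a1) \<bullet> (transpose_mat (J_mat m l) *\<^sub>v ?a2)
        = (transpose_mat (J_mat m l) *\<^sub>v ?a2) \<bullet> (transpose_mat (J_mat m l) *\<^sub>v a1)"
      by (intro dot_commute) simp
    show ?thesis unfolding H_def e Md(1)
      using H0_mat_bilinear[OF Md(2) tail_stack_carrier Md(3) e2] H0_mat_bilinear[OF tail_stack_carrier Md(2) e2 Md(3)] 1 2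
      by simp
  qed
  have "vv (k + 1) - y = (vv k - y) - M *\<^sub>v d"
    unfolding vv_step[OF k t] M_def[symmetric] d_def[symmetric]
    using cv c d by (intro eq_vecI) auto
  then have "wnormsq H (vv (k + 1) - y) = wnormsq H (vv k - y) - 2 * ((vv k - y) \<bullet> (Q *\<^sub>v d)) + (M *\<^sub>v d) \<bullet> (Q *\<^sub>v d)"
    using wnormsq_diff_correction[OF c(3) _ _ sym] cv c d by (simp add: HMd)
  moreover have "wnormsq (G_mat Q M H) d = 2 * (d \<bullet> (Q *\<^sub>v d)) - (M *\<^sub>v d) \<bullet> (Q *\<^sub>v d)"
    by (rule wnormsq_G_mat[OF c QHM d])
  moreover have "(y - vt k) \<bullet> (Q *\<^sub>v d) = d \<bullet> (Q *\<^sub>v d) - (vv k - y) \<bullet> (Q *\<^sub>v d)"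
    using cv c d by (simp add: d_def dot_linear)
  ultimately show ?thesis by (simp add: Q_def M_def d_def)
qed

text \<open>The weights \<open>1 / \<tau>\<close> and \<open>- (1 - \<tau>) / \<tau>\<close> in
  \<open>xtilde\<close> sum to 1, so residuals combine like the points.\<close>

lemma (in algorithm3_run) tresid_resid:
  assumes k: "0 \<le> k" and t: "0 < \<tau> k"
  shows "resid k = (1 - \<tau> k) \<cdot>\<^sub>v resid (k - 1) + \<tau> k \<cdot>\<^sub>v tresid k"
proof (rule eq_vecI)
  fix i assume "i < dim_vec ((1 - \<tau> k) \<cdot>\<^sub>v resid (k - 1) + \<tau> k \<cdot>\<^sub>v tresid k)"
  then have i: "i < l" by simp
  have "(\<Sum>j = 1..m. (A j *\<^sub>v xtilde k j) $ i)
      = (\<Sum>j = 1..m. 1 / \<tau> k * (A j *\<^sub>v xbreve k j) $ i - (1 - \<tau> k) / \<tau> k * (A j *\<^sub>v xbreve (k - 1) j) $ i)"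
    using i by (intro sum.cong refl) (simp add: A_xtilde[OF k] del: index_mult_mat_vec)
  then have e: "Amul m l A (xtilde k) $ i = 1 / \<tau> k * Amul m l A (xbreve k) $ i - (1 - \<tau> k) / \<tau> k * Amul m l A (xbreve (k - 1)) $ i"
    using i by (simp add: index_Amul sum_subtractf sum_distrib_left del: index_mult_mat_vec)
  show "resid k $ i = ((1 - \<tau> k) \<cdot>\<^sub>v resid (k - 1) + \<tau> k \<cdot>\<^sub>v tresid k) $ i"
    using i t by (simp add: resid_def tresid_def e) (simp add: field_simps)
qed simp

lemma (in algorithm3_run) Amul_minus_feasible:
  assumes k: "0 \<le> k" and x: "x \<in> feasible m l n A b"
  shows "Amul m l A (\<lambda>i. x i - xtilde k i) = - tresid k"
proof (rule eq_vecI)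
  fix i assume "i < dim_vec (- tresid k)"
  then have i: "i < l" by simp
  have "(\<Sum>j = 1..m. (A j *\<^sub>v (x j - xtilde k j)) $ i) = (\<Sum>j = 1..m. (A j *\<^sub>v x j) $ i - (A j *\<^sub>v xtilde k j) $ i)"
  proof (rule sum.cong[OF refl])
    fix j assume j: "j \<in> {1..m}"
    then have "x j \<in> carrier_vec (n j)" using x by (simp add: feasible_def bspace_def)
    then show "(A j *\<^sub>v (x j - xtilde k j)) $ i = (A j *\<^sub>v x j) $ i - (A j *\<^sub>v xtilde k j) $ i"
      using i j by (simp add: mult_mat_vec_linear[OF A_carrier] xtilde_carrier k del: index_mult_mat_vec)
  qed
  moreover have "Amul m l A x $ i = b $ i" using x by (simp add: feasible_def)
  ultimately show "Amul m l A (\<lambda>i. x i - xtilde k i) $ i = (- tresid k) $ i"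
    using i by (simp add: index_Amul sum_subtractf tresid_def del: index_mult_mat_vec)
qed simp

section \<open>Saddle points and the Lipschitz case\<close>

lemma vec_eq_of_dot_diff_eq_0:
  fixes x y :: "real vec"
  assumes x: "x \<in> carrier_vec n" and y: "y \<in> carrier_vec n" and "(x - y) \<bullet> (x - y) = 0"
  shows "x = y"
proof (rule eq_vecI)
  fix i assume i: "i < dim_vec y"
  have "x - y = 0\<^sub>v n" using dot_self_eq_0[of "x - y"] assms by simp
  then have "(x - y) $ i = 0" using i y by simp
  then show "x $ i = y $ i" using i x y by simp
qed (use x y in simp)

context algorithm3_run
begin

lemma
  assumes "saddle_point m l n A b f xs \<mu>s"
  shows saddle_feasible: "xs \<in> feasible m l n A b"
    and saddle_carrier: "\<mu>s \<in> carrier_vec l"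
    and saddle_le: "x \<in> bspace m n \<Longrightarrow> obj m f xs \<le> obj m f x - \<mu>s \<bullet> (Amul m l A x - b)"
proof -
  define R where "R = Amul m l A xs - b"
  have R: "R \<in> carrier_vec l" by (simp add: R_def)
  from assms have xs: "xs \<in> bspace m n" and \<mu>: "\<mu>s \<in> carrier_vec l"
    and s1: "\<And>\<mu>. \<mu> \<in> carrier_vec l \<Longrightarrow> Lagrangian m l A b f xs \<mu> \<le> Lagrangian m l A b f xs \<mu>s"
    and s2: "\<And>x. x \<in> bspace m n \<Longrightarrow> Lagrangian m l A b f xs \<mu>s \<le> Lagrangian m l A b f x \<mu>s"
    unfolding saddle_point_def by blast+
  \<comment> \<open>Moving the multiplier against the residual raises the Lagrangian by
    \<open>R \<bullet> R\<close>, which maximality in \<open>\<mu>\<close> excludes unless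
    \<open>R = 0\<close>.\<close>
  have "\<mu>s - R \<in> carrier_vec l" using \<mu> R by simp
  from s1[OF this] have "R \<bullet> R \<le> 0"
    using \<mu> R by (simp add: Lagrangian_def dot_linear flip: R_def)
  then have feas: "Amul m l A xs = b"
    unfolding R_def using dot_self_nonneg[of "Amul m l A xs - b"]
    by (intro vec_eq_of_dot_diff_eq_0[of _ l]) auto
  then show "xs \<in> feasible m l n A b" using xs by (simp add: feasible_def)
  show "\<mu>s \<in> carrier_vec l" by (rule \<mu>)
  show "obj m f xs \<le> obj m f x - \<mu>s \<bullet> (Amul m l A x - b)" if "x \<in> bspace m n"
    using s2[OF that] \<mu> by (simp add: Lagrangian_def feas dot_linear)
qed

lemma obj_fun_upd:
  "j \<in> {1..m} \<Longrightarrow> obj m f (x(j := y)) = obj m f x - f j (x j) + f j y"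
proof -
  assume j: "j \<in> {1..m}"
  have "obj m f (x(j := y)) = f j y + (\<Sum>i \<in> {1..m} - {j}. f i ((x(j := y)) i))"
    unfolding obj_def using j by (subst sum.remove[of _ j]) auto
  also have "(\<Sum>i \<in> {1..m} - {j}. f i ((x(j := y)) i)) = (\<Sum>i \<in> {1..m} - {j}. f i (x i))"
    by (intro sum.cong) auto
  also have "\<dots> = obj m f x - f j (x j)"
    unfolding obj_def using j by (subst (2) sum.remove[of _ j]) auto
  finally show ?thesis by linarith
qed

text \<open>Varying only block \<open>j\<close> makes the transpose of \<open>A j\<close> applied to
  \<open>\<mu>\<close> a subgradient of \<open>f j\<close>; differentiability leaves no other
  choice.\<close>

lemma Lagrangian_minimizer_gradient:
  assumes x: "x \<in> feasible m l n A b" and \<mu>: "\<mu> \<in> carrier_vec l"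
    and min: "\<And>y. y \<in> bspace m n \<Longrightarrow> obj m f x \<le> obj m f y - \<mu> \<bullet> (Amul m l A y - b)"
    and j: "j \<in> {1..m}" and d: "has_gradient (n j) (f j) (x j) d"
  shows "gradient (n j) (f j) (x j) = transpose_mat (A j) *\<^sub>v \<mu>"
proof (rule subgradient_eq_gradient[OF d])
  have xb: "x \<in> bspace m n" using x by (simp add: feasible_def)
  show xj: "x j \<in> carrier_vec (n j)" using xb j by (simp add: bspace_def)
  show "transpose_mat (A j) *\<^sub>v \<mu> \<in> carrier_vec (n j)"
    using A_carrier[OF j] \<mu> by (intro mult_mat_vec_carrier[of _ _ l]) auto
  fix y :: "real vec" assume y: "y \<in> carrier_vec (n j)"
  have "x(j := y) \<in> bspace m n" using xb y by (auto simp: bspace_def)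
  from min[OF this] have "obj m f x \<le> obj m f (x(j := y)) - \<mu> \<bullet> (Amul m l A (x(j := y)) - b)" .
  also have "Amul m l A (x(j := y)) - b = A j *\<^sub>v (y - x j)"
    using x j y xj unfolding Amul_fun_upd[of A j l "n j" x y m, OF A_carrier[OF j] xj y j]
    by (intro eq_vecI) (auto simp: feasible_def simp del: index_mult_mat_vec)
  also have "\<mu> \<bullet> (A j *\<^sub>v (y - x j)) = (transpose_mat (A j) *\<^sub>v \<mu>) \<bullet> (y - x j)"
    using y xj \<mu> by (intro dot_mult_mat_vec[symmetric, OF A_carrier[OF j]]) auto
  finally show "f j (x j) + (transpose_mat (A j) *\<^sub>v \<mu>) \<bullet> (y - x j) \<le> f j y"
    unfolding obj_fun_upd[OF j] by linarith
qed

end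

section \<open>Step sizes and multipliers under constant penalty\<close>

locale algorithm3_lipschitz = algorithm3_run +
  fixes \<beta>0 L :: real
  assumes lip: "gradient_lipschitz (n m) L (f m)" and \<beta>0: "0 < \<beta>0" and \<beta>_eq: "\<forall>k\<ge>0. \<beta> k = \<beta>0"
    and \<gamma>\<beta>: "(1 - \<gamma>) * \<beta>0 \<le> 1"
    and \<tau>_pos': "\<forall>k\<ge>0. \<tau> k > 0" and \<tau>_rec: "\<forall>k\<ge>0. 1 / (\<tau> (k - 1))\<^sup>2 = (1 - \<tau> k) / (\<tau> k)\<^sup>2"
    and \<tau>_init: "0 < \<tau> (-1)"
    and growth: "\<forall>k\<ge>0. 1 / (\<beta>0 * (\<tau> k)\<^sup>2) + sigma2 (A m) L / \<tau> k
             \<ge> 1 / (\<beta>0 * (\<tau> (k + 1))\<^sup>2) + sigma2 (A m) L * (1 - \<gamma>) / \<tau> (k + 1)"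
begin

abbreviation "s1 \<equiv> sigma1 (A m) L"
abbreviation "s2 \<equiv> sigma2 (A m) L"

text \<open>The coefficient of \<open>1 / \<tau> (k + 1)\<close> in the multiplier weight at
  \<open>k + 1\<close>, once \<open>1 / \<tau> (k + 1)^2\<close> is expanded by the recursion for
  \<open>\<tau>\<close>.\<close>

definition rho :: real where
  "rho = 1 / \<beta>0 + s2 * (1 - \<gamma>)"

lemma m_mem: "m \<in> {1..m}" using m2 by simp

lemma L_pos: "0 < L" using lip by (simp add: gradient_lipschitz_def)

lemma tau_pos: "-1 \<le> k \<Longrightarrow> 0 < \<tau> k"
  using \<tau>_pos' \<tau>_init by (cases "k = -1") auto

lemma tau_rec: "0 \<le> k \<Longrightarrow> (1 - \<tau> k) / (\<tau> k)\<^sup>2 = 1 / (\<tau> (k - 1))\<^sup>2"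
  using \<tau>_rec by simp

lemma tau_less_1:
  assumes "0 \<le> k"
  shows "\<tau> k < 1"
proof -
  have "0 < 1 / (\<tau> (k - 1))\<^sup>2" using tau_pos[of "k - 1"] assms by simp
  then show ?thesis using tau_pos[of k] assms by (simp add: zero_less_divide_iff flip: tau_rec)
qed

lemma inverse_tau_rec:
  assumes "0 \<le> k"
  shows "(1 / \<tau> (k + 1))\<^sup>2 = (1 / \<tau> k)\<^sup>2 + 1 / \<tau> (k + 1)"
proof -
  define t where "t = \<tau> (k + 1)"
  have t: "0 < t" using tau_pos[of "k + 1"] assms by (simp add: t_def)
  have "(1 - t) / t\<^sup>2 = 1 / (\<tau> k)\<^sup>2" using tau_rec[of "k + 1"] assms by (simp add: t_def)
  moreover have "(1 - t) / t\<^sup>2 = (1 / t)\<^sup>2 - 1 / t"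
    using t by (simp add: power2_eq_square diff_divide_distrib)
  ultimately show ?thesis by (simp add: power_one_over flip: t_def)
qed

lemma inverse_tau_gt_1:
  assumes "0 \<le> k"
  shows "1 < 1 / \<tau> k"
  using tau_less_1[OF assms] \<tau>_pos'[rule_format, OF assms] by (simp add: less_divide_eq_1)

lemma inverse_tau_mono:
  assumes "0 \<le> k"
  shows "1 / \<tau> k < 1 / \<tau> (k + 1)" "1 / \<tau> (k + 1) \<le> 1 / \<tau> k + 1"
proof -
  define i i' where "i = 1 / \<tau> k" and "i' = 1 / \<tau> (k + 1)"
  have p: "1 < i" "1 < i'" using inverse_tau_gt_1[of k] inverse_tau_gt_1[of "k + 1"] assms by (auto simp: i_def i'_def)
  have e: "i'\<^sup>2 = i\<^sup>2 + i'" unfolding i_def i'_def by (rule inverse_tau_rec[OF assms])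
  have "i\<^sup>2 < i'\<^sup>2" using e p by simp
  then show "i < i'" using p by (intro power_less_imp_less_base[of i 2 i']) auto
  \<comment> \<open>If \<open>i'\<close> exceeded \<open>i + 1\<close>, both factors on the left
    would exceed \<open>i\<close>.\<close>
  have "i' * (i' - 1) = i * i" using e by (simp add: power2_eq_square algebra_simps)
  moreover have "i * i < i' * (i' - 1)" if "i + 1 < i'"
    using that p by (intro mult_strict_mono) auto
  ultimately show "i' \<le> i + 1" by (metis less_irrefl not_le_imp_less)
qed

text \<open>A crude bound from adding terms larger than 1; only divergence of
  \<open>1 / \<tau>\<close> is used later.\<close>

lemma inverse_tau_square_ge: "real k \<le> (1 / \<tau> (int k))\<^sup>2"
proof (induction k)
  case (Suc k)
  have "real (Suc k) \<le> (1 / \<tau> (int k))\<^sup>2 + 1 / \<tau> (int k + 1)"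
    using Suc inverse_tau_gt_1[of "int k + 1"] by simp
  then show ?case using inverse_tau_rec[of "int k"] by (simp add: add.commute)
qed simp

lemma s1_nonneg: "0 \<le> s1"
  unfolding sigma1_def using sigma_min_gram_nonneg[OF A_carrier[OF m_mem] l0] L_pos by simp

lemma s2_eq: "s2 = s1 / (s1 + 1)"
  using s1_nonneg by (simp add: sigma2_def power2_eq_square field_simps)

lemma s2_nonneg: "0 \<le> s2"
  using s1_nonneg by (simp add: s2_eq)

lemma rho_pos: "0 < rho"
  using \<beta>0 s2_nonneg \<gamma> by (simp add: rho_def add_pos_nonneg)

lemma growth_rho:
  assumes k: "0 \<le> k"
  shows "rho / \<tau> (k + 1) \<le> s2 / \<tau> k"
proof -
  have "1 / (\<beta>0 * (\<tau> (k + 1))\<^sup>2) = 1 / \<beta>0 * (1 / \<tau> (k + 1))\<^sup>2" by (simp add: power_divide)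
  also have "\<dots> = 1 / (\<beta>0 * (\<tau> k)\<^sup>2) + 1 / \<beta>0 * (1 / \<tau> (k + 1))"
    unfolding inverse_tau_rec[OF k] by (simp add: power_divide distrib_left)
  finally show ?thesis using growth k by (auto simp: rho_def add_divide_distrib)
qed

text \<open>The growth condition at \<open>k = 0\<close> together with the strict increase of
  \<open>1 / \<tau>\<close> suffices.\<close>

lemma rho_less_s2: "rho < s2"
proof -
  have "rho * (1 / \<tau> 0) < rho * (1 / \<tau> (0 + 1))"
    using inverse_tau_mono(1)[of 0] rho_pos by (intro mult_strict_left_mono) auto
  also have "\<dots> \<le> s2 * (1 / \<tau> 0)" using growth_rho[of 0] by simp
  finally show ?thesis using tau_pos[of 0] by (simp add: divide_less_cancel)
qed

lemma sigma_min_pos: "0 < sigma_min (A m * transpose_mat (A m))"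
proof -
  have "0 < s2" using rho_less_s2 rho_pos by simp
  then have "s1 \<noteq> 0" by (auto simp: s2_eq)
  then show ?thesis
    using sigma_min_gram_nonneg[OF A_carrier[OF m_mem] l0] by (auto simp: sigma1_def)
qed

text \<open>Saddle points share the objective value, so \<open>x\<close> minimizes the Lagrangian
  for both multipliers. Both then yield the gradient of \<open>f m\<close> at \<open>x m\<close>,
  and the transpose of \<open>A m\<close> is injective because \<open>sigma_min\<close> of the Gram
  matrix is positive.\<close>

lemma multiplier_unique:
  assumes "saddle_point m l n A b f x \<mu>" "saddle_point m l n A b f x' \<mu>'"
  shows "\<mu>' = \<mu>"
proof -
  note 1 = saddle_feasible[OF assms(1)] saddle_carrier[OF assms(1)] saddle_le[OF assms(1)]
  note 2 = saddle_feasible[OF assms(2)] saddle_carrier[OF assms(2)] saddle_le[OF assms(2)]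
  have "obj m f x \<le> obj m f x'" "obj m f x' \<le> obj m f x"
    using 1(3)[of x'] 2(3)[of x] 1(1,2) 2(1,2) by (auto simp: feasible_def dot_linear)
  then have eq: "obj m f x = obj m f x'" by simp
  have "x m \<in> carrier_vec (n m)" using 1(1) m_mem by (auto simp: feasible_def bspace_def)
  then have d: "has_gradient (n m) (f m) (x m) (gradient (n m) (f m) (x m))"
    by (rule gradient_lipschitz_has_gradient[OF lip])
  have "gradient (n m) (f m) (x m) = transpose_mat (A m) *\<^sub>v \<mu>"
    by (rule Lagrangian_minimizer_gradient[OF 1 m_mem d])
  moreover have "gradient (n m) (f m) (x m) = transpose_mat (A m) *\<^sub>v \<mu>'"
    by (rule Lagrangian_minimizer_gradient[OF 1(1) 2(2) _ m_mem d]) (use 2(3) eq in simp)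
  ultimately have e: "transpose_mat (A m) *\<^sub>v \<mu>' = transpose_mat (A m) *\<^sub>v \<mu>" by simp
  have T: "transpose_mat (A m) \<in> carrier_mat (n m) l" using A_carrier[OF m_mem] by simp
  have z: "transpose_mat (A m) *\<^sub>v (\<mu>' - \<mu>) = 0\<^sub>v (n m)"
    using T 1(2) 2(2) by (simp add: mult_mat_vec_linear[OF T] e)
  have "sigma_min (A m * transpose_mat (A m)) * ((\<mu>' - \<mu>) \<bullet> (\<mu>' - \<mu>)) \<le> 0"
    using sigma_min_gram_le[OF A_carrier[OF m_mem] l0, of "\<mu>' - \<mu>"] 1(2) 2(2) by (simp add: z)
  then have "(\<mu>' - \<mu>) \<bullet> (\<mu>' - \<mu>) = 0"
    using sigma_min_pos dot_self_nonneg[of "\<mu>' - \<mu>"] by (simp add: mult_le_0_iff)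
  then show ?thesis using 1(2) 2(2) by (intro vec_eq_of_dot_diff_eq_0[of _ l])
qed

text \<open>\<open>lhat\<close> is the multiplier that a correction step with \<open>\<gamma> = 1\<close> would produce.\<close>

definition lhat :: "int \<Rightarrow> real vec" where
  "lhat k = lambar k - (\<tau> k * \<beta>0) \<cdot>\<^sub>v tresid k"

lemma lhat_carrier: "0 \<le> k \<Longrightarrow> lhat k \<in> carrier_vec l"
  by (simp add: lhat_def lambar_carrier)

text \<open>In block \<open>m\<close> the partial gap is the full sum, which cancels the one in
  \<open>lambar - lamtilde\<close>. The gradient of the last function therefore sees the multiplier
  error without any gaps.\<close>

lemma block_mult_last: "0 \<le> k \<Longrightarrow> block_mult k m = lhat k - cf k \<cdot>\<^sub>v resid (k - 1)"
proof -
  assume k: "0 \<le> k"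
  have "lamtilde k = lambar k - (lambar k - lamtilde k)"
    using lambar_carrier[OF k] lamtilde_carrier[OF k] by (intro eq_vecI) auto
  then have "lamtilde k = lambar k - (\<tau> k * \<beta> k) \<cdot>\<^sub>v (tresid k + partial_gap k m)"
    by (simp only: lambar_minus_lamtilde[OF k])
  then show ?thesis using lambar_carrier[OF k] \<beta>_eq k
    by (intro eq_vecI) (auto simp: block_mult_def lhat_def algebra_simps)
qed

lemma lambar_step_lhat:
  assumes k: "0 \<le> k" and \<mu>: "\<mu> \<in> carrier_vec l"
  shows "lambar (k + 1) - \<mu> = (1 - \<gamma>) \<cdot>\<^sub>v (lambar k - \<mu>) + \<gamma> \<cdot>\<^sub>v (lhat k - \<mu>)"
  unfolding lambar_step[OF k] lhat_def using lambar_carrier[OF k] \<mu> \<beta>_eq k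
  by (intro eq_vecI) (auto simp: algebra_simps)

lemma xbreve_gradient:
  assumes k: "0 \<le> k"
  shows "gradient (n m) (f m) (xbreve k m) = transpose_mat (A m) *\<^sub>v block_mult k m"
proof -
  have xb: "xbreve k m \<in> carrier_vec (n m)" using k m_mem by (intro xbreve_carrier) auto
  show ?thesis
  proof (rule subgradient_eq_gradient[OF gradient_lipschitz_has_gradient[OF lip xb] xb])
    show "transpose_mat (A m) *\<^sub>v block_mult k m \<in> carrier_vec (n m)"
      using A_carrier[OF m_mem] by (intro mult_mat_vec_carrier[of _ _ l]) auto
    fix y :: "real vec" assume y: "y \<in> carrier_vec (n m)"
    show "f m (xbreve k m) + (transpose_mat (A m) *\<^sub>v block_mult k m) \<bullet> (y - xbreve k m) \<le> f m y"
      using xbreve_subgradient[OF k _ m_mem y] tau_pos[of k] k y xb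
      by (subst dot_mult_mat_vec[OF A_carrier[OF m_mem]]) auto
  qed
qed

lemma xbreve_cocoercive:
  assumes k: "0 \<le> k" and y: "y \<in> carrier_vec (n m)"
  defines "h \<equiv> gradient (n m) (f m) (xbreve k m) - gradient (n m) (f m) y"
  shows "f m (xbreve k m) + block_mult k m \<bullet> (A m *\<^sub>v (y - xbreve k m)) + 1 / (2 * L) * (h \<bullet> h) \<le> f m y"
proof -
  have xb: "xbreve k m \<in> carrier_vec (n m)" using k m_mem by (intro xbreve_carrier) auto
  have g: "gradient (n m) (f m) z \<in> carrier_vec (n m)" if "z \<in> carrier_vec (n m)" for z
    using gradient_lipschitz_has_gradient[OF lip that] by (simp add: has_gradient_def)
  define h' where "h' = gradient (n m) (f m) y - gradient (n m) (f m) (xbreve k m)"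
  have "h \<bullet> h = h' \<bullet> h'"
    using g[OF xb] g[OF y] by (simp add: h_def h'_def dot_linear)
  moreover have "f m (xbreve k m) + gradient (n m) (f m) (xbreve k m) \<bullet> (y - xbreve k m) + 1 / (2 * L) * (h' \<bullet> h') \<le> f m y"
    unfolding h'_def by (rule gradient_lipschitz_cocoercive[OF f_convex[OF m_mem] lip xb y])
  moreover have "gradient (n m) (f m) (xbreve k m) \<bullet> (y - xbreve k m) = block_mult k m \<bullet> (A m *\<^sub>v (y - xbreve k m))"
    unfolding xbreve_gradient[OF k] using xb y by (intro dot_mult_mat_vec[OF A_carrier[OF m_mem]]) auto
  ultimately show ?thesis by simp
qed

end

context algorithm3_run
begin

abbreviation Q_k :: "int \<Rightarrow> real mat" where
  "Q_k k \<equiv> Q_mat m l (\<tau> k) (\<beta> k)"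

abbreviation M_k :: "int \<Rightarrow> real mat" where
  "M_k k \<equiv> M_mat m l \<gamma> (\<tau> k) (\<beta> k)"

abbreviation H_k :: "int \<Rightarrow> real mat" where
  "H_k k \<equiv> H0_mat m l \<gamma> (\<tau> k * \<beta> k) (1 / (\<tau> k * \<beta> k))"

abbreviation G_k :: "int \<Rightarrow> real mat" where
  "G_k k \<equiv> G_mat (Q_k k) (M_k k) (H_k k)"

lemma H_k_factorization:
  assumes "0 \<le> k" "0 < \<tau> k"
  shows "H_k k \<in> carrier_mat (m * l) (m * l)" "Q_k k = H_k k * M_k k"
proof -
  have "tail_dim m l + l = m * l" using m2 by (cases m) (auto simp: tail_dim_def)
  then show "H_k k \<in> carrier_mat (m * l) (m * l)"
    using H0_mat_carrier[of m l \<gamma> "\<tau> k * \<beta> k" "1 / (\<tau> k * \<beta> k)"] by simp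
  show "Q_k k = H_k k * M_k k"
    using H0_mat_mult_M_mat[OF l0, of "\<tau> k" "\<beta> k" \<gamma> m] beta_pos[OF assms(1)] assms(2) \<gamma> by simp
qed

lemma wnormsq_G_k_nonneg:
  assumes "0 \<le> k" "0 < \<tau> k"
  shows "0 \<le> wnormsq (G_k k) (vv k - vt k)"
proof -
  have "0 \<le> (1 - \<gamma>) * \<tau> k * \<beta> k * (tresid k \<bullet> tresid k)"
    using \<gamma> assms beta_pos[OF assms(1)] by (simp add: dot_self_nonneg)
  then show ?thesis using wnormsq_G_ge[OF assms] by linarith
qed

lemma vv_minus_v_stack:
  assumes k: "0 \<le> k" and x: "x \<in> bspace m n" and \<mu>: "\<mu> \<in> carrier_vec l"
  shows "vv k - v_stack m l A x \<mu> = tail_stack m l (\<lambda>j. A j *\<^sub>v xbar k j - A j *\<^sub>v x j) @\<^sub>v (lambar k - \<mu>)"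
  unfolding vv_def using x \<mu> lambar_carrier[OF k] by (intro v_stack_minus) (auto simp: bspace_def)

end

section \<open>The gap of the contraction inequality\<close>

context algorithm3_lipschitz
begin

text \<open>The multiplier coefficient of \<open>H_0\<close> in part (ii). Its first term is already
  the multiplier coefficient of \<open>H_k k\<close> divided by \<open>\<tau> k\<close>; the second
  is the surplus gained from smoothness.\<close>

definition weight :: "int \<Rightarrow> real" where
  "weight k = 1 / (\<beta>0 * (\<tau> k)\<^sup>2) + s2 * (1 - \<gamma>) / \<tau> k"

text \<open>At a saddle point this is the gradient difference \<open>z^k - z'\<close>, expressed
  through the multiplier alone.\<close>

definition grad_gap :: "int \<Rightarrow> real vec \<Rightarrow> real vec" where
  "grad_gap k \<mu> = transpose_mat (A m) *\<^sub>v (block_mult k m - \<mu>)"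

text \<open>The gap of the contraction inequality in part (ii) before \<open>\<Theta>\<close> is subtracted; it depends on
  the saddle point only through its multiplier \<open>\<mu>\<close>.\<close>

definition slack :: "int \<Rightarrow> real vec \<Rightarrow> real" where
  "slack k \<mu> = s2 * (1 - \<gamma>) / (\<gamma> * \<tau> k) * ((lambar k - \<mu>) \<bullet> (lambar k - \<mu>))
    - rho / (\<gamma> * \<tau> (k + 1)) * ((lambar (k + 1) - \<mu>) \<bullet> (lambar (k + 1) - \<mu>))
    + 1 / \<tau> k * (1 / L * (grad_gap k \<mu> \<bullet> grad_gap k \<mu>) + wnormsq (G_k k) (vv k - vt k))"

lemma weight_next:
  assumes k: "0 \<le> k"
  shows "weight (k + 1) = 1 / (\<beta>0 * (\<tau> k)\<^sup>2) + rho / \<tau> (k + 1)"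
proof -
  have "1 / (\<beta>0 * (\<tau> (k + 1))\<^sup>2) = 1 / \<beta>0 * (1 / \<tau> (k + 1))\<^sup>2" by (simp add: power_divide)
  also have "\<dots> = 1 / (\<beta>0 * (\<tau> k)\<^sup>2) + 1 / \<beta>0 * (1 / \<tau> (k + 1))"
    unfolding inverse_tau_rec[OF k] by (simp add: power_divide distrib_left)
  finally show ?thesis by (simp add: weight_def rho_def add_divide_distrib)
qed

text \<open>After division by \<open>\<tau> k\<close> the \<open>J J^T\<close> blocks of
  \<open>H_k k\<close> and \<open>H_0\<close> coincide, so only multiplier terms differ. Expanding
  \<open>weight (k + 1)\<close> by the recursion for \<open>\<tau>\<close> exposes them as the first
  two terms of \<open>slack\<close>.\<close>

lemma contraction_slack:
  assumes k: "0 \<le> k" and x: "x \<in> bspace m n" and \<mu>: "\<mu> \<in> carrier_vec l"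
  defines "y \<equiv> v_stack m l A x \<mu>"
  shows "1 / \<tau> k * (wnormsq (H_k k) (vv (k + 1) - y) + 1 / L * (grad_gap k \<mu> \<bullet> grad_gap k \<mu>)
      - wnormsq (H_k k) (vv k - y) + wnormsq (G_k k) (vv k - vt k))
    = wnormsq (H0_mat m l \<gamma> \<beta>0 (weight (k + 1))) (vv (k + 1) - y)
      - wnormsq (H0_mat m l \<gamma> \<beta>0 (weight k)) (vv k - y) + slack k \<mu>"
proof -
  have k1: "0 \<le> k + 1" using k by simp
  have c: "lambar k - \<mu> \<in> carrier_vec l" "lambar (k + 1) - \<mu> \<in> carrier_vec l"
    using lambar_carrier[OF k] lambar_carrier[OF k1] \<mu> by auto
  have t: "0 < \<tau> k" and t1: "0 < \<tau> (k + 1)" using tau_pos k by auto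
  have b: "\<beta> k = \<beta>0" using \<beta>_eq k by simp
  define a0 a1 where "a0 = tail_stack m l (\<lambda>j. A j *\<^sub>v xbar k j - A j *\<^sub>v x j)"
    and "a1 = tail_stack m l (\<lambda>j. A j *\<^sub>v xbar (k + 1) j - A j *\<^sub>v x j)"
  define N0 N1 A0 A1 where "N0 = (lambar k - \<mu>) \<bullet> (lambar k - \<mu>)"
    and "N1 = (lambar (k + 1) - \<mu>) \<bullet> (lambar (k + 1) - \<mu>)"
    and "A0 = (transpose_mat (J_mat m l) *\<^sub>v a0) \<bullet> (transpose_mat (J_mat m l) *\<^sub>v a0)"
    and "A1 = (transpose_mat (J_mat m l) *\<^sub>v a1) \<bullet> (transpose_mat (J_mat m l) *\<^sub>v a1)"
  have w0: "wnormsq (H0_mat m l \<gamma> p q) (vv k - y) = (p * A0 + q * N0) / \<gamma>" for p q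
    unfolding y_def vv_minus_v_stack[OF k x \<mu>] A0_def N0_def a0_def
    by (rule wnormsq_H0_mat[OF tail_stack_carrier c(1)])
  have w1: "wnormsq (H0_mat m l \<gamma> p q) (vv (k + 1) - y) = (p * A1 + q * N1) / \<gamma>" for p q
    unfolding y_def vv_minus_v_stack[OF k1 x \<mu>] A1_def N1_def a1_def
    by (rule wnormsq_H0_mat[OF tail_stack_carrier c(2)])
  have "1 / \<tau> k * ((\<tau> k * \<beta>0 * A1 + 1 / (\<tau> k * \<beta>0) * N1) / \<gamma>) - 1 / \<tau> k * ((\<tau> k * \<beta>0 * A0 + 1 / (\<tau> k * \<beta>0) * N0) / \<gamma>)
      = (\<beta>0 * A1 + weight (k + 1) * N1) / \<gamma> - (\<beta>0 * A0 + weight k * N0) / \<gamma>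
        + s2 * (1 - \<gamma>) / (\<gamma> * \<tau> k) * N0 - rho / (\<gamma> * \<tau> (k + 1)) * N1"
    unfolding weight_next[OF k] unfolding weight_def
    using t t1 \<beta>0 \<gamma> by (simp add: power2_eq_square add_divide_distrib distrib_right distrib_left diff_divide_distrib mult_ac)
  then show ?thesis
    unfolding w0 w1 b slack_def N0_def[symmetric] N1_def[symmetric]
    by (simp add: distrib_left right_diff_distrib)
qed

lemma slack_ge_neg:
  assumes k: "0 \<le> k"
  shows "- (rho / (\<gamma> * \<tau> (k + 1)) * ((lambar (k + 1) - \<mu>) \<bullet> (lambar (k + 1) - \<mu>))) \<le> slack k \<mu>"
proof -
  have t: "0 < \<tau> k" using tau_pos k by auto
  have "0 \<le> s2 * (1 - \<gamma>) / (\<gamma> * \<tau> k) * ((lambar k - \<mu>) \<bullet> (lambar k - \<mu>))"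
    using t \<gamma> s2_nonneg by (simp add: dot_self_nonneg)
  moreover have "0 \<le> 1 / \<tau> k * (1 / L * (grad_gap k \<mu> \<bullet> grad_gap k \<mu>) + wnormsq (G_k k) (vv k - vt k))"
    using t L_pos wnormsq_G_k_nonneg[OF k t] by (simp add: dot_self_nonneg)
  ultimately show ?thesis unfolding slack_def by linarith
qed

text \<open>The Gram bound gives \<open>s1 |p - q|^2\<close> for the multiplier error
  \<open>p\<close> of \<open>lhat\<close> and the shift \<open>q\<close> by the previous residual;
  Young's inequality separates the two and reduces \<open>s1\<close> to \<open>s2\<close>.\<close>

lemma grad_gap_ge:
  assumes k: "0 \<le> k" and \<mu>: "\<mu> \<in> carrier_vec l"
  shows "s2 * ((lhat k - \<mu>) \<bullet> (lhat k - \<mu>)) - (cf k)\<^sup>2 * (resid (k - 1) \<bullet> resid (k - 1))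
    \<le> 1 / L * (grad_gap k \<mu> \<bullet> grad_gap k \<mu>)"
proof -
  define p q where "p = lhat k - \<mu>" and "q = cf k \<cdot>\<^sub>v resid (k - 1)"
  have pq: "p \<in> carrier_vec l" "q \<in> carrier_vec l" using lhat_carrier[OF k] \<mu> by (auto simp: p_def q_def)
  have "block_mult k m - \<mu> = p - q"
    unfolding block_mult_last[OF k] p_def q_def using lhat_carrier[OF k] \<mu> by (intro eq_vecI) auto
  then have "sigma_min (A m * transpose_mat (A m)) * ((p - q) \<bullet> (p - q)) \<le> grad_gap k \<mu> \<bullet> grad_gap k \<mu>"
    unfolding grad_gap_def using sigma_min_gram_le[OF A_carrier[OF m_mem] l0, of "p - q"] pq by simp
  then have "s1 * ((p - q) \<bullet> (p - q)) \<le> 1 / L * (grad_gap k \<mu> \<bullet> grad_gap k \<mu>)"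
    using L_pos by (simp add: sigma1_def divide_right_mono)
  moreover have "s2 * (p \<bullet> p) - q \<bullet> q \<le> s1 * ((p - q) \<bullet> (p - q))"
    unfolding sigma2_def using pq s1_nonneg by (intro dot_diff_Young) auto
  moreover have "q \<bullet> q = (cf k)\<^sup>2 * (resid (k - 1) \<bullet> resid (k - 1))"
    by (simp add: q_def dot_linear power2_eq_square)
  ultimately show ?thesis by (simp add: p_def)
qed

text \<open>The bound \<open>(1 - \<gamma>) \<beta>0 \<le> 1\<close> lowers the square of this
  factor to its first power, and \<open>1 - \<tau> k\<close> likewise. The recursion then rewrites
  \<open>(1 - \<tau> k) / \<tau> k\<close> as \<open>\<tau> k / (\<tau> (k - 1))^2\<close>.\<close>

lemma cf_square_le:
  assumes k: "0 \<le> k"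
  shows "(cf k)\<^sup>2 / \<tau> k \<le> (1 - \<gamma>) * \<beta>0 * (\<tau> k / (\<tau> (k - 1))\<^sup>2)"
proof -
  have t: "0 < \<tau> k" "\<tau> k \<le> 1" using tau_pos tau_less_1 k by (auto simp: less_imp_le)
  have g: "0 \<le> (1 - \<gamma>) * \<beta>0" using \<gamma> \<beta>0 by simp
  have "cf k = ((1 - \<gamma>) * \<beta>0) * (1 - \<tau> k)" using \<beta>_eq k by (simp add: cf_def)
  then have "(cf k)\<^sup>2 = ((1 - \<gamma>) * \<beta>0)\<^sup>2 * (1 - \<tau> k)\<^sup>2" by (simp add: power_mult_distrib)
  also have "\<dots> \<le> ((1 - \<gamma>) * \<beta>0) * (1 - \<tau> k)"
  proof (rule mult_mono)
    show "((1 - \<gamma>) * \<beta>0)\<^sup>2 \<le> (1 - \<gamma>) * \<beta>0"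
      unfolding power2_eq_square using mult_left_mono[OF \<gamma>\<beta> g] by simp
    show "(1 - \<tau> k)\<^sup>2 \<le> 1 - \<tau> k"
      unfolding power2_eq_square using t mult_left_mono[of "1 - \<tau> k" 1 "1 - \<tau> k"] by simp
  qed (use t g in auto)
  finally have "(cf k)\<^sup>2 / \<tau> k \<le> (1 - \<gamma>) * \<beta>0 * (1 - \<tau> k) / \<tau> k" using t by (intro divide_right_mono) auto
  also have "(1 - \<gamma>) * \<beta>0 * (1 - \<tau> k) / \<tau> k = (1 - \<gamma>) * \<beta>0 * (\<tau> k * ((1 - \<tau> k) / (\<tau> k)\<^sup>2))"
    using t by (simp add: power2_eq_square)
  finally show ?thesis unfolding tau_rec[OF k] by simp
qed

text \<open>The lower bound prescribed for the increments of \<open>\<Theta>\<close>; its sign is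
  not fixed.\<close>

definition Theta_incr :: "int \<Rightarrow> real" where
  "Theta_incr k = (1 - \<gamma>) * \<beta>0 * (tresid k \<bullet> tresid k - \<tau> k / (\<tau> (k - 1))\<^sup>2 * (resid (k - 1) \<bullet> resid (k - 1)))"

text \<open>What remains for the new multiplier error: \<open>s2 / (\<gamma> \<tau> k)\<close> from
  convexity minus the coefficient already charged in \<open>slack\<close>.\<close>

definition decrease :: "int \<Rightarrow> real" where
  "decrease k = (s2 / \<tau> k - rho / \<tau> (k + 1)) / \<gamma>"

lemma decrease_nonneg: "0 \<le> k \<Longrightarrow> 0 \<le> decrease k"
  using growth_rho[of k] \<gamma> by (simp add: decrease_def)

text \<open>\<open>lambar (k + 1)\<close> is a convex combination of \<open>lambar k\<close> and
  \<open>lhat k\<close>. With weight \<open>s2 / (\<gamma> \<tau> k)\<close>, convexity of the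
  squared error trades the old error in \<open>slack\<close> and the \<open>lhat\<close> error from
  the gradient gap for the new error, while \<open>G\<close> and \<open>cf_square_le\<close> supply
  \<open>Theta_incr\<close>.\<close>

lemma slack_ge:
  assumes k: "0 \<le> k" and \<mu>: "\<mu> \<in> carrier_vec l"
  shows "Theta_incr k + decrease k * ((lambar (k + 1) - \<mu>) \<bullet> (lambar (k + 1) - \<mu>)) \<le> slack k \<mu>"
proof -
  have t: "0 < \<tau> k" using tau_pos k by auto
  define N0 N1 P R W where "N0 = (lambar k - \<mu>) \<bullet> (lambar k - \<mu>)"
    and "N1 = (lambar (k + 1) - \<mu>) \<bullet> (lambar (k + 1) - \<mu>)"
    and "P = (lhat k - \<mu>) \<bullet> (lhat k - \<mu>)" and "R = resid (k - 1) \<bullet> resid (k - 1)"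
    and "W = tresid k \<bullet> tresid k"
  have R: "0 \<le> R" by (simp add: R_def dot_self_nonneg)
  have N1: "N1 \<le> (1 - \<gamma>) * N0 + \<gamma> * P"
    unfolding N1_def N0_def P_def lambar_step_lhat[OF k \<mu>]
    using \<gamma> \<mu> by (intro dot_convex_comb_le) auto
  have "(1 - \<gamma>) * \<tau> k * \<beta>0 * W \<le> wnormsq (G_k k) (vv k - vt k)"
    using wnormsq_G_ge[OF k t] \<beta>_eq k by (simp add: W_def)
  then have "s2 * P - (cf k)\<^sup>2 * R + (1 - \<gamma>) * \<tau> k * \<beta>0 * W
      \<le> 1 / L * (grad_gap k \<mu> \<bullet> grad_gap k \<mu>) + wnormsq (G_k k) (vv k - vt k)"
    using grad_gap_ge[OF k \<mu>] by (simp add: P_def R_def)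
  then have "1 / \<tau> k * (s2 * P - (cf k)\<^sup>2 * R + (1 - \<gamma>) * \<tau> k * \<beta>0 * W)
      \<le> 1 / \<tau> k * (1 / L * (grad_gap k \<mu> \<bullet> grad_gap k \<mu>) + wnormsq (G_k k) (vv k - vt k))"
    using t by (intro mult_left_mono) auto
  moreover have "1 / \<tau> k * (s2 * P - (cf k)\<^sup>2 * R + (1 - \<gamma>) * \<tau> k * \<beta>0 * W)
      = s2 / \<tau> k * P - (cf k)\<^sup>2 / \<tau> k * R + (1 - \<gamma>) * \<beta>0 * W"
    using t by (simp add: field_simps)
  moreover have "(cf k)\<^sup>2 / \<tau> k * R \<le> (1 - \<gamma>) * \<beta>0 * (\<tau> k / (\<tau> (k - 1))\<^sup>2) * R"
    by (rule mult_right_mono[OF cf_square_le[OF k] R])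
  moreover have "s2 / (\<gamma> * \<tau> k) * N1 \<le> s2 / (\<gamma> * \<tau> k) * ((1 - \<gamma>) * N0 + \<gamma> * P)"
    using N1 s2_nonneg \<gamma> t by (intro mult_left_mono) auto
  moreover have "s2 / (\<gamma> * \<tau> k) * ((1 - \<gamma>) * N0 + \<gamma> * P) = s2 * (1 - \<gamma>) / (\<gamma> * \<tau> k) * N0 + s2 / \<tau> k * P"
    using \<gamma> t by (simp add: field_simps)
  moreover have "decrease k * N1 = s2 / (\<gamma> * \<tau> k) * N1 - rho / (\<gamma> * \<tau> (k + 1)) * N1"
    by (simp add: decrease_def diff_divide_distrib left_diff_distrib mult.commute[of \<gamma>])
  moreover have "Theta_incr k = (1 - \<gamma>) * \<beta>0 * W - (1 - \<gamma>) * \<beta>0 * (\<tau> k / (\<tau> (k - 1))\<^sup>2) * R"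
    by (simp add: Theta_incr_def W_def R_def right_diff_distrib)
  ultimately show ?thesis
    unfolding slack_def N0_def[symmetric] N1_def[symmetric] by linarith
qed

text \<open>Expand \<open>resid k\<close> as a convex combination of the previous residual and
  \<open>tresid k\<close>: the indefinite product disappears into a telescoping difference.\<close>

lemma tresid_resid_dot:
  assumes k: "0 \<le> k"
  shows "Theta_incr k + 2 * (cf k / \<tau> k) * (tresid k \<bullet> resid (k - 1))
    = (1 - \<gamma>) * \<beta>0 * (resid k \<bullet> resid k / (\<tau> k)\<^sup>2 - resid (k - 1) \<bullet> resid (k - 1) / (\<tau> (k - 1))\<^sup>2)"
proof -
  define t R W C where "t = \<tau> k" and "R = resid (k - 1) \<bullet> resid (k - 1)" and "W = tresid k \<bullet> tresid k"
    and "C = tresid k \<bullet> resid (k - 1)"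
  have t: "0 < t" using tau_pos k by (auto simp: t_def)
  have rr: "resid k \<bullet> resid k = (1 - t)\<^sup>2 * R + 2 * (t * (1 - t)) * C + t\<^sup>2 * W"
    using tau_pos[of k] k dot_commute[of "resid (k - 1)" "tresid k"]
    unfolding tresid_resid[OF k tau_pos[of k, OF order_trans[OF _ k]], simplified]
    by (simp add: dot_linear R_def W_def C_def t_def power2_eq_square algebra_simps)
  have p: "1 / (\<tau> (k - 1))\<^sup>2 = (1 - t) / t\<^sup>2" using tau_rec[OF k] by (simp add: t_def)
  have "W - t * ((1 - t) / t\<^sup>2) * R + 2 * ((1 - t) / t) * C
      = ((1 - t)\<^sup>2 * R + 2 * (t * (1 - t)) * C + t\<^sup>2 * W) / t\<^sup>2 - R * ((1 - t) / t\<^sup>2)"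
    using t by (simp add: power2_eq_square field_simps)
  then have e1: "(1 - \<gamma>) * \<beta>0 * (W - t * ((1 - t) / t\<^sup>2) * R + 2 * ((1 - t) / t) * C)
      = (1 - \<gamma>) * \<beta>0 * (resid k \<bullet> resid k / t\<^sup>2 - R * ((1 - t) / t\<^sup>2))"
    unfolding rr by simp
  have e2: "t / (\<tau> (k - 1))\<^sup>2 = t * ((1 - t) / t\<^sup>2)" unfolding p[symmetric] by simp
  have e3: "R / (\<tau> (k - 1))\<^sup>2 = R * ((1 - t) / t\<^sup>2)" unfolding p[symmetric] by simp
  have e4: "2 * (cf k / t) * C = (1 - \<gamma>) * \<beta>0 * (2 * ((1 - t) / t) * C)"
    using \<beta>_eq k by (simp add: cf_def t_def)
  show ?thesis
    unfolding Theta_incr_def W_def[symmetric] R_def[symmetric] C_def[symmetric] t_def[symmetric] e2 e3 e4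
    using e1 by (simp only: distrib_left)
qed

section \<open>Lyapunov function at a fixed saddle point\<close>

context
  fixes xs :: bvec and \<mu>s :: "real vec"
  assumes saddle: "saddle_point m l n A b f xs \<mu>s"
begin

lemma xs_bspace: "xs \<in> bspace m n"
  using saddle_feasible[OF saddle] by (simp add: feasible_def)

lemma xs_gradient: "gradient (n m) (f m) (xs m) = transpose_mat (A m) *\<^sub>v \<mu>s"
proof -
  have "xs m \<in> carrier_vec (n m)" using xs_bspace m_mem by (auto simp: bspace_def)
  then show ?thesis
    using Lagrangian_minimizer_gradient[OF saddle_feasible[OF saddle] saddle_carrier[OF saddle]
        saddle_le[OF saddle] m_mem] gradient_lipschitz_has_gradient[OF lip] by blast
qed

lemma grad_gap_eq:
  assumes k: "0 \<le> k"
  shows "gradient (n m) (f m) (xbreve k m) - gradient (n m) (f m) (xs m) = grad_gap k \<mu>s"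
proof -
  have T: "transpose_mat (A m) \<in> carrier_mat (n m) l" using A_carrier[OF m_mem] by simp
  show ?thesis
    unfolding xbreve_gradient[OF k] xs_gradient grad_gap_def
    using saddle_carrier[OF saddle] by (simp add: mult_mat_vec_linear[OF T])
qed

definition Lagrangian_gap :: "int \<Rightarrow> real" where
  "Lagrangian_gap k = obj m f (xbreve k) - obj m f xs - \<mu>s \<bullet> resid k"

lemma Lagrangian_gap_nonneg: "-1 \<le> k \<Longrightarrow> 0 \<le> Lagrangian_gap k"
  using saddle_le[OF saddle xbreve_bspace[of k]] by (simp add: Lagrangian_gap_def resid_def)

text \<open>The Lyapunov function: Lagrangian gap, weighted distance to the saddle point, and the
  scaled residual that absorbs the product of residuals. The Lagrangian gap replaces the objective
  gap, which could be negative at infeasible points.\<close>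

definition potential :: "int \<Rightarrow> real" where
  "potential k = 2 * (Lagrangian_gap (k - 1) / (\<tau> (k - 1))\<^sup>2)
    + wnormsq (H0_mat m l \<gamma> \<beta>0 (weight k)) (vv k - v_stack m l A xs \<mu>s)
    + (1 - \<gamma>) * \<beta>0 * (resid (k - 1) \<bullet> resid (k - 1) / (\<tau> (k - 1))\<^sup>2)"

lemma potential_nonneg:
  assumes k: "0 \<le> k"
  shows "0 \<le> potential k"
proof -
  have t: "0 < \<tau> k" using tau_pos[of k] k by simp
  have c: "lambar k - \<mu>s \<in> carrier_vec l"
    using lambar_carrier[OF k] saddle_carrier[OF saddle] by auto
  have "0 \<le> weight k" using t \<beta>0 \<gamma> s2_nonneg by (simp add: weight_def)
  then have "0 \<le> wnormsq (H0_mat m l \<gamma> \<beta>0 (weight k)) (vv k - v_stack m l A xs \<mu>s)"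
    unfolding vv_minus_v_stack[OF k xs_bspace saddle_carrier[OF saddle]] wnormsq_H0_mat[OF tail_stack_carrier c]
    using \<beta>0 \<gamma> by (simp add: dot_self_nonneg)
  moreover have "0 \<le> Lagrangian_gap (k - 1)" using k by (intro Lagrangian_gap_nonneg) simp
  ultimately show ?thesis using \<gamma> \<beta>0 by (simp add: potential_def dot_self_nonneg)
qed

lemma u_inner_saddle:
  assumes k: "0 \<le> k"
  shows "u_inner m (u_diff (xs, \<mu>s) (xtilde k, lamtilde k)) (F_op m l A b (xtilde k, lamtilde k)) = \<mu>s \<bullet> tresid k"
proof -
  have "(\<Sum>j = 1..m. lamtilde k \<bullet> (A j *\<^sub>v xs j - A j *\<^sub>v xtilde k j))
      = (\<Sum>j = 1..m. lamtilde k \<bullet> (A j *\<^sub>v (xs j - xtilde k j)))"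
    using xs_bspace by (intro sum.cong) (auto simp: mult_mat_vec_linear[OF A_carrier] bspace_def xtilde_carrier k)
  also have "\<dots> = lamtilde k \<bullet> Amul m l A (\<lambda>j. xs j - xtilde k j)"
    by (rule Amul_dot[symmetric, OF A_carrier lamtilde_carrier[OF k]])
  also have "\<dots> = - (lamtilde k \<bullet> tresid k)"
    unfolding Amul_minus_feasible[OF k saddle_feasible[OF saddle]]
    using lamtilde_carrier[OF k] by (simp add: dot_linear)
  finally show ?thesis
    unfolding u_inner_F_op[OF k xs_bspace saddle_carrier[OF saddle]]
    using lamtilde_carrier[OF k] saddle_carrier[OF saddle] by (simp add: dot_linear)
qed

text \<open>The prediction inequality at the saddle point, scaled by
  \<open>2 / (\<tau> k)^2\<close>. There \<open>F\<close> contributes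
  \<open>\<mu>s \<bullet> tresid k\<close>, which the residual recursion distributes over the two
  objective gaps, making them Lagrangian gaps.\<close>

lemma saddle_prediction:
  assumes k: "0 \<le> k"
  defines "y \<equiv> v_stack m l A xs \<mu>s"
  shows "1 / \<tau> k * (wnormsq (H_k k) (vv (k + 1) - y) + 1 / L * (grad_gap k \<mu>s \<bullet> grad_gap k \<mu>s)
      - wnormsq (H_k k) (vv k - y) + wnormsq (G_k k) (vv k - vt k))
    \<le> 2 * (Lagrangian_gap (k - 1) / (\<tau> (k - 1))\<^sup>2) - 2 * (Lagrangian_gap k / (\<tau> k)\<^sup>2)
      - 2 * (cf k / \<tau> k) * (tresid k \<bullet> resid (k - 1))"
proof -
  have t: "0 < \<tau> k" "\<tau> k \<le> 1" using tau_pos[of k] tau_less_1[of k] k by auto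
  have xm: "xs m \<in> carrier_vec (n m)" using xs_bspace m_mem by (auto simp: bspace_def)
  define D V where "D = 1 / (2 * L) * (grad_gap k \<mu>s \<bullet> grad_gap k \<mu>s)"
    and "V = (y - vt k) \<bullet> (Q_k k *\<^sub>v (vv k - vt k))"
  have D: "f m (xbreve k m) + block_mult k m \<bullet> (A m *\<^sub>v (xs m - xbreve k m)) + D \<le> f m (xs m)"
    using xbreve_cocoercive[OF k xm] by (simp add: D_def grad_gap_eq[OF k])
  define C where "C = tresid k \<bullet> resid (k - 1)"
  have R: "Amul m l A (\<lambda>i. xs i - xtilde k i) \<bullet> resid (k - 1) = - C"
    unfolding Amul_minus_feasible[OF k saddle_feasible[OF saddle]] by (simp add: dot_linear C_def)
  have "\<tau> k * (\<mu>s \<bullet> tresid k) = \<mu>s \<bullet> resid k - (1 - \<tau> k) * (\<mu>s \<bullet> resid (k - 1))"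
    unfolding tresid_resid[OF k t(1)] using saddle_carrier[OF saddle] by (simp add: dot_linear)
  moreover have "\<tau> k * (V + D) \<le> \<tau> k * (\<mu>s \<bullet> tresid k + cf k * (- C))
      + (obj m f xs - obj m f (xbreve k)) - (1 - \<tau> k) * (obj m f xs - obj m f (xbreve (k - 1)))"
    using prediction[OF k t xs_bspace saddle_carrier[OF saddle] D]
    unfolding u_inner_saddle[OF k] R V_def y_def .
  ultimately have "\<tau> k * (V + D) \<le> (1 - \<tau> k) * Lagrangian_gap (k - 1) - Lagrangian_gap k - \<tau> k * cf k * C"
    by (simp add: Lagrangian_gap_def algebra_simps)
  then have "2 / (\<tau> k)\<^sup>2 * (\<tau> k * (V + D))
      \<le> 2 / (\<tau> k)\<^sup>2 * ((1 - \<tau> k) * Lagrangian_gap (k - 1) - Lagrangian_gap k - \<tau> k * cf k * C)"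
    by (intro mult_left_mono) auto
  also have "2 / (\<tau> k)\<^sup>2 * ((1 - \<tau> k) * Lagrangian_gap (k - 1) - Lagrangian_gap k - \<tau> k * cf k * C)
      = 2 * ((1 - \<tau> k) / (\<tau> k)\<^sup>2 * Lagrangian_gap (k - 1)) - 2 * (Lagrangian_gap k / (\<tau> k)\<^sup>2) - 2 * (cf k / \<tau> k) * C"
    using t by (simp add: power2_eq_square field_simps)
  also have "(1 - \<tau> k) / (\<tau> k)\<^sup>2 * Lagrangian_gap (k - 1) = Lagrangian_gap (k - 1) / (\<tau> (k - 1))\<^sup>2"
    unfolding tau_rec[OF k] by simp
  also have "2 / (\<tau> k)\<^sup>2 * (\<tau> k * (V + D)) = 1 / \<tau> k * (2 * V + 2 * D)"
    using t by (simp add: power2_eq_square field_simps)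
  also have "2 * V + 2 * D = wnormsq (H_k k) (vv (k + 1) - y) + 1 / L * (grad_gap k \<mu>s \<bullet> grad_gap k \<mu>s)
      - wnormsq (H_k k) (vv k - y) + wnormsq (G_k k) (vv k - vt k)"
  proof -
    have "2 * D = 1 / L * (grad_gap k \<mu>s \<bullet> grad_gap k \<mu>s)" by (simp add: D_def)
    moreover have "2 * V = wnormsq (H_k k) (vv (k + 1) - y) - wnormsq (H_k k) (vv k - y) + wnormsq (G_k k) (vv k - vt k)"
      unfolding V_def y_def by (rule correction_identity[OF k t(1) xs_bspace saddle_carrier[OF saddle]])
    ultimately show ?thesis by linarith
  qed
  finally show ?thesis unfolding C_def .
qed

lemma potential_step:
  assumes k: "0 \<le> k"
  shows "potential (k + 1) + decrease k * ((lambar (k + 1) - \<mu>s) \<bullet> (lambar (k + 1) - \<mu>s)) \<le> potential k"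
  using saddle_prediction[OF k] slack_ge[OF k saddle_carrier[OF saddle]] tresid_resid_dot[OF k]
  unfolding contraction_slack[OF k xs_bspace saddle_carrier[OF saddle]] potential_def
  by (simp add: right_diff_distrib)

lemma sum_decrease_le:
  "(\<Sum>i<K. decrease (int i) * ((lambar (int i + 1) - \<mu>s) \<bullet> (lambar (int i + 1) - \<mu>s))) \<le> potential 0"
proof -
  have "(\<Sum>i<K. decrease (int i) * ((lambar (int i + 1) - \<mu>s) \<bullet> (lambar (int i + 1) - \<mu>s))) + potential (int K) \<le> potential 0"
  proof (induction K)
    case (Suc K)
    then show ?case using potential_step[of "int K"] by (simp add: add.commute)
  qed simp
  then show ?thesis using potential_nonneg[of "int K"] by simp
qed

lemma eventually_decrease_ge:
  "eventually (\<lambda>i. rho / (\<gamma> * \<tau> (int i + 1)) \<le> 2 * rho / (s2 - rho) * decrease (int i)) sequentially"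
proof (rule eventually_sequentiallyI)
  \<comment> \<open>The threshold for \<open>1 / \<tau>\<close>: from \<open>X\<close> on,
    \<open>(s2 + rho) (a + 1) \<le> 2 s2 a\<close>. Since \<open>1 / \<tau>\<close> grows by at most
    1 per step, \<open>decrease\<close> then keeps at least half of its limiting coefficient
    \<open>(s2 - rho) / \<gamma>\<close>.\<close>
  define X where "X = (s2 + rho) / (s2 - rho)"
  have d: "0 < s2 - rho" using rho_less_s2 by simp
  fix i assume i: "nat \<lceil>X\<^sup>2\<rceil> \<le> i"
  define a a' where "a = 1 / \<tau> (int i)" and "a' = 1 / \<tau> (int i + 1)"
  have a: "0 < a" by (simp add: a_def tau_pos)
  have "X\<^sup>2 \<le> real i" using i by (simp add: nat_le_iff ceiling_le_iff)
  also have "\<dots> \<le> a\<^sup>2" unfolding a_def by (rule inverse_tau_square_ge)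
  finally have "X \<le> a" using a by (intro power2_le_imp_le[of X a]) auto
  then have "s2 + rho \<le> (s2 - rho) * a" using d by (simp add: X_def field_simps)
  then have "(s2 + rho) * (a + 1) \<le> 2 * s2 * a" by (simp add: algebra_simps)
  moreover have "(s2 + rho) * a' \<le> (s2 + rho) * (a + 1)"
    using inverse_tau_mono(2)[of "int i"] s2_nonneg rho_pos by (intro mult_left_mono) (auto simp: a_def a'_def)
  ultimately have "(s2 - rho) * a' \<le> 2 * (s2 * a - rho * a')" by (simp add: algebra_simps)
  then have "rho / (\<gamma> * (s2 - rho)) * ((s2 - rho) * a') \<le> rho / (\<gamma> * (s2 - rho)) * (2 * (s2 * a - rho * a'))"
    using d rho_pos \<gamma> by (intro mult_left_mono) auto
  moreover have "rho / (\<gamma> * (s2 - rho)) * ((s2 - rho) * a') = rho / (\<gamma> * \<tau> (int i + 1))"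
    using d by (simp add: a'_def)
  moreover have "rho / (\<gamma> * (s2 - rho)) * (2 * Y) = 2 * rho / (s2 - rho) * (Y / \<gamma>)" for Y
    by (simp add: mult.commute)
  moreover have "decrease (int i) = (s2 * a - rho * a') / \<gamma>" by (simp add: decrease_def a_def a'_def)
  ultimately show "rho / (\<gamma> * \<tau> (int i + 1)) \<le> 2 * rho / (s2 - rho) * decrease (int i)" by metis
qed

lemma summable_multiplier_error:
  "summable (\<lambda>i. rho / (\<gamma> * \<tau> (int i + 1)) * ((lambar (int i + 1) - \<mu>s) \<bullet> (lambar (int i + 1) - \<mu>s)))"
proof (rule summable_comparison_test_ev)
  let ?d = "\<lambda>i. decrease (int i) * ((lambar (int i + 1) - \<mu>s) \<bullet> (lambar (int i + 1) - \<mu>s))"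
  have "summable ?d"
    by (rule summableI_nonneg_bounded[OF _ sum_decrease_le]) (simp add: decrease_nonneg dot_self_nonneg)
  then show "summable (\<lambda>i. 2 * rho / (s2 - rho) * ?d i)" by (rule summable_mult)
  show "eventually (\<lambda>i. norm (rho / (\<gamma> * \<tau> (int i + 1)) * ((lambar (int i + 1) - \<mu>s) \<bullet> (lambar (int i + 1) - \<mu>s)))
      \<le> 2 * rho / (s2 - rho) * ?d i) sequentially"
    using eventually_decrease_ge
  proof (rule eventually_mono)
    fix i assume *: "rho / (\<gamma> * \<tau> (int i + 1)) \<le> 2 * rho / (s2 - rho) * decrease (int i)"
    let ?N = "(lambar (int i + 1) - \<mu>s) \<bullet> (lambar (int i + 1) - \<mu>s)"
    have nn: "0 \<le> rho / (\<gamma> * \<tau> (int i + 1)) * ?N"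
      using rho_pos \<gamma> tau_pos[of "int i + 1"] by (simp add: dot_self_nonneg)
    show "norm (rho / (\<gamma> * \<tau> (int i + 1)) * ?N) \<le> 2 * rho / (s2 - rho) * ?d i"
      using mult_right_mono[OF * dot_self_nonneg]
      unfolding real_norm_def abs_of_nonneg[OF nn] by (simp only: mult.assoc)
  qed
qed

end

lemma ex_Theta:
  "\<exists>\<Theta> :: int \<Rightarrow> real. (\<forall>k\<ge>0. 0 \<le> \<Theta> k) \<and> (\<forall>k\<ge>0. Theta_incr k \<le> \<Theta> (k + 1) - \<Theta> k)
    \<and> (\<forall>k\<ge>0. \<forall>xs \<mu>s. saddle_point m l n A b f xs \<mu>s \<longrightarrow> \<Theta> (k + 1) - \<Theta> k \<le> slack k \<mu>s)"
proof (cases "\<exists>xs \<mu>s. saddle_point m l n A b f xs \<mu>s")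
  case False
  \<comment> \<open>Without saddle points only the lower bounds on the increments remain, and
    absolute values meet them while keeping \<open>\<Theta>\<close> nonnegative.\<close>
  define \<Theta> where "\<Theta> k = (\<Sum>i<nat k. \<bar>Theta_incr (int i)\<bar>)" for k
  have "\<Theta> (k + 1) - \<Theta> k = \<bar>Theta_incr k\<bar>" if "0 \<le> k" for k
    using that by (simp add: \<Theta>_def nat_add_distrib)
  moreover have "0 \<le> \<Theta> k" for k by (simp add: \<Theta>_def sum_nonneg)
  ultimately show ?thesis using False by (intro exI[of _ \<Theta>]) auto
next
  case True
  then obtain xs \<mu>s where s: "saddle_point m l n A b f xs \<mu>s" by blast
  define err where "err i = rho / (\<gamma> * \<tau> (int i + 1)) * ((lambar (int i + 1) - \<mu>s) \<bullet> (lambar (int i + 1) - \<mu>s))" for i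
  have err: "0 \<le> err i" for i
    using rho_pos \<gamma> tau_pos[of "int i + 1"] by (simp add: err_def dot_self_nonneg)
  have sm: "summable err" unfolding err_def by (rule summable_multiplier_error[OF s])
  \<comment> \<open>Each \<open>slack\<close> is at least minus the corresponding
    \<open>err\<close>, so starting at the sum of the whole error series keeps every partial sum
    nonnegative.\<close>
  define \<Theta> where "\<Theta> k = (\<Sum>i. err i) + (\<Sum>i<nat k. slack (int i) \<mu>s)" for k
  have step: "\<Theta> (k + 1) - \<Theta> k = slack k \<mu>s" if "0 \<le> k" for k
    using that by (simp add: \<Theta>_def nat_add_distrib)
  have "0 \<le> \<Theta> k" for k
  proof -
    have "(\<Sum>i<nat k. - err i) \<le> (\<Sum>i<nat k. slack (int i) \<mu>s)"
      unfolding err_def by (intro sum_mono slack_ge_neg) simp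
    moreover have "(\<Sum>i<nat k. err i) \<le> (\<Sum>i. err i)"
      by (rule sum_le_suminf[OF sm]) (use err in auto)
    ultimately show ?thesis by (simp add: \<Theta>_def sum_negf)
  qed
  moreover have "Theta_incr k \<le> slack k \<mu>s" if "0 \<le> k" for k
  proof -
    have "0 \<le> decrease k * ((lambar (k + 1) - \<mu>s) \<bullet> (lambar (k + 1) - \<mu>s))"
      using decrease_nonneg[OF that] by (simp add: dot_self_nonneg)
    then show ?thesis using slack_ge[OF that saddle_carrier[OF s]] by linarith
  qed
  moreover have "\<mu> = \<mu>s" if "saddle_point m l n A b f x \<mu>" for x \<mu>
    using multiplier_unique[OF s that] .
  ultimately show ?thesis using step by (intro exI[of _ \<Theta>]) fastforce
qed

end

section \<open>Assembly of the two parts\<close>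

lemma wnormsq_one: "x \<in> carrier_vec p \<Longrightarrow> wnormsq (1\<^sub>m p) x = x \<bullet> x"
  by (simp add: wnormsq_def)

context algorithm3_run
begin

text \<open>Part (i) takes \<open>c = 1\<close>, part (ii) \<open>c = 1 / \<tau> k\<close>. In both
  cases the recursion for \<open>\<tau>\<close> turns \<open>c (1 - \<tau> k) / \<tau> k\<close>
  into the previous objective weight.\<close>

lemma prediction_scaled:
  assumes k: "0 \<le> k" and t: "0 < \<tau> k" "\<tau> k \<le> 1" and c: "0 < c" and x: "x \<in> bspace m n" and \<mu>: "\<mu> \<in> carrier_vec l"
    and D: "f m (xbreve k m) + block_mult k m \<bullet> (A m *\<^sub>v (x m - xbreve k m)) + D \<le> f m (x m)"
  shows "c * ((v_stack m l A x \<mu> - vt k) \<bullet> (Q_k k *\<^sub>v (vv k - vt k)) + D)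
    \<le> c * u_inner m (u_diff (x, \<mu>) (xtilde k, lamtilde k)) (F_op m l A b (xtilde k, lamtilde k))
      + c * cf k * (Amul m l A (\<lambda>i. x i - xtilde k i) \<bullet> resid (k - 1))
      + c / \<tau> k * (obj m f x - obj m f (xbreve k)) - c * ((1 - \<tau> k) / \<tau> k) * (obj m f x - obj m f (xbreve (k - 1)))"
proof -
  define V U R F F' where "V = (v_stack m l A x \<mu> - vt k) \<bullet> (Q_k k *\<^sub>v (vv k - vt k))"
    and "U = u_inner m (u_diff (x, \<mu>) (xtilde k, lamtilde k)) (F_op m l A b (xtilde k, lamtilde k))"
    and "R = Amul m l A (\<lambda>i. x i - xtilde k i) \<bullet> resid (k - 1)"
    and "F = obj m f x - obj m f (xbreve k)" and "F' = obj m f x - obj m f (xbreve (k - 1))"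
  have "\<tau> k * (V + D) \<le> \<tau> k * (U + cf k * R) + F - (1 - \<tau> k) * F'"
    unfolding V_def U_def R_def F_def F'_def by (rule prediction[OF k t x \<mu> D])
  then have "c / \<tau> k * (\<tau> k * (V + D)) \<le> c / \<tau> k * (\<tau> k * (U + cf k * R) + F - (1 - \<tau> k) * F')"
    using t c by (intro mult_left_mono) auto
  moreover have "c / \<tau> k * (\<tau> k * (V + D)) = c * (V + D)" using t by simp
  moreover have "c / \<tau> k * (\<tau> k * (U + cf k * R) + F - (1 - \<tau> k) * F')
      = c * U + c * cf k * R + c / \<tau> k * F - c * ((1 - \<tau> k) / \<tau> k) * F'"
    using t by (simp add: field_simps)
  ultimately show ?thesis unfolding V_def U_def R_def F_def F'_def by linarith
qed

text \<open>In part (i) positivity propagates from \<open>\<tau> (-1)\<close>: a positive quotient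
  \<open>(1 - \<tau>) / \<tau>\<close> needs equal signs, and both cannot be negative.\<close>

lemma reciprocal_penalty_tau_bounds:
  assumes rec: "\<forall>k\<ge>0. 1 / \<tau> (k - 1) = (1 - \<tau> k) / \<tau> k" and init: "0 < \<tau> (-1)" and k: "-1 \<le> k"
  shows "0 < \<tau> k \<and> (0 \<le> k \<longrightarrow> \<tau> k \<le> 1)"
  using k
proof (induction k rule: int_ge_induct)
  case base
  then show ?case using init by simp
next
  case (step i)
  have e: "1 / \<tau> i = (1 - \<tau> (i + 1)) / \<tau> (i + 1)" using rec[rule_format, of "i + 1"] step by simp
  have p: "0 < 1 / \<tau> i" using step by simp
  then have "0 < \<tau> (i + 1) \<and> 0 < 1 - \<tau> (i + 1) \<or> \<tau> (i + 1) < 0 \<and> 1 - \<tau> (i + 1) < 0"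
    unfolding e by (auto simp: zero_less_divide_iff)
  then show ?case by auto
qed

lemma xbreve_subgradient_last:
  assumes "0 \<le> k" "0 < \<tau> k" "x \<in> bspace m n"
  shows "f m (xbreve k m) + block_mult k m \<bullet> (A m *\<^sub>v (x m - xbreve k m)) + 0 \<le> f m (x m)"
  using xbreve_subgradient[OF assms(1,2), of m "x m"] assms(3) m2 by (simp add: bspace_def)

lemma reciprocal_penalty_result:
  assumes \<beta>0: "0 < \<beta>0" and \<beta>: "\<forall>k\<ge>0. \<beta> k = \<beta>0 / \<tau> k"
    and rec: "\<forall>k\<ge>0. 1 / \<tau> (k - 1) = (1 - \<tau> k) / \<tau> k" and init: "0 < \<tau> (-1)"
  shows "\<lbrakk>0 \<le> k; x \<in> bspace m n; \<mu> \<in> carrier_vec l\<rbrakk> \<Longrightarrow>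
      (v_stack m l A x \<mu> - vt k) \<bullet> (Q_k k *\<^sub>v (vv k - vt k)) \<le>
      1 / \<tau> k * (obj m f x - obj m f (xbreve k))
      - 1 / \<tau> (k - 1) * (obj m f x - obj m f (xbreve (k - 1)))
      + u_inner m (u_diff (x, \<mu>) (xtilde k, lamtilde k)) (F_op m l A b (xtilde k, lamtilde k))
      + (1 - \<gamma>) * (1 - \<tau> k) * \<beta> k
        * (Amul m l A (\<lambda>i. x i - xtilde k i) \<bullet> (Amul m l A (xbreve (k - 1)) - b))"
    and "0 \<le> k \<Longrightarrow> vv (k + 1) = vv k - M_k k *\<^sub>v (vv k - vt k)"
    and "\<exists>(H :: int \<Rightarrow> real mat) (\<Theta> :: int \<Rightarrow> real).
      (\<forall>k\<ge>0. H k \<in> carrier_mat (m * l) (m * l) \<and> Q_k k = H k * M_k k)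
      \<and> (\<forall>k\<ge>0. \<Theta> k \<ge> 0)
      \<and> (\<forall>k\<ge>0. \<Theta> (k + 1) - \<Theta> k \<ge> (1 - \<gamma>) * \<tau> k * \<beta> k * (vnorm (Amul m l A (xtilde k) - b))\<^sup>2)
      \<and> (\<forall>k\<ge>0. \<forall>v'.
           wnormsq (H k) (vv (k + 1) - v') - wnormsq (H k) (vv k - v')
           + wnormsq (G_mat (Q_k k) (M_k k) (H k)) (vv k - vt k)
           \<ge> wnormsq (H0_mat m l \<gamma> \<beta>0 (1 / \<beta>0)) (vv (k + 1) - v')
             - wnormsq (H0_mat m l \<gamma> \<beta>0 (1 / \<beta>0)) (vv k - v') + \<Theta> (k + 1) - \<Theta> k)"
proof -
  have t: "0 < \<tau> k" "\<tau> k \<le> 1" if "0 \<le> k" for k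
    using reciprocal_penalty_tau_bounds[OF rec init, of k] that by auto
  show "0 \<le> k \<Longrightarrow> vv (k + 1) = vv k - M_k k *\<^sub>v (vv k - vt k)"
    by (rule vv_step) (use t in auto)
  show "(v_stack m l A x \<mu> - vt k) \<bullet> (Q_k k *\<^sub>v (vv k - vt k)) \<le>
      1 / \<tau> k * (obj m f x - obj m f (xbreve k))
      - 1 / \<tau> (k - 1) * (obj m f x - obj m f (xbreve (k - 1)))
      + u_inner m (u_diff (x, \<mu>) (xtilde k, lamtilde k)) (F_op m l A b (xtilde k, lamtilde k))
      + (1 - \<gamma>) * (1 - \<tau> k) * \<beta> k
        * (Amul m l A (\<lambda>i. x i - xtilde k i) \<bullet> (Amul m l A (xbreve (k - 1)) - b))"
    if k: "0 \<le> k" and x: "x \<in> bspace m n" and \<mu>: "\<mu> \<in> carrier_vec l"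
    using prediction_scaled[where c = 1 and x = x and D = 0, OF k t[OF k] _ x \<mu> xbreve_subgradient_last[OF k t(1)[OF k] x]]
    unfolding rec[rule_format, OF k] resid_def cf_def by simp
  \<comment> \<open>This constancy makes \<open>H_k k\<close> equal to \<open>H_0\<close> for every
    \<open>k\<close>, so the distance terms cancel for any \<open>v'\<close> and only
    \<open>G\<close> against the increment of \<open>\<Theta>\<close> remains.\<close>
  have tb: "\<tau> k * \<beta> k = \<beta>0" if "0 \<le> k" for k using \<beta> t(1)[OF that] that by simp
  define g where "g i = (1 - \<gamma>) * \<beta>0 * (tresid (int i) \<bullet> tresid (int i))" for i
  define \<Theta> where "\<Theta> k = (\<Sum>i<nat k. g i)" for k
  have step: "\<Theta> (k + 1) - \<Theta> k = (1 - \<gamma>) * \<beta>0 * (tresid k \<bullet> tresid k)" if "0 \<le> k" for k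
    using that by (simp add: \<Theta>_def g_def nat_add_distrib)
  have G: "(1 - \<gamma>) * \<beta>0 * (tresid k \<bullet> tresid k) \<le> wnormsq (G_k k) (vv k - vt k)" if "0 \<le> k" for k
    using wnormsq_G_ge[OF that t(1)[OF that]] tb[OF that] by (simp add: mult.assoc)
  show "\<exists>(H :: int \<Rightarrow> real mat) (\<Theta> :: int \<Rightarrow> real).
      (\<forall>k\<ge>0. H k \<in> carrier_mat (m * l) (m * l) \<and> Q_k k = H k * M_k k)
      \<and> (\<forall>k\<ge>0. \<Theta> k \<ge> 0)
      \<and> (\<forall>k\<ge>0. \<Theta> (k + 1) - \<Theta> k \<ge> (1 - \<gamma>) * \<tau> k * \<beta> k * (vnorm (Amul m l A (xtilde k) - b))\<^sup>2)
      \<and> (\<forall>k\<ge>0. \<forall>v'.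
           wnormsq (H k) (vv (k + 1) - v') - wnormsq (H k) (vv k - v')
           + wnormsq (G_mat (Q_k k) (M_k k) (H k)) (vv k - vt k)
           \<ge> wnormsq (H0_mat m l \<gamma> \<beta>0 (1 / \<beta>0)) (vv (k + 1) - v')
             - wnormsq (H0_mat m l \<gamma> \<beta>0 (1 / \<beta>0)) (vv k - v') + \<Theta> (k + 1) - \<Theta> k)"
  proof (intro exI[of _ H_k] exI[of _ \<Theta>] conjI allI impI)
    fix k :: int assume k: "0 \<le> k"
    show "H_k k \<in> carrier_mat (m * l) (m * l)" "Q_k k = H_k k * M_k k"
      by (rule H_k_factorization[OF k t(1)[OF k]])+
    show "0 \<le> \<Theta> k" unfolding \<Theta>_def g_def using \<gamma> \<beta>0 by (intro sum_nonneg) (simp add: dot_self_nonneg)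
    show "(1 - \<gamma>) * \<tau> k * \<beta> k * (vnorm (Amul m l A (xtilde k) - b))\<^sup>2 \<le> \<Theta> (k + 1) - \<Theta> k"
      unfolding step[OF k] vnorm_sq tresid_def[symmetric] using tb[OF k] by (simp add: mult.assoc)
    show "wnormsq (H0_mat m l \<gamma> \<beta>0 (1 / \<beta>0)) (vv (k + 1) - v')
             - wnormsq (H0_mat m l \<gamma> \<beta>0 (1 / \<beta>0)) (vv k - v') + \<Theta> (k + 1) - \<Theta> k
        \<le> wnormsq (H_k k) (vv (k + 1) - v') - wnormsq (H_k k) (vv k - v')
           + wnormsq (G_k k) (vv k - vt k)" for v'
      using G[OF k] step[OF k] unfolding tb[OF k] by linarith
  qed
qed

end

context algorithm3_lipschitz
begin

lemma constant_penalty_result: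
  shows "\<lbrakk>0 \<le> k; x \<in> bspace m n; \<mu> \<in> carrier_vec l\<rbrakk> \<Longrightarrow>
      1 / \<tau> k * ((v_stack m l A x \<mu> - vt k) \<bullet> (Q_k k *\<^sub>v (vv k - vt k))
          + (1 / L) / 2 * wnormsq (1\<^sub>m (n m))
              (gradient (n m) (f m) (xbreve k m) - gradient (n m) (f m) (x m))) \<le>
      1 / (\<tau> k)\<^sup>2 * (obj m f x - obj m f (xbreve k))
      - 1 / (\<tau> (k - 1))\<^sup>2 * (obj m f x - obj m f (xbreve (k - 1)))
      + 1 / \<tau> k * u_inner m (u_diff (x, \<mu>) (xtilde k, lamtilde k)) (F_op m l A b (xtilde k, lamtilde k))
      + (1 - \<gamma>) * (1 - \<tau> k) * \<beta> k / \<tau> k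
        * (Amul m l A (\<lambda>i. x i - xtilde k i) \<bullet> (Amul m l A (xbreve (k - 1)) - b))"
    and "0 \<le> k \<Longrightarrow> vv (k + 1) = vv k - M_k k *\<^sub>v (vv k - vt k)"
    and "\<exists>(H :: int \<Rightarrow> real mat) (\<Theta> :: int \<Rightarrow> real).
      (\<forall>k\<ge>0. H k \<in> carrier_mat (m * l) (m * l) \<and> Q_k k = H k * M_k k)
      \<and> (\<forall>k\<ge>0. \<Theta> k \<ge> 0)
      \<and> (\<forall>k\<ge>0. \<Theta> (k + 1) - \<Theta> k
           \<ge> (1 - \<gamma>) * \<beta> k * ((vnorm (Amul m l A (xtilde k) - b))\<^sup>2
               - \<tau> k / (\<tau> (k - 1))\<^sup>2 * (vnorm (Amul m l A (xbreve (k - 1)) - b))\<^sup>2))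
      \<and> (\<forall>k\<ge>0. \<forall>xs \<mu>s. saddle_point m l n A b f xs \<mu>s \<longrightarrow>
           1 / \<tau> k * (wnormsq (H k) (vv (k + 1) - v_stack m l A xs \<mu>s)
             + 1 / L * wnormsq (1\<^sub>m (n m))
                 (gradient (n m) (f m) (xbreve k m) - gradient (n m) (f m) (xs m))
             - wnormsq (H k) (vv k - v_stack m l A xs \<mu>s)
             + wnormsq (G_mat (Q_k k) (M_k k) (H k)) (vv k - vt k))
           \<ge> wnormsq (H0_mat m l \<gamma> \<beta>0 (weight (k + 1))) (vv (k + 1) - v_stack m l A xs \<mu>s)
             - wnormsq (H0_mat m l \<gamma> \<beta>0 (weight k)) (vv k - v_stack m l A xs \<mu>s) + \<Theta> (k + 1) - \<Theta> k)"
proof -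
  have t: "0 < \<tau> k" "\<tau> k \<le> 1" if "0 \<le> k" for k
    using tau_pos[of k] tau_less_1[of k] that by auto
  have gc: "gradient (n m) (f m) z \<in> carrier_vec (n m)" if "z \<in> carrier_vec (n m)" for z
    using gradient_lipschitz_has_gradient[OF lip that] by (simp add: has_gradient_def)
  have xm: "x m \<in> carrier_vec (n m)" if "x \<in> bspace m n" for x
    using that m_mem by (auto simp: bspace_def)
  have wz: "wnormsq (1\<^sub>m (n m)) (gradient (n m) (f m) (xbreve k m) - gradient (n m) (f m) (x m))
      = (gradient (n m) (f m) (xbreve k m) - gradient (n m) (f m) (x m)) \<bullet> (gradient (n m) (f m) (xbreve k m) - gradient (n m) (f m) (x m))"
    if "0 \<le> k" "x \<in> bspace m n" for k x
    using gc xm[OF that(2)] xm[OF xbreve_bspace[of k]] that by (intro wnormsq_one) auto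
  show "0 \<le> k \<Longrightarrow> vv (k + 1) = vv k - M_k k *\<^sub>v (vv k - vt k)"
    by (rule vv_step) (use t in auto)
  show "1 / \<tau> k * ((v_stack m l A x \<mu> - vt k) \<bullet> (Q_k k *\<^sub>v (vv k - vt k))
          + (1 / L) / 2 * wnormsq (1\<^sub>m (n m))
              (gradient (n m) (f m) (xbreve k m) - gradient (n m) (f m) (x m))) \<le>
      1 / (\<tau> k)\<^sup>2 * (obj m f x - obj m f (xbreve k))
      - 1 / (\<tau> (k - 1))\<^sup>2 * (obj m f x - obj m f (xbreve (k - 1)))
      + 1 / \<tau> k * u_inner m (u_diff (x, \<mu>) (xtilde k, lamtilde k)) (F_op m l A b (xtilde k, lamtilde k))
      + (1 - \<gamma>) * (1 - \<tau> k) * \<beta> k / \<tau> k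
        * (Amul m l A (\<lambda>i. x i - xtilde k i) \<bullet> (Amul m l A (xbreve (k - 1)) - b))"
    if k: "0 \<le> k" and x: "x \<in> bspace m n" and \<mu>: "\<mu> \<in> carrier_vec l"
  proof -
    have c: "0 < 1 / \<tau> k" using t[OF k] by simp
    have e1: "1 / \<tau> k / \<tau> k = 1 / (\<tau> k)\<^sup>2" by (simp add: power2_eq_square)
    \<comment> \<open>With the additional factor \<open>1 / \<tau> k\<close> the quadratic recursion
      produces the telescoping weight.\<close>
    have e2: "1 / \<tau> k * ((1 - \<tau> k) / \<tau> k) = 1 / (\<tau> (k - 1))\<^sup>2"
      unfolding tau_rec[OF k, symmetric] by (simp add: power2_eq_square)
    have e3: "1 / \<tau> k * cf k = (1 - \<gamma>) * (1 - \<tau> k) * \<beta> k / \<tau> k" by (simp add: cf_def)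
    show ?thesis
      using prediction_scaled[OF k t[OF k] c x \<mu> xbreve_cocoercive[OF k xm[OF x]]]
      unfolding e1 e2 e3 resid_def wz[OF k x] by (simp add: mult.commute)
  qed
  obtain \<Theta> :: "int \<Rightarrow> real" where \<Theta>: "\<And>k. 0 \<le> k \<Longrightarrow> 0 \<le> \<Theta> k" "\<And>k. 0 \<le> k \<Longrightarrow> Theta_incr k \<le> \<Theta> (k + 1) - \<Theta> k"
    "\<And>k xs \<mu>s. 0 \<le> k \<Longrightarrow> saddle_point m l n A b f xs \<mu>s \<Longrightarrow> \<Theta> (k + 1) - \<Theta> k \<le> slack k \<mu>s"
    using ex_Theta by blast
  show "\<exists>(H :: int \<Rightarrow> real mat) (\<Theta> :: int \<Rightarrow> real).
      (\<forall>k\<ge>0. H k \<in> carrier_mat (m * l) (m * l) \<and> Q_k k = H k * M_k k)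
      \<and> (\<forall>k\<ge>0. \<Theta> k \<ge> 0)
      \<and> (\<forall>k\<ge>0. \<Theta> (k + 1) - \<Theta> k
           \<ge> (1 - \<gamma>) * \<beta> k * ((vnorm (Amul m l A (xtilde k) - b))\<^sup>2
               - \<tau> k / (\<tau> (k - 1))\<^sup>2 * (vnorm (Amul m l A (xbreve (k - 1)) - b))\<^sup>2))
      \<and> (\<forall>k\<ge>0. \<forall>xs \<mu>s. saddle_point m l n A b f xs \<mu>s \<longrightarrow>
           1 / \<tau> k * (wnormsq (H k) (vv (k + 1) - v_stack m l A xs \<mu>s)
             + 1 / L * wnormsq (1\<^sub>m (n m))
                 (gradient (n m) (f m) (xbreve k m) - gradient (n m) (f m) (xs m))
             - wnormsq (H k) (vv k - v_stack m l A xs \<mu>s)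
             + wnormsq (G_mat (Q_k k) (M_k k) (H k)) (vv k - vt k))
           \<ge> wnormsq (H0_mat m l \<gamma> \<beta>0 (weight (k + 1))) (vv (k + 1) - v_stack m l A xs \<mu>s)
             - wnormsq (H0_mat m l \<gamma> \<beta>0 (weight k)) (vv k - v_stack m l A xs \<mu>s) + \<Theta> (k + 1) - \<Theta> k)"
  proof (intro exI[of _ H_k] exI[of _ \<Theta>] conjI allI impI)
    fix k :: int assume k: "0 \<le> k"
    show "H_k k \<in> carrier_mat (m * l) (m * l)" "Q_k k = H_k k * M_k k"
      by (rule H_k_factorization[OF k t(1)[OF k]])+
    show "0 \<le> \<Theta> k" by (rule \<Theta>(1)[OF k])
    show "(1 - \<gamma>) * \<beta> k * ((vnorm (Amul m l A (xtilde k) - b))\<^sup>2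
               - \<tau> k / (\<tau> (k - 1))\<^sup>2 * (vnorm (Amul m l A (xbreve (k - 1)) - b))\<^sup>2) \<le> \<Theta> (k + 1) - \<Theta> k"
      using \<Theta>(2)[OF k] \<beta>_eq k by (simp add: vnorm_sq Theta_incr_def tresid_def resid_def)
    show "wnormsq (H0_mat m l \<gamma> \<beta>0 (weight (k + 1))) (vv (k + 1) - v_stack m l A xs \<mu>s)
             - wnormsq (H0_mat m l \<gamma> \<beta>0 (weight k)) (vv k - v_stack m l A xs \<mu>s) + \<Theta> (k + 1) - \<Theta> k
      \<le> 1 / \<tau> k * (wnormsq (H_k k) (vv (k + 1) - v_stack m l A xs \<mu>s)
             + 1 / L * wnormsq (1\<^sub>m (n m))
                 (gradient (n m) (f m) (xbreve k m) - gradient (n m) (f m) (xs m))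
             - wnormsq (H_k k) (vv k - v_stack m l A xs \<mu>s) + wnormsq (G_k k) (vv k - vt k))"
      if s: "saddle_point m l n A b f xs \<mu>s" for xs \<mu>s
      unfolding wz[OF k xs_bspace[OF s]]
      unfolding grad_gap_eq[OF s k]
        contraction_slack[OF k xs_bspace[OF s] saddle_carrier[OF s]]
      using \<Theta>(3)[OF k s] by linarith
  qed
qed

end

theorem theorem5p4:
  fixes m l :: nat and n :: "nat \<Rightarrow> nat"
    and A :: "nat \<Rightarrow> real mat" and b :: "real vec" and f :: "nat \<Rightarrow> real vec \<Rightarrow> real"
    and \<gamma> :: real and \<tau> \<beta> :: "int \<Rightarrow> real"
    and xhat xbreve xtilde xbar :: "int \<Rightarrow> nat \<Rightarrow> real vec"
    and lam lambar lamtilde :: "int \<Rightarrow> real vec"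
    and utilde :: "int \<Rightarrow> (nat \<Rightarrow> real vec) \<times> real vec"
    and v vtilde :: "int \<Rightarrow> real vec"
    and Q M :: "int \<Rightarrow> real mat"
  assumes "problem_P3 m l n A b f"
    and "0 < \<gamma>" and "\<gamma> \<le> 1"
    and "algorithm3 m l n A b f \<gamma> \<tau> \<beta> xhat xbreve xtilde xbar lam"
    and "\<forall>k\<ge>0. lambar k = lam k - (\<gamma> * (1 - \<tau> k) * \<beta> k) \<cdot>\<^sub>v (Amul m l A (xbreve (k - 1)) - b)"
    and "\<forall>k\<ge>0. lamtilde k = lambar k
           - (\<tau> k * \<beta> k) \<cdot>\<^sub>v (A 1 *\<^sub>v xtilde k 1 + Asum {2..m} l A (xbar k) - b)"
    and "\<forall>k\<ge>0. utilde k = (xtilde k, lamtilde k)"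
    and "\<forall>k\<ge>0. v k = v_stack m l A (xbar k) (lambar k)"
    and "\<forall>k\<ge>0. vtilde k = v_stack m l A (xtilde k) (lamtilde k)"
    and "\<forall>k\<ge>0. Q k = Q_mat m l (\<tau> k) (\<beta> k)"
    and "\<forall>k\<ge>0. M k = M_mat m l \<gamma> (\<tau> k) (\<beta> k)"
  shows
    "(\<forall>\<beta>0. 0 < \<beta>0 \<and> (\<forall>k\<ge>0. \<beta> k = \<beta>0 / \<tau> k)
        \<and> (\<forall>k\<ge>0. 1 / \<tau> (k - 1) = (1 - \<tau> k) / \<tau> k) \<and> 0 < \<tau> (-1) \<and> \<tau> (-1) < 1 \<longrightarrow>
        (\<forall>k\<ge>0.
           (\<forall>x\<in>bspace m n. \<forall>\<mu>\<in>carrier_vec l.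
              1 / \<tau> k * (obj m f x - obj m f (xbreve k))
              - 1 / \<tau> (k - 1) * (obj m f x - obj m f (xbreve (k - 1)))
              + u_inner m (u_diff (x, \<mu>) (utilde k)) (F_op m l A b (utilde k))
              + (1 - \<gamma>) * (1 - \<tau> k) * \<beta> k
                * (Amul m l A (\<lambda>i. x i - xtilde k i) \<bullet> (Amul m l A (xbreve (k - 1)) - b))
              \<ge> (v_stack m l A x \<mu> - vtilde k) \<bullet> (Q k *\<^sub>v (v k - vtilde k)))
           \<and> v (k + 1) = v k - M k *\<^sub>v (v k - vtilde k))
        \<and> (\<exists>(H :: int \<Rightarrow> real mat) (\<Theta> :: int \<Rightarrow> real).
             (\<forall>k\<ge>0. H k \<in> carrier_mat (m * l) (m * l) \<and> Q k = H k * M k)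
             \<and> (\<forall>k\<ge>0. \<Theta> k \<ge> 0)
             \<and> (\<forall>k\<ge>0. \<Theta> (k + 1) - \<Theta> k
                  \<ge> (1 - \<gamma>) * \<tau> k * \<beta> k * (vnorm (Amul m l A (xtilde k) - b))\<^sup>2)
             \<and> (\<forall>k\<ge>0. \<forall>x'\<in>feasible m l n A b. \<forall>\<mu>\<in>carrier_vec l. \<forall>v'.
                  v' = v_stack m l A x' \<mu> \<longrightarrow>
                  wnormsq (H k) (v (k + 1) - v') - wnormsq (H k) (v k - v')
                  + wnormsq (G_mat (Q k) (M k) (H k)) (v k - vtilde k)
                  \<ge> wnormsq (H0_mat m l \<gamma> \<beta>0 (1 / \<beta>0)) (v (k + 1) - v')
                    - wnormsq (H0_mat m l \<gamma> \<beta>0 (1 / \<beta>0)) (v k - v')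
                    + \<Theta> (k + 1) - \<Theta> k)))
     \<and>
     (\<forall>\<beta>0 L. gradient_lipschitz (n m) L (f m) \<and> 0 < \<beta>0 \<and> (\<forall>k\<ge>0. \<beta> k = \<beta>0) \<and> (1 - \<gamma>) * \<beta>0 \<le> 1
        \<and> (\<forall>k\<ge>0. \<tau> k > 0)
        \<and> (\<forall>k\<ge>0. 1 / (\<tau> (k - 1))\<^sup>2 = (1 - \<tau> k) / (\<tau> k)\<^sup>2) \<and> 0 < \<tau> (-1) \<and> \<tau> (-1) < 1
        \<and> (\<forall>k\<ge>0. 1 / (\<beta>0 * (\<tau> k)\<^sup>2) + sigma2 (A m) L / \<tau> k
             \<ge> 1 / (\<beta>0 * (\<tau> (k + 1))\<^sup>2) + sigma2 (A m) L * (1 - \<gamma>) / \<tau> (k + 1)) \<longrightarrow>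
        (\<forall>k\<ge>0.
           (\<forall>x\<in>bspace m n. \<forall>\<mu>\<in>carrier_vec l.
              1 / (\<tau> k)\<^sup>2 * (obj m f x - obj m f (xbreve k))
              - 1 / (\<tau> (k - 1))\<^sup>2 * (obj m f x - obj m f (xbreve (k - 1)))
              + 1 / \<tau> k * u_inner m (u_diff (x, \<mu>) (utilde k)) (F_op m l A b (utilde k))
              + (1 - \<gamma>) * (1 - \<tau> k) * \<beta> k / \<tau> k
                * (Amul m l A (\<lambda>i. x i - xtilde k i) \<bullet> (Amul m l A (xbreve (k - 1)) - b))
              \<ge> 1 / \<tau> k * ((v_stack m l A x \<mu> - vtilde k) \<bullet> (Q k *\<^sub>v (v k - vtilde k))
                  + (1 / L) / 2 * wnormsq (1\<^sub>m (n m))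
                      (gradient (n m) (f m) (xbreve k m) - gradient (n m) (f m) (x m))))
           \<and> v (k + 1) = v k - M k *\<^sub>v (v k - vtilde k))
        \<and> (\<exists>(H :: int \<Rightarrow> real mat) (\<Theta> :: int \<Rightarrow> real).
             (\<forall>k\<ge>0. H k \<in> carrier_mat (m * l) (m * l) \<and> Q k = H k * M k)
             \<and> (\<forall>k\<ge>0. \<Theta> k \<ge> 0)
             \<and> (\<forall>k\<ge>0. \<Theta> (k + 1) - \<Theta> k
                  \<ge> (1 - \<gamma>) * \<beta> k * ((vnorm (Amul m l A (xtilde k) - b))\<^sup>2
                      - \<tau> k / (\<tau> (k - 1))\<^sup>2 * (vnorm (Amul m l A (xbreve (k - 1)) - b))\<^sup>2))
             \<and> (\<forall>k\<ge>0. \<forall>xs \<mu>s v' H0. saddle_point m l n A b f xs \<mu>s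
                  \<and> v' = v_stack m l A xs \<mu>s
                  \<and> H0 = (\<lambda>k. H0_mat m l \<gamma> \<beta>0
                            (1 / (\<beta>0 * (\<tau> k)\<^sup>2) + sigma2 (A m) L * (1 - \<gamma>) / \<tau> k)) \<longrightarrow>
                  1 / \<tau> k * (wnormsq (H k) (v (k + 1) - v')
                    + 1 / L * wnormsq (1\<^sub>m (n m))
                        (gradient (n m) (f m) (xbreve k m) - gradient (n m) (f m) (xs m))
                    - wnormsq (H k) (v k - v')
                    + wnormsq (G_mat (Q k) (M k) (H k)) (v k - vtilde k))
                  \<ge> wnormsq (H0 (k + 1)) (v (k + 1) - v') - wnormsq (H0 k) (v k - v')
                    + \<Theta> (k + 1) - \<Theta> k)))"
proof -
  interpret algorithm3_run m l n A b f \<gamma> \<tau> \<beta> xhat xbreve xtilde xbar lam lambar lamtilde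
    by unfold_locales (use assms in auto)
  have eqs: "v k = vv k" "vtilde k = vt k" "utilde k = (xtilde k, lamtilde k)" "Q k = Q_k k" "M k = M_k k"
    if "0 \<le> k" for k
    using assms that by (auto simp: vv_def vt_def)
  \<comment> \<open>The defining equations of the named sequences are available only at nonnegative
    counters, so the shifted one is instantiated separately.\<close>
  have eq1: "v (k + 1) = vv (k + 1)" if "0 \<le> k" for k using eqs(1)[of "k + 1"] that by simp
  show ?thesis
  proof (intro conjI allI impI, goal_cases)
    case (1 \<beta>0 k)
    then show ?case
      by (intro ballI, elim conjE, unfold eqs[OF 1(2)]) (rule reciprocal_penalty_result(1))
  next
    case (2 \<beta>0 k)
    then show ?case
      by (elim conjE, unfold eqs[OF 2(2)] eq1[OF 2(2)]) (rule reciprocal_penalty_result(2))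
  next
    case (3 \<beta>0)
    then obtain H :: "int \<Rightarrow> real mat" and \<Theta> :: "int \<Rightarrow> real"
      where *: "\<forall>k\<ge>0. H k \<in> carrier_mat (m * l) (m * l) \<and> Q_k k = H k * M_k k"
        "\<forall>k\<ge>0. \<Theta> k \<ge> 0"
        "\<forall>k\<ge>0. \<Theta> (k + 1) - \<Theta> k \<ge> (1 - \<gamma>) * \<tau> k * \<beta> k * (vnorm (Amul m l A (xtilde k) - b))\<^sup>2"
        "\<forall>k\<ge>0. \<forall>v'.
           wnormsq (H k) (vv (k + 1) - v') - wnormsq (H k) (vv k - v')
           + wnormsq (G_mat (Q_k k) (M_k k) (H k)) (vv k - vt k)
           \<ge> wnormsq (H0_mat m l \<gamma> \<beta>0 (1 / \<beta>0)) (vv (k + 1) - v')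
             - wnormsq (H0_mat m l \<gamma> \<beta>0 (1 / \<beta>0)) (vv k - v') + \<Theta> (k + 1) - \<Theta> k"
      using reciprocal_penalty_result(3)[of \<beta>0] by metis
    show ?case
    proof (intro exI[of _ H] exI[of _ \<Theta>] conjI allI ballI impI, goal_cases)
      case (5 k)
      \<comment> \<open>The estimate was proved for every \<open>v'\<close>, in particular for
        stacks of feasible points.\<close>
      then show ?case using *(4) unfolding eqs[OF 5(1)] eq1[OF 5(1)] by blast
    qed (use * eqs in auto)
  next
    case (4 \<beta>0 L k)
    interpret algorithm3_lipschitz m l n A b f \<gamma> \<tau> \<beta> xhat xbreve xtilde xbar lam lambar lamtilde \<beta>0 L
      by unfold_locales (use 4 in auto)
    show ?case
      by (intro ballI, unfold eqs[OF 4(2)]) (rule constant_penalty_result(1)[OF 4(2)])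
  next
    case (5 \<beta>0 L k)
    interpret algorithm3_lipschitz m l n A b f \<gamma> \<tau> \<beta> xhat xbreve xtilde xbar lam lambar lamtilde \<beta>0 L
      by unfold_locales (use 5 in auto)
    show ?case unfolding eqs[OF 5(2)] eq1[OF 5(2)] by (rule constant_penalty_result(2)[OF 5(2)])
  next
    case (6 \<beta>0 L)
    interpret algorithm3_lipschitz m l n A b f \<gamma> \<tau> \<beta> xhat xbreve xtilde xbar lam lambar lamtilde \<beta>0 L
      by unfold_locales (use 6 in auto)
    obtain H :: "int \<Rightarrow> real mat" and \<Theta> :: "int \<Rightarrow> real"
      where *: "\<forall>k\<ge>0. H k \<in> carrier_mat (m * l) (m * l) \<and> Q_k k = H k * M_k k"
        "\<forall>k\<ge>0. \<Theta> k \<ge> 0"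
        "\<forall>k\<ge>0. \<Theta> (k + 1) - \<Theta> k
           \<ge> (1 - \<gamma>) * \<beta> k * ((vnorm (Amul m l A (xtilde k) - b))\<^sup>2
               - \<tau> k / (\<tau> (k - 1))\<^sup>2 * (vnorm (Amul m l A (xbreve (k - 1)) - b))\<^sup>2)"
        "\<forall>k\<ge>0. \<forall>xs \<mu>s. saddle_point m l n A b f xs \<mu>s \<longrightarrow>
           1 / \<tau> k * (wnormsq (H k) (vv (k + 1) - v_stack m l A xs \<mu>s)
             + 1 / L * wnormsq (1\<^sub>m (n m))
                 (gradient (n m) (f m) (xbreve k m) - gradient (n m) (f m) (xs m))
             - wnormsq (H k) (vv k - v_stack m l A xs \<mu>s)
             + wnormsq (G_mat (Q_k k) (M_k k) (H k)) (vv k - vt k))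
           \<ge> wnormsq (H0_mat m l \<gamma> \<beta>0 (weight (k + 1))) (vv (k + 1) - v_stack m l A xs \<mu>s)
             - wnormsq (H0_mat m l \<gamma> \<beta>0 (weight k)) (vv k - v_stack m l A xs \<mu>s) + \<Theta> (k + 1) - \<Theta> k"
      using constant_penalty_result(3) by blast
    show ?case
    proof (intro exI[of _ H] exI[of _ \<Theta>] conjI allI ballI impI, goal_cases)
      case (5 k xs \<mu>s v' H0)
      then show ?case using *(4) unfolding eqs[OF 5(1)] eq1[OF 5(1)] weight_def by blast
    qed (use * eqs in auto)
  qed
qed

end
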